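(* Let $n\in\mathbb N$, let $\mu_{\Phi,n}$ be the product probability measure on $\mathbb R^n$ associated with a function $\Phi$ as in the context, and let $\|\cdot\|_{X(0,1)}$ be a rearrangement-invariant function norm. Let $k,h\in\mathbb N$. Then $$\big(X_{k,\Phi}\big)_{h,\Phi}(\mathbb R^n,\mu_{\Phi,n})=X_{k+h,\Phi}(\mathbb R^n,\mu_{\Phi,n}),$$ up to equivalent norms.
   Context: The measure. $\Phi:[0,\infty)\to[0,\infty)$ is a strictly increasing convex function, twice continuously differentiable in $(0,\infty)$, such that $\sqrt\Phi$ is concave and $\Phi(0)=0$. $\mu_\Phi$ is the probability measure on $\mathbb R$ given by $d\mu_\Phi(x)=c_\Phi e^{-\Phi(|x|)}dx$, with $c_\Phi$ a normalizing constant, and $\mu_{\Phi,n}=\mu_\Phi\times\dots\times\mu_\Phi$ ($n$ factors) on $\mathbb R^n$. Write $\mu=\mu_{\Phi,n}$. Rearrangement-invariant (r.i.) spaces. $\mathcal M_+(0,1)$ is the set of measurable functions $(0,1)\to[0,\infty]$. For a measurable $u:\mathbb R^n\to[-\infty,\infty]$, $u^*(s)=\sup\{t\in\mathbb R:\mu(\{x:|u(x)|>t\})>s\}$ for $s\in(0,1)$ (similarly for functions on $(0,1)$ with Lebesgue measure). An r.i. function norm is a functional $\|\cdot\|_{X(0,1)}:\mathcal M_+(0,1)\to[0,\infty]$ such that for all $f,g,f_j\in\mathcal M_+(0,1)$ and $\lambda\ge0$: (P1) $\|f\|=0$ iff $f=0$ a.e., $\|\lambda f\|=\lambda\|f\|$,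 $\|f+g\|\le\|f\|+\|g\|$; (P2) $f\le g$ a.e. implies $\|f\|\le\|g\|$; (P3) $f_j\nearrow f$ a.e. implies $\|f_j\|\nearrow\|f\|$; (P4) $\|1\|<\infty$; (P5) $\int_0^1f\,dx\le C\|f\|$ with $C$ independent of $f$; (P6) $\|f\|=\|g\|$ whenever $f^*=g^*$. The associate norm is $\|g\|_{X'(0,1)}=\sup\{\int_0^1fg\,ds:f\ge0,\ \|f\|_{X(0,1)}\le1\}$, again an r.i. function norm, and $X''=X$. The space $X(\mathbb R^n,\mu)$ consists of all measurable $u$ with $\|u\|_{X(\mathbb R^n,\mu)}:=\|u^*\|_{X(0,1)}<\infty$. The norms $X_{m,\Phi}$. For $m\in\mathbb N$ and an r.i. function norm $\|\cdot\|_{X(0,1)}$, let $\|\cdot\|_{\widetilde X_m(0,1)}$ be the r.i. function norm whose associate norm is $\|g\|_{\widetilde X_m'(0,1)}=\big\|\frac1s\int_0^s(\log\frac sr)^{m-1}g^*(r)\,dr\big\|_{X'(0,1)}$, $g\in\mathcal M_+(0,1)$, and let $$\|f\|_{X_{m,\Phi}(0,1)}=\left\|\left(\frac{\log\frac2s}{\Phi^{-1}(\log\frac2s)}\right)^mf^*(s)\right\|_{\widetilde X_m(0,1)},\qquad f\in\mathcal M_+(0,1)$$ (an r.i. function norm). The space $(X_{k,\Phi})_{h,\Phi}$ is obtained by applying this construction with $m=h$ to the norm $\|\cdot\|_{X_{k,\Phi}(0,1)}$. *)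

theory Defs
  imports "HOL-Analysis.Analysis"
begin

section \<open>The measure\<close>

definition admissible :: "(real \<Rightarrow> real) \<Rightarrow> bool" where
  "admissible \<Phi> \<longleftrightarrow>
     (\<forall>t\<ge>0. \<Phi> t \<ge> 0) \<and> \<Phi> 0 = 0 \<and>
     strict_mono_on {0..} \<Phi> \<and> convex_on {0..} \<Phi> \<and> concave_on {0..} (\<lambda>t. sqrt (\<Phi> t)) \<and>
     (\<exists>\<Phi>' \<Phi>''. (\<forall>t>0. (\<Phi> has_real_derivative \<Phi>' t) (at t)) \<and>
              (\<forall>t>0. (\<Phi>' has_real_derivative \<Phi>'' t) (at t)) \<and>
              continuous_on {0<..} \<Phi>'')"

definition norm_const :: "(real \<Rightarrow> real) \<Rightarrow> real" where
  "norm_const \<Phi> = 1 / (LINT x|lborel. exp (- \<Phi> \<bar>x\<bar>))"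

definition mu :: "(real \<Rightarrow> real) \<Rightarrow> real measure" where
  "mu \<Phi> = density lborel (\<lambda>x. ennreal (norm_const \<Phi> * exp (- \<Phi> \<bar>x\<bar>)))"

text \<open>The product of \<open>CARD('n)\<close> copies of \<open>mu \<Phi>\<close>, transported from functions \<open>'n \<Rightarrow> real\<close> to
  \<open>real ^ 'n\<close>. It is completed so that its measurable sets are the Lebesgue measurable ones, the
  density being positive.\<close>

definition mu_prod :: "(real \<Rightarrow> real) \<Rightarrow> (real ^ 'n) measure" where
  "mu_prod \<Phi> = completion (distr (Pi\<^sub>M (UNIV :: 'n set) (\<lambda>_. mu \<Phi>)) borel (\<lambda>f. \<chi> i. f i))"

section \<open>Rearrangement-invariant spaces\<close>

abbreviation unit_int :: "real measure" where
  "unit_int \<equiv> lebesgue_on {0<..<1}"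

text \<open>Functions on \<open>(0,1)\<close> are represented by total functions on the reals. Values outside
  \<open>(0,1)\<close> carry no information: measurability, the a.e. relations and the axioms of a function norm
  below only see the restriction to \<open>(0,1)\<close>.\<close>

abbreviation M_plus :: "(real \<Rightarrow> ennreal) set" where
  "M_plus \<equiv> borel_measurable unit_int"

text \<open>On a probability space and for \<open>s \<in> (0,1)\<close>, the set over which the supremum is taken contains
  every negative \<open>t\<close>, so the supremum is nonnegative and \<open>e2ennreal\<close> loses nothing.\<close>

definition rearr :: "'a measure \<Rightarrow> ('a \<Rightarrow> ereal) \<Rightarrow> real \<Rightarrow> ennreal" where
  "rearr M u s =
     e2ennreal (SUP t\<in>{t::real. emeasure M {x \<in> space M. \<bar>u x\<bar> > ereal t} > ennreal s}. ereal t)"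

definition rearr01 :: "(real \<Rightarrow> ennreal) \<Rightarrow> real \<Rightarrow> ennreal" where
  "rearr01 f = rearr unit_int (\<lambda>x. enn2ereal (f x))"

definition ri_norm :: "((real \<Rightarrow> ennreal) \<Rightarrow> ennreal) \<Rightarrow> bool" where
  "ri_norm X \<longleftrightarrow>
     (\<forall>f\<in>M_plus. X f = 0 \<longleftrightarrow> (AE x in unit_int. f x = 0)) \<and>
     (\<forall>f\<in>M_plus. \<forall>c::real. c \<ge> 0 \<longrightarrow> X (\<lambda>x. ennreal c * f x) = ennreal c * X f) \<and>
     (\<forall>f\<in>M_plus. \<forall>g\<in>M_plus. X (\<lambda>x. f x + g x) \<le> X f + X g) \<and>
     (\<forall>f\<in>M_plus. \<forall>g\<in>M_plus. (AE x in unit_int. f x \<le> g x) \<longrightarrow> X f \<le> X g) \<and>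
     (\<forall>F. \<forall>f\<in>M_plus. (\<forall>j::nat. F j \<in> M_plus) \<and>
        (AE x in unit_int. incseq (\<lambda>j. F j x) \<and> (\<lambda>j. F j x) \<longlonglongrightarrow> f x) \<longrightarrow>
        incseq (\<lambda>j. X (F j)) \<and> (\<lambda>j. X (F j)) \<longlonglongrightarrow> X f) \<and>
     X (\<lambda>_. 1) < \<infinity> \<and>
     (\<exists>C::real. \<forall>f\<in>M_plus. (\<integral>\<^sup>+x. f x \<partial>unit_int) \<le> ennreal C * X f) \<and>
     (\<forall>f\<in>M_plus. \<forall>g\<in>M_plus. (\<forall>s\<in>{0<..<1}. rearr01 f s = rearr01 g s) \<longrightarrow> X f = X g)"

definition assoc :: "((real \<Rightarrow> ennreal) \<Rightarrow> ennreal) \<Rightarrow> (real \<Rightarrow> ennreal) \<Rightarrow> ennreal" where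
  "assoc X g = (SUP f\<in>{f\<in>M_plus. X f \<le> 1}. \<integral>\<^sup>+s. f s * g s \<partial>unit_int)"

definition ri_space_norm ::
    "'a measure \<Rightarrow> ((real \<Rightarrow> ennreal) \<Rightarrow> ennreal) \<Rightarrow> ('a \<Rightarrow> ereal) \<Rightarrow> ennreal" where
  "ri_space_norm M X u = X (rearr M u)"

definition ri_space :: "'a measure \<Rightarrow> ((real \<Rightarrow> ennreal) \<Rightarrow> ennreal) \<Rightarrow> ('a \<Rightarrow> ereal) set" where
  "ri_space M X = {u \<in> borel_measurable M. ri_space_norm M X u < \<infinity>}"

definition same_space_equiv_norms ::
    "'a measure \<Rightarrow> ((real \<Rightarrow> ennreal) \<Rightarrow> ennreal) \<Rightarrow> ((real \<Rightarrow> ennreal) \<Rightarrow> ennreal) \<Rightarrow> bool" where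
  "same_space_equiv_norms M X Y \<longleftrightarrow>
     ri_space M X = ri_space M Y \<and>
     (\<exists>c C::real. 0 < c \<and> 0 < C \<and>
        (\<forall>u\<in>ri_space M X. ennreal c * ri_space_norm M X u \<le> ri_space_norm M Y u \<and>
                          ri_space_norm M Y u \<le> ennreal C * ri_space_norm M X u))"

section \<open>The norms \<open>X\<^sub>m\<^sub>,\<^sub>\<Phi>\<close>\<close>

text \<open>The definitions of this section are meaningful for \<open>m \<ge> 1\<close>.\<close>

definition tilde_assoc ::
    "((real \<Rightarrow> ennreal) \<Rightarrow> ennreal) \<Rightarrow> nat \<Rightarrow> (real \<Rightarrow> ennreal) \<Rightarrow> ennreal" where
  "tilde_assoc X m g =
     assoc X (\<lambda>s. ennreal (1 / s) *
       (\<integral>\<^sup>+r. ennreal (ln (s / r) ^ (m - 1)) * rearr01 g r \<partial>lebesgue_on {0<..<s}))"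

text \<open>The r.i. function norm whose associate norm is \<open>tilde_assoc X m\<close>. By \<open>X'' = X\<close> it is
  determined on \<open>M_plus\<close>; its values on other functions are left open, hence \<open>SOME\<close> and
  not \<open>THE\<close>.\<close>

definition tilde :: "((real \<Rightarrow> ennreal) \<Rightarrow> ennreal) \<Rightarrow> nat \<Rightarrow> (real \<Rightarrow> ennreal) \<Rightarrow> ennreal" where
  "tilde X m = (SOME Z. ri_norm Z \<and> (\<forall>g\<in>M_plus. assoc Z g = tilde_assoc X m g))"

definition X_norm ::
    "(real \<Rightarrow> real) \<Rightarrow> nat \<Rightarrow> ((real \<Rightarrow> ennreal) \<Rightarrow> ennreal) \<Rightarrow> (real \<Rightarrow> ennreal) \<Rightarrow> ennreal" where
  "X_norm \<Phi> m X f =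
     tilde X m (\<lambda>s. ennreal ((ln (2 / s) / inv_into {0..} \<Phi> (ln (2 / s))) ^ m) * rearr01 f s)"

end

theory Submission
  imports Defs
begin

text \<open>
  Put \<open>w(s) = ln(2/s) / \<Phi>\<^sup>-\<^sup>1(ln(2/s))\<close> and \<open>S m g (s) = 1/s \<integral>\<^sub>0\<^sup>s ln(s/r)\<^sup>m\<^sup>-\<^sup>1 g(r) dr\<close>. By the
  Lorentz--Luxemburg theorem, and because rearrangements on \<open>(0,1)\<close> are realised by measure preserving
  maps, the norm of \<open>f\<close> in \<open>X\<^sub>m\<^sub>,\<^sub>\<Phi>\<close> is the supremum of \<open>\<integral> w\<^sup>m f\<^sup>* g\<close> over the decreasing functions \<open>g\<close>
  for which \<open>S m g\<close> has associate norm at most 1. By induction on \<open>k\<close>, with \<open>X\<^sub>1\<^sub>,\<^sub>\<Phi>\<close> in place of \<open>X\<close>,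
  it suffices to compare \<open>(X\<^sub>1\<^sub>,\<^sub>\<Phi>)\<^sub>h\<^sub>,\<^sub>\<Phi>\<close> with \<open>X\<^sub>1\<^sub>+\<^sub>h\<^sub>,\<^sub>\<Phi>\<close>.

  The weight \<open>w\<close> decreases, whereas \<open>w(s) / sqrt(ln(2/s))\<close> increases. For one inequality, \<open>g\<close> is
  replaced by \<open>w g\<close>: the square root of a logarithm that \<open>S h (w g) / w\<close> loses against \<open>S h g\<close> is
  regained by one more averaging. For the other one, \<open>g\<close> is replaced by the least decreasing majorant
  of \<open>g / w\<close>, and the associate norm of \<open>X\<^sub>1\<^sub>,\<^sub>\<Phi>\<close> is tested with the functions \<open>(1/w(s)) \<integral>\<^sub>s\<^sup>1 F(r)/r dr\<close>
  for decreasing \<open>F\<close>, modified where the majorant of \<open>S h g / w\<close> is attained far to the right.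
\<close>

section \<open>The unit interval\<close>

text \<open>Comparisons are made in pairings with decreasing functions, where by Hardy's lemma only
  the integrals over the intervals \<open>{..<t}\<close> count. This is decisive, since pointwise
  estimates fail: in general \<open>S h (w g)\<close> is not bounded by a multiple of
  \<open>w\<close> times \<open>S h g\<close>. After integration over \<open>(0, t)\<close> the
  excess \<open>sqrt (ln (2 / r))\<close> meets the integral of
  \<open>1 / (s sqrt (ln (2 / s)))\<close> over \<open>(r, t)\<close>, and the product is at most
  \<open>2 ln (t / r)\<close>. For the reverse inequality the obstacle is that division by
  \<open>w\<close> destroys monotonicity: the majorant at \<open>r\<close> may take its value from a
  point \<open>b\<close> far to the right. A block of height \<open>1 / (b w(b))\<close> over
  \<open>(0, b)\<close> recovers this value, but near 0 it is multiplied by the possibly unbounded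
  \<open>w(s)\<close>. For \<open>r < s\<close> an integrable power of \<open>s\<close> absorbs this
  growth; for \<open>s \<le> r\<close> it is absorbed by the convexity of \<open>Q 1 F\<close> in
  the logarithmic variable and by \<open>b \<ge> sqrt r / 2\<close>, which leave the integrable
  power \<open>r powr (- 3 / 4)\<close>. The constants \<open>2\<close> and \<open>532 h\<close> of
  a single step depend neither on \<Phi> nor on the norm.\<close>

lemma ennreal_cancel:
  assumes "0 < c"
  shows "ennreal (1 / c) * (ennreal c * x) = x" "ennreal c * (ennreal (1 / c) * x) = x"
  using assms by (simp_all add: mult.assoc[symmetric] flip: ennreal_mult)

lemma ennreal_le_inverse:
  assumes "0 < c" "ennreal c * x \<le> 1"
  shows "x \<le> ennreal (1 / c)"
  using mult_left_mono[OF assms(2), of "ennreal (1 / c)"] by (simp add: ennreal_cancel(1)[OF assms(1)])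

lemma ennreal_le_scaled:
  assumes "0 < c" "ennreal (1 / c) * x \<le> 1"
  shows "x \<le> ennreal c"
  using ennreal_le_inverse[of "1 / c" x] assms by simp

abbreviation unit_integral :: "(real \<Rightarrow> ennreal) \<Rightarrow> ennreal"  (binder "\<integral>\<^sub>1" 10) where
  "unit_integral f \<equiv> integral\<^sup>N unit_int f"

lemma space_unit_int: "space unit_int = {0<..<1}"
  by (simp add: space_restrict_space)

lemma sets_unit_intI: "A \<in> sets borel \<Longrightarrow> A \<subseteq> {0<..<1} \<Longrightarrow> A \<in> sets unit_int"
  by (subst sets_restrict_space_iff) auto

lemma emeasure_unit_int: "A \<subseteq> {0<..<1} \<Longrightarrow> emeasure unit_int A = emeasure lebesgue A"
  by (rule emeasure_restrict_space) auto

interpretation unit_int: finite_measure unit_int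
  by (rule finite_measureI) (simp add: space_unit_int emeasure_unit_int)

interpretation unit_int2: pair_sigma_finite unit_int unit_int
  by standard

interpretation unit_int_lborel: pair_sigma_finite unit_int lborel
  by standard

lemma measurable_id_unit_int [measurable]: "(\<lambda>x. x) \<in> borel_measurable unit_int"
  by (rule measurable_restrict_space1) (auto simp: measurable_def)

lemma unit_integral_eq_lborel:
  assumes "f \<in> borel_measurable borel"
  shows "(\<integral>\<^sub>1x. f x) = (\<integral>\<^sup>+x. f x * indicator {0<..<1} x \<partial>lborel)"
  by (subst nn_integral_restrict_space) (auto simp: nn_integral_completion)

lemma unit_integral_cong:
  "(\<And>x. 0 < x \<Longrightarrow> x < 1 \<Longrightarrow> f x = g x) \<Longrightarrow> (\<integral>\<^sub>1x. f x) = (\<integral>\<^sub>1x. g x)"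
  by (rule nn_integral_cong) (auto simp: space_unit_int)

lemma unit_integral_mono:
  "(\<And>x. 0 < x \<Longrightarrow> x < 1 \<Longrightarrow> f x \<le> g x) \<Longrightarrow> (\<integral>\<^sub>1x. f x) \<le> (\<integral>\<^sub>1x. g x)"
  by (rule nn_integral_mono) (auto simp: space_unit_int)

lemma AE_unit_int_neq: "AE x in unit_int. x \<noteq> (c::real)"
proof (cases "c \<in> {0<..<1}")
  case True
  then have "emeasure unit_int {c} = 0"
    by (subst emeasure_unit_int) auto
  moreover have "{c} \<in> sets unit_int" using True by (intro sets_unit_intI) auto
  ultimately have "{c} \<in> null_sets unit_int" by auto
  then show ?thesis by (rule AE_I'[where N="{c}"]) auto
next
  case False
  then show ?thesis by (intro AE_I2) (auto simp: space_unit_int)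
qed

lemma emeasure_unit_int_interval:
  assumes "0 \<le> c" "c \<le> 1"
  shows "emeasure unit_int {0<..<c} = ennreal c" "c < 1 \<Longrightarrow> emeasure unit_int {0<..c} = ennreal c"
  using assms by (subst emeasure_unit_int; auto)+

lemma unit_int_FTC:
  fixes f F :: "real \<Rightarrow> real"
  assumes "f \<in> borel_measurable borel" "0 < a" "a \<le> b" "b \<le> 1"
    and "\<And>x. a \<le> x \<Longrightarrow> x \<le> b \<Longrightarrow> (F has_real_derivative f x) (at x)"
    and "\<And>x. a \<le> x \<Longrightarrow> x \<le> b \<Longrightarrow> 0 \<le> f x"
  shows "(\<integral>\<^sub>1x. ennreal (f x) * indicator {a<..<b} x) = ennreal (F b - F a)"
proof -
  have ae: "AE x in lborel. x \<noteq> a \<and> x \<noteq> b"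
    using AE_lborel_singleton[of a] AE_lborel_singleton[of b] by auto
  have "(\<integral>\<^sub>1x. ennreal (f x) * indicator {a<..<b} x)
      = (\<integral>\<^sup>+x. ennreal (f x) * indicator {a<..<b} x * indicator {0<..<1} x \<partial>lborel)"
    using assms(1) by (intro unit_integral_eq_lborel) auto
  also have "\<dots> = (\<integral>\<^sup>+x. ennreal (f x) * indicator {a..b} x \<partial>lborel)"
    using ae assms(2-4) by (intro nn_integral_cong_AE) (auto split: split_indicator)
  also have "\<dots> = F b - F a"
    using assms by (intro nn_integral_FTC_Icc) auto
  finally show ?thesis .
qed

lemma unit_int_powr:
  assumes "-1 < p" "0 \<le> b" "b \<le> 1"
  shows "(\<integral>\<^sub>1x. ennreal (x powr p) * indicator {0<..<b} x) = ennreal (b powr (p + 1) / (p + 1))"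
proof -
  have ae: "AE x in lborel. x \<noteq> 0 \<and> x \<noteq> b"
    using AE_lborel_singleton[of 0] AE_lborel_singleton[of b] by auto
  have "(\<integral>\<^sub>1x. ennreal (x powr p) * indicator {0<..<b} x)
      = (\<integral>\<^sup>+x. ennreal (x powr p) * indicator {0<..<b} x * indicator {0<..<1} x \<partial>lborel)"
    by (intro unit_integral_eq_lborel) auto
  also have "\<dots> = (\<integral>\<^sup>+x. ennreal (x powr p) * indicator {0..b} x \<partial>lborel)"
    using ae assms by (intro nn_integral_cong_AE) (auto split: split_indicator)
  also have "\<dots> = ennreal (b powr (p + 1) / (p + 1))"
    using has_integral_powr_from_0[OF assms(1,2)] by (intro nn_integral_has_integral_lebesgue') auto
  finally show ?thesis .
qed

section \<open>Decreasing functions\<close>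

definition decr :: "(real \<Rightarrow> ennreal) \<Rightarrow> bool" where
  "decr f \<longleftrightarrow> (\<forall>x y. 0 < x \<longrightarrow> x \<le> y \<longrightarrow> y < 1 \<longrightarrow> f y \<le> f x)"

lemma decrI: "(\<And>x y. 0 < x \<Longrightarrow> x \<le> y \<Longrightarrow> y < 1 \<Longrightarrow> f y \<le> f x) \<Longrightarrow> decr f"
  by (simp add: decr_def)

lemma decrD: "decr f \<Longrightarrow> 0 < x \<Longrightarrow> x \<le> y \<Longrightarrow> y < 1 \<Longrightarrow> f y \<le> f x"
  by (simp add: decr_def)

lemma decr_const: "decr (\<lambda>_. c)"
  by (simp add: decr_def)

lemma decr_mult: "decr f \<Longrightarrow> decr g \<Longrightarrow> decr (\<lambda>x. f x * g x)"
  by (auto simp: decr_def intro!: mult_mono)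

lemma decr_add: "decr f \<Longrightarrow> decr g \<Longrightarrow> decr (\<lambda>x. f x + g x)"
  by (auto simp: decr_def intro!: add_mono)

text \<open>The possible superlevel sets of a decreasing function, which need not be continuous from
  either side: the end point \<open>c\<close> may or may not belong to the set. \<open>c = 0\<close>
  encodes the empty set, and the closed form demands \<open>c < 1\<close> to stay inside
  \<open>(0,1)\<close>.\<close>

definition segment :: "real \<Rightarrow> real set \<Rightarrow> bool" where
  "segment c A \<longleftrightarrow> 0 \<le> c \<and> c \<le> 1 \<and> (A = {0<..<c} \<or> A = {0<..c} \<and> c < 1)"

lemma segment_cases:
  assumes "segment c A"
  obtains "0 \<le> c" "c \<le> 1" "A = {0<..<c}" | "0 \<le> c" "c < 1" "A = {0<..c}"
  using assms by (auto simp: segment_def)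

lemma segment_bounds: "segment c A \<Longrightarrow> 0 \<le> c" "segment c A \<Longrightarrow> c \<le> 1"
  by (simp_all add: segment_def)

lemma segment_memD: "segment c A \<Longrightarrow> 0 < x \<Longrightarrow> x \<noteq> c \<Longrightarrow> x \<in> A \<longleftrightarrow> x < c"
  by (erule segment_cases) auto

lemma segment_sets: "segment c A \<Longrightarrow> A \<in> sets unit_int"
  by (erule segment_cases; intro sets_unit_intI) auto

lemma emeasure_segment: "segment c A \<Longrightarrow> emeasure unit_int A = ennreal c"
  using emeasure_unit_int_interval[of c] by (elim segment_cases) auto

lemma initial_segment:
  assumes "A \<subseteq> {0<..<1::real}" "\<And>x y. x \<in> A \<Longrightarrow> 0 < y \<Longrightarrow> y \<le> x \<Longrightarrow> y \<in> A"
  shows "\<exists>c. segment c A"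
proof (cases "A = {}")
  case True
  then show ?thesis by (intro exI[of _ 0]) (auto simp: segment_def)
next
  case False
  define c where "c = Sup A"
  have bdd: "bdd_above A" using assms(1) by (intro bdd_aboveI[of _ 1]) auto
  have up: "x \<le> c" if "x \<in> A" for x unfolding c_def using that bdd by (rule cSup_upper)
  obtain a where a: "a \<in> A" using False by blast
  have "0 < a" using a assms(1) by auto
  then have c0: "0 < c" using up[OF a] by linarith
  have c1: "c \<le> 1" unfolding c_def using assms(1) by (intro cSup_least[OF False]) auto
  have low: "y \<in> A" if y: "0 < y" "y < c" for y
  proof -
    obtain x where "x \<in> A" "y < x" using y(2) less_cSup_iff[OF False bdd] unfolding c_def by blast
    then show ?thesis using assms(2) y(1) by auto
  qed
  have A: "A \<subseteq> {0<..c}" using up assms(1) by auto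
  show ?thesis
  proof (cases "c \<in> A")
    case True
    then have "A = {0<..c}" using A low by (auto simp: le_less)
    moreover have "c < 1" using True assms(1) by auto
    ultimately show ?thesis using c0 c1 by (intro exI[of _ c]) (auto simp: segment_def)
  next
    case False
    then have "A = {0<..<c}" using A low by (auto simp: le_less)
    then show ?thesis using c0 c1 by (intro exI[of _ c]) (auto simp: segment_def)
  qed
qed

lemma decr_superlevel:
  assumes "decr f"
  shows "\<exists>c. segment c {x\<in>{0<..<1}. v < f x}"
  using decrD[OF assms] by (intro initial_segment) (auto intro: less_le_trans)

lemma decr_measurable [measurable_dest]:
  assumes "decr f"
  shows "f \<in> M_plus"
proof (rule borel_measurableI_greater)
  fix y
  show "{x \<in> space unit_int. y < f x} \<in> sets unit_int"
    using decr_superlevel[OF assms, of y] segment_sets unfolding space_unit_int by blast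
qed

section \<open>Rearrangements\<close>

definition distrib :: "(real \<Rightarrow> ennreal) \<Rightarrow> ennreal \<Rightarrow> ennreal" where
  "distrib f v = emeasure unit_int {x\<in>{0<..<1}. v < f x}"

lemma distrib_sets [measurable]: "f \<in> M_plus \<Longrightarrow> {x\<in>{0<..<1}. v < f x} \<in> sets unit_int"
  using measurable_sets[of f unit_int borel "{v<..}"] by (simp add: space_unit_int vimage_def Int_def conj_commute)

lemma distrib_le_1: "distrib f v \<le> 1"
proof -
  have "distrib f v \<le> emeasure unit_int {0<..<1}"
    unfolding distrib_def by (intro emeasure_mono) (auto intro!: sets_unit_intI)
  then show ?thesis using emeasure_unit_int_interval(1)[of 1] by simp
qed

lemma ennreal_eq_layers:
  "(\<integral>\<^sup>+v. indicator {v. 0 \<le> v \<and> ennreal v < y} v \<partial>lborel) = y"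
proof (cases y)
  case (real t)
  then have "{v. 0 \<le> v \<and> ennreal v < y} = {0..<t}"
    by (auto simp: ennreal_less_iff)
  then show ?thesis using real by simp
next
  case top
  then have e: "{v. 0 \<le> v \<and> ennreal v < y} = {0..}" by auto
  have "of_nat n \<le> emeasure lborel {0::real..}" for n
    using emeasure_mono[of "{0..real n}" "{0::real..}" lborel] by (simp add: ennreal_of_nat_eq_real_of_nat)
  then have "emeasure lborel {0::real..} = top"
    using ennreal_Ex_less_of_nat[of "emeasure lborel {0::real..}"] by (metis leD top.not_eq_extremum)
  then show ?thesis using top e by simp
qed

text \<open>\<open>f x\<close> is the length of the set of real levels \<open>v \<ge> 0\<close>
  below it, an infinite value being an infinite length; then the integrals are interchanged.\<close>

lemma layer_cake:
  assumes [measurable]: "f \<in> M_plus" "k \<in> M_plus"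
  shows "(\<integral>\<^sub>1x. f x * k x)
    = (\<integral>\<^sup>+v. indicator {0..} v * (\<integral>\<^sub>1x. indicator {x. ennreal v < f x} x * k x) \<partial>lborel)"
proof -
  have "(\<integral>\<^sub>1x. f x * k x)
      = (\<integral>\<^sub>1x. (\<integral>\<^sup>+v. indicator {v. 0 \<le> v \<and> ennreal v < f x} v * k x \<partial>lborel))"
    by (intro nn_integral_cong) (subst nn_integral_multc, auto simp: ennreal_eq_layers)
  also have "\<dots> = (\<integral>\<^sup>+v. (\<integral>\<^sub>1x. indicator {v. 0 \<le> v \<and> ennreal v < f x} v * k x) \<partial>lborel)"
    by (rule unit_int_lborel.Fubini'[symmetric]) measurable
  also have "\<dots> = (\<integral>\<^sup>+v. indicator {0..} v * (\<integral>\<^sub>1x. indicator {x. ennreal v < f x} x * k x) \<partial>lborel)"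
    by (intro nn_integral_cong) (auto split: split_indicator intro!: nn_integral_cong)
  finally show ?thesis .
qed

lemma layer_cake_mono:
  assumes "f \<in> M_plus" "k \<in> M_plus" "f' \<in> M_plus" "k' \<in> M_plus"
    and "\<And>v. v < top \<Longrightarrow> (\<integral>\<^sub>1x. indicator {x. v < f x} x * k x)
                        \<le> (\<integral>\<^sub>1x. indicator {x. v < f' x} x * k' x)"
  shows "(\<integral>\<^sub>1x. f x * k x) \<le> (\<integral>\<^sub>1x. f' x * k' x)"
  unfolding layer_cake[OF assms(1,2)] layer_cake[OF assms(3,4)]
  by (intro nn_integral_mono mult_left_mono assms(5)) auto

lemma nn_integral_superlevel:
  assumes "f \<in> M_plus"
  shows "(\<integral>\<^sub>1x. indicator {x. v < f x} x) = distrib f v"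
proof -
  have "(\<integral>\<^sub>1x. indicator {x. v < f x} x) = (\<integral>\<^sub>1x. indicator {x\<in>{0<..<1}. v < f x} x)"
    by (rule unit_integral_cong) (auto split: split_indicator)
  also have "\<dots> = distrib f v" unfolding distrib_def using distrib_sets[OF assms] by simp
  finally show ?thesis .
qed

lemma nn_integral_segment:
  assumes "segment c {x\<in>{0<..<1}. P x}"
  shows "(\<integral>\<^sub>1x. indicator {x. P x} x * k x) = (\<integral>\<^sub>1x. k x * indicator {..<c} x)"
proof (rule nn_integral_cong_AE)
  show "AE x in unit_int. indicator {x. P x} x * k x = k x * indicator {..<c} x"
    using AE_unit_int_neq[of c] AE_space
  proof eventually_elim
    case (elim x)
    then have x: "x \<in> {0<..<1}" by (simp add: space_unit_int)
    then have "P x \<longleftrightarrow> x < c" using segment_memD[OF assms, of x] elim(1) by simp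
    then show ?case by (simp split: split_indicator)
  qed
qed

text \<open>Hardy's lemma. By the layer-cake formula \<open>H\<close> may be replaced by the
  indicators of its superlevel sets. These are initial intervals up to an end point of measure zero,
  and for initial intervals the inequality is the hypothesis.\<close>

lemma hardy:
  assumes "decr H" "a \<in> M_plus" "b \<in> M_plus"
    and "\<And>t. 0 < t \<Longrightarrow> t \<le> 1 \<Longrightarrow> (\<integral>\<^sub>1x. a x * indicator {..<t} x) \<le> (\<integral>\<^sub>1x. b x * indicator {..<t} x)"
  shows "(\<integral>\<^sub>1x. H x * a x) \<le> (\<integral>\<^sub>1x. H x * b x)"
proof (rule layer_cake_mono)
  fix v :: ennreal
  obtain c where A: "segment c {x\<in>{0<..<1}. v < H x}"
    using decr_superlevel[OF assms(1)] by blast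
  note c = segment_bounds[OF A]
  have "(\<integral>\<^sub>1x. a x * indicator {..<c} x) \<le> (\<integral>\<^sub>1x. b x * indicator {..<c} x)"
  proof (cases "c = 0")
    case True
    then have "(\<integral>\<^sub>1x. a x * indicator {..<c} x) = (\<integral>\<^sub>1x. 0)"
      by (intro unit_integral_cong) auto
    then show ?thesis by simp
  qed (use c assms(4) in auto)
  then show "(\<integral>\<^sub>1x. indicator {x. v < H x} x * a x) \<le> (\<integral>\<^sub>1x. indicator {x. v < H x} x * b x)"
    by (simp add: nn_integral_segment[OF A])
qed (use assms decr_measurable in auto)

section \<open>The rearrangement as generalized inverse of the distribution function\<close>

lemma decr_rearr: "decr (rearr M u)"
  unfolding rearr_def
  by (rule decrI, rule e2ennreal_mono, rule SUP_subset_mono) (auto intro: le_less_trans ennreal_leI)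

lemma decr_rearr01: "decr (rearr01 f)"
  unfolding rearr01_def by (rule decr_rearr)

lemma rearr01_measurable [measurable]: "rearr01 f \<in> M_plus"
  by (rule decr_measurable[OF decr_rearr01])

lemma distrib_right_continuous:
  assumes [measurable]: "f \<in> M_plus" and "r < distrib f (ennreal t)" "0 \<le> t"
  shows "\<exists>t'>t. r < distrib f (ennreal t')"
proof -
  define A where "A n = {x\<in>{0<..<1}. ennreal (t + 1 / real (Suc n)) < f x}" for n
  have "(\<Union>n. A n) = {x\<in>{0<..<1}. ennreal t < f x}"
  proof (intro equalityI subsetI)
    fix x assume "x \<in> (\<Union>n. A n)"
    then obtain n where "x \<in> {0<..<1}" "ennreal (t + 1 / real (Suc n)) < f x" by (auto simp: A_def)
    moreover have "ennreal t \<le> ennreal (t + 1 / real (Suc n))" by (rule ennreal_leI) auto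
    ultimately show "x \<in> {x\<in>{0<..<1}. ennreal t < f x}" by (auto intro: le_less_trans)
  next
    fix x assume x: "x \<in> {x\<in>{0<..<1}. ennreal t < f x}"
    have "\<exists>n. ennreal (t + 1 / real (Suc n)) < f x"
    proof (cases "f x")
      case (real y)
      then have "t < y" using x assms(3) by (auto simp: ennreal_less_iff)
      then obtain n where "inverse (real (Suc n)) < y - t" using reals_Archimedean[of "y - t"] by auto
      then have "t + 1 / real (Suc n) < y" by (simp add: field_simps)
      then have "ennreal (t + 1 / real (Suc n)) < f x" using real assms(3) by (subst real, subst ennreal_less_iff) auto
      then show ?thesis ..
    qed auto
    then show "x \<in> (\<Union>n. A n)" using x by (auto simp: A_def)
  qed
  moreover have "range A \<subseteq> sets unit_int" using distrib_sets[OF assms(1)] unfolding A_def by blast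
  moreover have "incseq A"
  proof (rule incseq_SucI, rule subsetI)
    fix n x assume x: "x \<in> A n"
    have "ennreal (t + 1 / real (Suc (Suc n))) \<le> ennreal (t + 1 / real (Suc n))"
      by (rule ennreal_leI) (auto simp: field_simps)
    then show "x \<in> A (Suc n)" using x by (auto simp: A_def intro: le_less_trans)
  qed
  ultimately have "(SUP n. emeasure unit_int (A n)) = distrib f (ennreal t)"
    using SUP_emeasure_incseq[of A unit_int] by (simp add: distrib_def)
  then obtain n where "r < emeasure unit_int (A n)"
    using assms(2) by (metis less_SUP_iff)
  then show ?thesis by (intro exI[of _ "t + 1 / real (Suc n)"]) (auto simp: distrib_def A_def)
qed

text \<open>The Galois connection that replaces the defining supremum from here on. Strict
  inequalities are possible on both sides because the distribution function is right continuous: a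
  level at which it exceeds \<open>s\<close> can be raised a little.\<close>

lemma less_rearr01_iff:
  assumes [measurable]: "f \<in> M_plus" and "0 \<le> s"
  shows "v < rearr01 f s \<longleftrightarrow> ennreal s < distrib f v"
proof (cases v)
  case top
  have e: "{x\<in>{0<..<1::real}. top < f x} = {}" by auto
  show ?thesis unfolding top distrib_def e by simp
next
  case (real t)
  define T where "T = {t::real. emeasure unit_int {x \<in> space unit_int. \<bar>enn2ereal (f x)\<bar> > ereal t} > ennreal s}"
  have "\<bar>enn2ereal y\<bar> > ereal t \<longleftrightarrow> ennreal t < y" if "0 \<le> t" for y t
    using that by (cases y) (auto simp: ennreal_less_iff enn2ereal_ennreal)
  then have T: "t \<in> T \<longleftrightarrow> ennreal s < distrib f (ennreal t)" if "0 \<le> t" for t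
    using that by (simp add: T_def distrib_def space_unit_int)
  have R: "rearr01 f s = e2ennreal (SUP t\<in>T. ereal t)"
    by (simp add: rearr01_def rearr_def T_def)
  show ?thesis
  proof
    assume "v < rearr01 f s"
    then have "ereal t < (SUP t\<in>T. ereal t)"
      using real R by (metis e2ennreal_enn2ereal e2ennreal_mono enn2ereal_ennreal leD not_le)
    then obtain t' where t': "t' \<in> T" "t < t'" by (auto simp: less_SUP_iff)
    then have "ennreal s < distrib f (ennreal t')" using T[of t'] real by auto
    also have "\<dots> \<le> distrib f v" unfolding distrib_def
    proof (rule emeasure_mono)
      show "{x \<in> {0<..<1}. ennreal t' < f x} \<subseteq> {x \<in> {0<..<1}. v < f x}"
        using real t'(2) by (auto intro: le_less_trans[rotated] ennreal_leI)
    qed measurable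
    finally show "ennreal s < distrib f v" .
  next
    assume "ennreal s < distrib f v"
    then obtain t' where t': "t < t'" "ennreal s < distrib f (ennreal t')"
      using distrib_right_continuous[OF assms(1), of "ennreal s" t] real by auto
    then have "t' \<in> T" using T[of t'] real by auto
    then have "ereal t' \<le> (SUP t\<in>T. ereal t)" by (rule SUP_upper)
    then have "e2ennreal (ereal t') \<le> rearr01 f s" unfolding R by (rule e2ennreal_mono)
    then have "ennreal t' \<le> rearr01 f s" using real t' by (simp add: e2ennreal_ereal)
    moreover have "v < ennreal t'" using real t' by (simp add: ennreal_less_iff)
    ultimately show "v < rearr01 f s" by simp
  qed
qed

lemma segment_superlevel_rearr01:
  assumes "f \<in> M_plus"
  shows "segment (enn2real (distrib f v)) {x\<in>{0<..<1}. v < rearr01 f x}"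
proof -
  obtain c where c: "0 \<le> c" "distrib f v = ennreal c"
    using distrib_le_1[of f v] by (cases "distrib f v") (auto simp: top_unique)
  have "c \<le> 1" using distrib_le_1[of f v] c by simp
  have "v < rearr01 f x \<longleftrightarrow> x < c" if "0 < x" for x
    using that less_rearr01_iff[OF assms, of x v] c by (simp add: ennreal_less_iff)
  then show ?thesis using c \<open>c \<le> 1\<close> by (auto simp: segment_def)
qed

lemma distrib_segment: "segment c {x\<in>{0<..<1}. v < f x} \<Longrightarrow> distrib f v = ennreal c"
  unfolding distrib_def by (rule emeasure_segment)

lemma distrib_rearr01:
  assumes "f \<in> M_plus"
  shows "distrib (rearr01 f) v = distrib f v"
  using distrib_segment[OF segment_superlevel_rearr01[OF assms]] distrib_le_1[of f v]
  by (metis ennreal_enn2real_if ennreal_one_neq_top top_unique)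

lemma rearr01_cong:
  assumes "f \<in> M_plus" "g \<in> M_plus" "\<And>v. distrib f v = distrib g v" "0 \<le> s"
  shows "rearr01 f s = rearr01 g s"
  using less_rearr01_iff[OF assms(1,4)] less_rearr01_iff[OF assms(2,4)] assms(3)
  by (metis linorder_neq_iff order_less_irrefl)

lemma rearr01_rearr01: "f \<in> M_plus \<Longrightarrow> 0 \<le> s \<Longrightarrow> rearr01 (rearr01 f) s = rearr01 f s"
  by (rule rearr01_cong) (auto simp: distrib_rearr01)

text \<open>A decreasing \<open>f\<close> agrees with its rearrangement except possibly at its
  jumps. Under the integral this is seen level by level: both superlevel sets are segments with the
  same end point.\<close>

lemma nn_integral_rearr01_decr:
  assumes "decr f" and [measurable]: "k \<in> M_plus"
  shows "(\<integral>\<^sub>1x. rearr01 f x * k x) = (\<integral>\<^sub>1x. f x * k x)"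
proof -
  have [measurable]: "f \<in> M_plus" by (rule decr_measurable[OF assms(1)])
  have "(\<integral>\<^sub>1x. indicator {x. v < rearr01 f x} x * k x) = (\<integral>\<^sub>1x. indicator {x. v < f x} x * k x)" for v
  proof -
    obtain c where A: "segment c {x\<in>{0<..<1}. v < f x}"
      using decr_superlevel[OF assms(1)] by blast
    have "segment c {x\<in>{0<..<1}. v < rearr01 f x}"
      using segment_superlevel_rearr01[of f v] distrib_segment[OF A] segment_bounds(1)[OF A] by simp
    then show ?thesis using nn_integral_segment[OF A, of k] nn_integral_segment[of c "\<lambda>x. v < rearr01 f x" k]
      by simp
  qed
  note e = this
  show ?thesis
    by (rule antisym; rule layer_cake_mono) (measurable, simp only: e)+
qed

text \<open>Two applications of the layer-cake formula reduce the claim to sets: an intersection has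
  at most the smaller of the two measures, and initial intervals attain this bound because they are
  nested.\<close>

lemma hardy_littlewood:
  assumes [measurable]: "f \<in> M_plus" "g \<in> M_plus"
  shows "(\<integral>\<^sub>1x. f x * g x) \<le> (\<integral>\<^sub>1x. rearr01 f x * rearr01 g x)"
proof (rule layer_cake_mono)
  fix u :: ennreal
  let ?f = "\<lambda>x. indicator {x. u < f x} x :: ennreal"
  let ?f' = "\<lambda>x. indicator {x. u < rearr01 f x} x :: ennreal"
  have "(\<integral>\<^sub>1x. g x * ?f x) \<le> (\<integral>\<^sub>1x. rearr01 g x * ?f' x)"
  proof (rule layer_cake_mono)
    fix v :: ennreal
    let ?g = "\<lambda>x. indicator {x. v < g x} x :: ennreal"
    let ?g' = "\<lambda>x. indicator {x. v < rearr01 g x} x :: ennreal"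
    have "(\<integral>\<^sub>1x. ?g x * ?f x) \<le> min (\<integral>\<^sub>1x. ?f x) (\<integral>\<^sub>1x. ?g x)"
      by (intro min.boundedI nn_integral_mono) (auto split: split_indicator)
    also have "\<dots> = min (distrib f u) (distrib g v)"
      by (simp add: nn_integral_superlevel)
    also have "\<dots> \<le> (\<integral>\<^sub>1x. ?g' x * ?f' x)"
    proof -
      obtain c where c: "0 \<le> c" "distrib f u = ennreal c"
        using distrib_le_1[of f u] by (cases "distrib f u") (auto simp: top_unique)
      obtain d where d: "0 \<le> d" "distrib g v = ennreal d"
        using distrib_le_1[of g v] by (cases "distrib g v") (auto simp: top_unique)
      have le: "c \<le> 1" "d \<le> 1" using distrib_le_1[of f u] c distrib_le_1[of g v] d by auto
      have "min (distrib f u) (distrib g v) = emeasure unit_int {0<..<min c d}"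
        using c d le by (subst emeasure_unit_int_interval) (auto simp: min_def)
      also have "\<dots> = (\<integral>\<^sub>1x. indicator {0<..<min c d} x)"
        using c d le by (intro nn_integral_indicator[symmetric] sets_unit_intI) auto
      also have "\<dots> \<le> (\<integral>\<^sub>1x. ?g' x * ?f' x)"
      proof (rule unit_integral_mono)
        fix x :: real assume x: "0 < x" "x < 1"
        have "u < rearr01 f x \<longleftrightarrow> x < c" "v < rearr01 g x \<longleftrightarrow> x < d"
          using less_rearr01_iff[of f x u] less_rearr01_iff[of g x v] x c d by (auto simp: ennreal_less_iff)
        then show "indicator {0<..<min c d} x \<le> ?g' x * ?f' x" by (auto split: split_indicator)
      qed
      finally show ?thesis .
    qed
    finally show "(\<integral>\<^sub>1x. ?g x * ?f x) \<le> (\<integral>\<^sub>1x. ?g' x * ?f' x)" .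
  qed auto
  then show "(\<integral>\<^sub>1x. ?f x * g x) \<le> (\<integral>\<^sub>1x. ?f' x * rearr01 g x)"
    by (simp add: mult.commute)
qed auto

lemma rearr01_mono_AE:
  assumes [measurable]: "f \<in> M_plus" "g \<in> M_plus" and "AE x in unit_int. f x \<le> g x" "0 \<le> s"
  shows "rearr01 f s \<le> rearr01 g s"
proof (rule ccontr)
  assume "\<not> rearr01 f s \<le> rearr01 g s"
  then have "rearr01 g s < rearr01 f s" by simp
  then have "ennreal s < distrib f (rearr01 g s)" using less_rearr01_iff assms by blast
  also have "\<dots> \<le> distrib g (rearr01 g s)"
    unfolding nn_integral_superlevel[OF assms(1), symmetric] nn_integral_superlevel[OF assms(2), symmetric]
    using assms(3) by (intro nn_integral_mono_AE) (auto elim!: eventually_mono split: split_indicator)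
  finally have "rearr01 g s < rearr01 g s" using less_rearr01_iff assms by blast
  then show False by simp
qed

lemma ennreal_less_cmult_iff:
  assumes "0 < c"
  shows "v < ennreal c * x \<longleftrightarrow> ennreal (1 / c) * v < x"
proof -
  note inv = ennreal_cancel[OF assms]
  show ?thesis
  proof
    assume "v < ennreal c * x"
    then have "ennreal (1 / c) * v < ennreal (1 / c) * (ennreal c * x)"
      using assms by (intro ennreal_mult_strict_left_mono) auto
    then show "ennreal (1 / c) * v < x" by (simp add: inv)
  next
    assume "ennreal (1 / c) * v < x"
    then have "ennreal c * (ennreal (1 / c) * v) < ennreal c * x"
      using assms by (intro ennreal_mult_strict_left_mono) auto
    then show "v < ennreal c * x" by (simp add: inv)
  qed
qed

lemma ennreal_eqI_less: "(\<And>v. v < x \<longleftrightarrow> v < y) \<Longrightarrow> x = (y::ennreal)"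
  by (metis linorder_neq_iff order_less_irrefl)

lemma rearr01_zero:
  assumes [measurable]: "f \<in> M_plus" and "AE x in unit_int. f x = 0" "0 \<le> s"
  shows "rearr01 f s = 0"
proof -
  have "distrib f v = 0" for v
  proof -
    have "distrib f v = (\<integral>\<^sub>1x. 0)" unfolding nn_integral_superlevel[OF assms(1), symmetric]
      using assms(2) by (intro nn_integral_cong_AE) (auto elim!: eventually_mono split: split_indicator)
    then show ?thesis by simp
  qed
  then have "\<not> 0 < rearr01 f s" using less_rearr01_iff[OF assms(1,3)] by simp
  then show ?thesis by (simp add: zero_less_iff_neq_zero)
qed

lemma rearr01_cmult:
  assumes [measurable]: "f \<in> M_plus" and "0 \<le> c" "0 \<le> s"
  shows "rearr01 (\<lambda>x. ennreal c * f x) s = ennreal c * rearr01 f s"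
proof (cases "c = 0")
  case True
  then show ?thesis using assms by (simp add: rearr01_zero)
next
  case False
  then have c: "0 < c" using assms by simp
  have d: "distrib (\<lambda>x. ennreal c * f x) v = distrib f (ennreal (1 / c) * v)" for v
    by (simp add: distrib_def ennreal_less_cmult_iff[OF c])
  show ?thesis
    by (rule ennreal_eqI_less) (use assms c in \<open>simp add: less_rearr01_iff d ennreal_less_cmult_iff\<close>)
qed

text \<open>The distribution functions converge by monotone convergence of indicators, and a strict
  inequality below a supremum is already attained by one member, so \<open>less_rearr01_iff\<close>
  carries the limit over.\<close>

lemma rearr01_SUP:
  assumes [measurable]: "\<And>j::nat. F j \<in> M_plus" "f \<in> M_plus"
    and ae: "AE x in unit_int. incseq (\<lambda>j. F j x) \<and> (\<lambda>j. F j x) \<longlonglongrightarrow> f x" and s: "0 \<le> s"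
  shows "(SUP j. rearr01 (F j) s) = rearr01 f s"
proof (rule ennreal_eqI_less)
  fix v
  have "distrib f v = (\<integral>\<^sub>1x. (SUP j. indicator {x. v < F j x} x))"
    unfolding nn_integral_superlevel[OF assms(2), symmetric]
  proof (rule nn_integral_cong_AE, use ae in eventually_elim)
    case (elim x)
    then have sup: "f x = (SUP j. F j x)" using LIMSEQ_SUP LIMSEQ_unique by blast
    show ?case
    proof (cases "v < f x")
      case True
      then obtain j where "v < F j x" unfolding sup by (auto simp: less_SUP_iff)
      then have "(1::ennreal) \<le> (SUP j. indicator {x. v < F j x} x)" by (intro SUP_upper2[of j]) auto
      moreover have "(SUP j. indicator {x. v < F j x} x) \<le> (1::ennreal)" by (intro SUP_least) (auto split: split_indicator)
      ultimately show ?thesis using True by (auto intro: antisym)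
    next
      case False
      then have "\<not> v < F j x" for j unfolding sup by (auto simp: less_SUP_iff)
      then show ?thesis using False by simp
    qed
  qed
  also have "\<dots> = (SUP j. distrib (F j) v)"
    unfolding nn_integral_superlevel[OF assms(1), symmetric]
  proof (rule nn_integral_monotone_convergence_SUP_AE)
    show "AE x in unit_int. indicator {x. v < F i x} x \<le> (indicator {x. v < F (Suc i) x} x :: ennreal)" for i
      using ae by eventually_elim (auto split: split_indicator dest!: incseq_SucD[of _ i])
  qed measurable
  finally show "v < (SUP j. rearr01 (F j) s) \<longleftrightarrow> v < rearr01 f s"
    using s by (simp add: less_SUP_iff less_rearr01_iff)
qed

section \<open>Measure preserving maps\<close>

lemma nn_integral_distrib:
  assumes "f \<in> M_plus"
  shows "(\<integral>\<^sub>1x. f x) = (\<integral>\<^sup>+v. indicator {0..} v * distrib f (ennreal v) \<partial>lborel)"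
  using layer_cake[OF assms, of "\<lambda>_. 1"] by (simp add: nn_integral_superlevel[OF assms])

lemma nn_integral_rearr01: "f \<in> M_plus \<Longrightarrow> (\<integral>\<^sub>1x. rearr01 f x) = (\<integral>\<^sub>1x. f x)"
  by (simp add: nn_integral_distrib distrib_rearr01)

text \<open>The strict superlevel set at height \<open>rearr01 g a\<close> may have measure less
  than \<open>a\<close>. Those at lower heights do not, and continuity of the measure from above
  passes this on to the weak superlevel set.\<close>

lemma rearr01_weak_superlevel:
  assumes [measurable]: "g \<in> M_plus" and a: "0 \<le> a" "a \<le> 1"
  shows "ennreal a \<le> emeasure unit_int {x\<in>{0<..<1}. rearr01 g a \<le> g x}"
proof (cases "rearr01 g a = 0")
  case True
  then have "{x\<in>{0<..<1}. rearr01 g a \<le> g x} = {0<..<1}" by auto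
  then show ?thesis using a emeasure_unit_int_interval(1)[of 1] by (auto intro: ennreal_leI)
next
  case False
  then have pos: "0 < rearr01 g a" by (simp add: zero_less_iff_neq_zero)
  obtain u where u: "\<And>n. u n < rearr01 g a" "u \<longlonglongrightarrow> rearr01 g a"
    using approx_from_below_dense_linorder[OF pos] by blast
  \<comment> \<open>The approximating levels \<open>u n\<close> need not be monotone; their running
    maxima make the sets \<open>B n\<close> decrease.\<close>
  define B where "B n = {x\<in>{0<..<1}. Max (u ` {..n}) < g x}" for n
  have B: "ennreal a \<le> emeasure unit_int (B n)" for n
  proof -
    have "Max (u ` {..n}) < rearr01 g a" using u(1) by (subst Max_less_iff) auto
    then have "ennreal a < distrib g (Max (u ` {..n}))"
      using less_rearr01_iff[OF assms(1) a(1)] by blast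
    then show ?thesis by (simp add: distrib_def B_def)
  qed
  have "(\<Inter>n. B n) \<subseteq> {x\<in>{0<..<1}. rearr01 g a \<le> g x}"
  proof
    fix x assume x: "x \<in> (\<Inter>n. B n)"
    have "u n \<le> g x" for n
    proof -
      have "u n \<le> Max (u ` {..n})" by (rule Max_ge) auto
      also have "\<dots> < g x" using x by (auto simp: B_def)
      finally show ?thesis by simp
    qed
    then have "rearr01 g a \<le> g x" using u(2) by (intro LIMSEQ_le_const2) auto
    then show "x \<in> {x\<in>{0<..<1}. rearr01 g a \<le> g x}" using x by (auto simp: B_def)
  qed
  moreover have meas: "{x\<in>{0<..<1}. rearr01 g a \<le> g x} \<in> sets unit_int"
    using measurable_sets[OF assms(1), of "{rearr01 g a..}"] by (simp add: space_unit_int vimage_def Int_def conj_commute)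
  ultimately have "emeasure unit_int (\<Inter>n. B n) \<le> emeasure unit_int {x\<in>{0<..<1}. rearr01 g a \<le> g x}"
    by (rule emeasure_mono)
  moreover have "(INF n. emeasure unit_int (B n)) = emeasure unit_int (\<Inter>n. B n)"
  proof (rule INF_emeasure_decseq)
    show "range B \<subseteq> sets unit_int" using distrib_sets[OF assms(1)] unfolding B_def by blast
    show "decseq B"
    proof (rule decseq_SucI, rule subsetI)
      fix n x assume "x \<in> B (Suc n)"
      moreover have "Max (u ` {..n}) \<le> Max (u ` {..Suc n})" by (rule Max_mono) auto
      ultimately show "x \<in> B n" by (auto simp: B_def)
    qed
  qed auto
  moreover have "ennreal a \<le> (INF n. emeasure unit_int (B n))" using B by (intro INF_greatest) auto
  ultimately show ?thesis by simp
qed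

text \<open>\<open>\<sigma> x\<close> is the measure of the set of predecessors of \<open>x\<close> when points are ordered
  lexicographically by decreasing \<open>g\<close>, then by increasing \<open>x\<close>.\<close>

lemma ryff:
  assumes [measurable]: "g \<in> M_plus"
  obtains \<sigma> where "\<sigma> \<in> borel_measurable unit_int" "\<And>x. 0 < \<sigma> x" "\<And>x. \<sigma> x < 1"
    "\<And>a. 0 \<le> a \<Longrightarrow> a \<le> 1 \<Longrightarrow> emeasure unit_int {x\<in>{0<..<1}. \<sigma> x < a} = ennreal a"
    "AE x in unit_int. rearr01 g (\<sigma> x) \<le> g x"
proof -
  define R where "R x = {y\<in>{0<..<1::real}. g x < g y \<or> (g y = g x \<and> y < x)}" for x
  define \<tau> where "\<tau> x = measure unit_int (R x)" for x
  have R_sets [measurable]: "R x \<in> sets unit_int" if "x \<in> {0<..<1}" for x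
  proof -
    have "{y \<in> space unit_int. g x < g y \<or> (g y = g x \<and> y < x)} \<in> sets unit_int" by measurable
    then show ?thesis by (simp add: R_def space_unit_int)
  qed
  have \<tau>_meas [measurable]: "\<tau> \<in> borel_measurable unit_int"
  proof -
    define Q where "Q = {p \<in> space (unit_int \<Otimes>\<^sub>M unit_int). g (fst p) < g (snd p) \<or> (g (snd p) = g (fst p) \<and> snd p < fst p)}"
    have "Q \<in> sets (unit_int \<Otimes>\<^sub>M unit_int)" unfolding Q_def by measurable
    then have [measurable]: "(\<lambda>x. emeasure unit_int (Pair x -` Q)) \<in> borel_measurable unit_int"
      by (rule unit_int.measurable_emeasure_Pair)
    have "(\<lambda>x. enn2real (emeasure unit_int (Pair x -` Q))) \<in> borel_measurable unit_int" by measurable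
    moreover have "enn2real (emeasure unit_int (Pair x -` Q)) = \<tau> x" if "x \<in> space unit_int" for x
    proof -
      have "Pair x -` Q = R x" using that by (auto simp: Q_def R_def space_pair_measure space_unit_int)
      then show ?thesis by (simp add: \<tau>_def measure_def)
    qed
    ultimately show ?thesis using measurable_cong[of unit_int "\<lambda>x. enn2real (emeasure unit_int (Pair x -` Q))" \<tau> borel] by blast
  qed
  have tau_sets: "{x\<in>{0<..<1}. \<tau> x < a} \<in> sets unit_int" "{x\<in>{0<..<1}. \<tau> x \<le> a} \<in> sets unit_int" for a
  proof -
    have "{x\<in>space unit_int. \<tau> x < a} \<in> sets unit_int" "{x\<in>space unit_int. \<tau> x \<le> a} \<in> sets unit_int" by measurable
    then show "{x\<in>{0<..<1}. \<tau> x < a} \<in> sets unit_int" "{x\<in>{0<..<1}. \<tau> x \<le> a} \<in> sets unit_int"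
      by (simp_all add: space_unit_int)
  qed
  \<comment> \<open>For each \<open>a\<close> there is a set \<open>L\<close> of measure exactly
    \<open>a\<close> that contains all predecessors of its points. It lies between
    \<open>{\<tau> < a}\<close> and \<open>{\<tau> \<le> a}\<close>, which forces \<tau> to be
    uniformly distributed.\<close>
  have main: "\<exists>L \<in> sets unit_int. measure unit_int L = a \<and> (\<forall>x\<in>L. x \<in> {0<..<1} \<and> \<tau> x \<le> a) \<and> (\<forall>x\<in>{0<..<1} - L. a \<le> \<tau> x)"
    if a: "0 < a" "a < 1" for a
  proof -
    define v where "v = rearr01 g a"
    define G where "G = {x\<in>{0<..<1}. v < g x}"
    define E where "E = {x\<in>{0<..<1}. g x = v}"
    have G: "G \<in> sets unit_int" unfolding G_def by (rule distrib_sets) fact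
    have E: "E \<in> sets unit_int"
      using measurable_sets[OF assms(1), of "{v}"] by (simp add: E_def space_unit_int vimage_def Int_def conj_commute)
    have "emeasure unit_int G \<le> ennreal a"
      using less_rearr01_iff[OF assms(1), of a v] a by (simp add: v_def G_def distrib_def not_less)
    then have G_le: "measure unit_int G \<le> a" using a by (simp add: unit_int.emeasure_eq_measure)
    have "G \<union> E = {x\<in>{0<..<1}. v \<le> g x}" by (auto simp: G_def E_def)
    then have "ennreal a \<le> emeasure unit_int (G \<union> E)"
      using rearr01_weak_superlevel[OF assms(1), of a] a by (simp add: v_def)
    then have "a \<le> measure unit_int (G \<union> E)" by (simp add: unit_int.emeasure_eq_measure)
    also have "\<dots> = measure unit_int G + measure unit_int E"
      by (rule unit_int.finite_measure_Union) (use G E in \<open>auto simp: G_def E_def\<close>)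
    finally have GE: "a \<le> measure unit_int G + measure unit_int E" .
    define m where "m x = measure unit_int (E \<inter> {0<..<x})" for x
    have seg: "E \<inter> {0<..<x} \<in> sets unit_int" if "0 \<le> x" "x \<le> 1" for x
      using that by (intro sets.Int[OF E] sets_unit_intI) auto
    have m_mono: "m x \<le> m y" "m y \<le> m x + (y - x)" if "0 \<le> x" "x \<le> y" "y \<le> 1" for x y
    proof -
      show "m x \<le> m y" unfolding m_def
        using that seg by (intro unit_int.finite_measure_mono) auto
      show "m y \<le> m x + (y - x)"
      proof (cases "x < y")
        case True
        have I: "{x..<y} \<inter> {0<..<1} \<in> sets unit_int" by (intro sets_unit_intI) auto
        have "m y \<le> measure unit_int ((E \<inter> {0<..<x}) \<union> ({x..<y} \<inter> {0<..<1}))" unfolding m_def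
          by (rule unit_int.finite_measure_mono) (use seg[of x] I that in \<open>auto simp: E_def\<close>)
        also have "\<dots> \<le> m x + measure unit_int ({x..<y} \<inter> {0<..<1})" unfolding m_def
          by (rule measure_Un_le) (use seg[of x] I that in simp_all)
        also have "emeasure unit_int ({x..<y} \<inter> {0<..<1}) \<le> emeasure lborel {x..<y}"
          by (subst emeasure_unit_int) (auto intro!: emeasure_mono)
        then have "measure unit_int ({x..<y} \<inter> {0<..<1}) \<le> y - x"
          using that by (simp add: unit_int.emeasure_eq_measure)
        finally show ?thesis by simp
      next
        case False
        then show ?thesis using that by simp
      qed
    qed
    have m_dist: "dist (m x) (m y) \<le> dist x y" if "x \<in> {0..1}" "y \<in> {0..1}" for x y
    proof (cases "x \<le> y")
      case True
      then show ?thesis using m_mono[of x y] that by (simp add: dist_real_def)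
    next
      case False
      then show ?thesis using m_mono[of y x] that by (simp add: dist_real_def)
    qed
    have "continuous_on {0..1} m"
      unfolding continuous_on_iff using m_dist by (meson le_less_trans)
    moreover have "m 0 = 0" by (simp add: m_def)
    moreover have "E \<inter> {0<..<1} = E" by (auto simp: E_def)
    then have "m 1 = measure unit_int E" by (simp add: m_def)
    \<comment> \<open>The level set \<open>E\<close> is cut at \<open>x0\<close> so that the cut
      part supplies exactly the measure missing in \<open>G\<close>. The intermediate value theorem
      applies because \<open>m\<close> is Lipschitz.\<close>
    ultimately obtain x0 where x0: "0 \<le> x0" "x0 \<le> 1" "m x0 = a - measure unit_int G"
      using IVT'[of m 0 "a - measure unit_int G" 1] G_le GE by auto
    define L where "L = G \<union> (E \<inter> {0<..<x0})"
    have L: "L \<in> sets unit_int" using G seg[OF x0(1,2)] by (simp add: L_def)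
    have mL: "measure unit_int L = a"
    proof -
      have "measure unit_int L = measure unit_int G + m x0" unfolding L_def m_def
        by (rule unit_int.finite_measure_Union) (use G seg[OF x0(1,2)] in \<open>auto simp: G_def E_def\<close>)
      then show ?thesis using x0(3) by simp
    qed
    have "x \<in> {0<..<1} \<and> \<tau> x \<le> a" if "x \<in> L" for x
    proof -
      have "R x \<subseteq> L" using that by (auto simp: L_def R_def G_def E_def)
      then have "\<tau> x \<le> measure unit_int L" unfolding \<tau>_def by (intro unit_int.finite_measure_mono L)
      then show ?thesis using that mL by (auto simp: L_def G_def E_def)
    qed
    moreover have "a \<le> \<tau> x" if x: "x \<in> {0<..<1} - L" for x
    proof -
      have "L \<subseteq> R x" using x by (auto simp: L_def R_def G_def E_def not_less)
      then have "measure unit_int L \<le> \<tau> x" unfolding \<tau>_def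
        using x by (intro unit_int.finite_measure_mono R_sets) auto
      then show ?thesis using mL by simp
    qed
    ultimately show ?thesis using L mL by blast
  qed
  have le: "a \<le> measure unit_int {x\<in>{0<..<1}. \<tau> x \<le> a}" if "0 < a" "a < 1" for a
  proof -
    obtain L where "L \<in> sets unit_int" "measure unit_int L = a" "\<forall>x\<in>L. x \<in> {0<..<1} \<and> \<tau> x \<le> a"
      using main[OF \<open>0 < a\<close> \<open>a < 1\<close>] by blast
    then show ?thesis using unit_int.finite_measure_mono[of L "{x\<in>{0<..<1}. \<tau> x \<le> a}"] tau_sets(2)[of a] by auto
  qed
  have ge: "measure unit_int {x\<in>{0<..<1}. \<tau> x < a} \<le> a" if "0 < a" "a < 1" for a
  proof -
    obtain L where "L \<in> sets unit_int" "measure unit_int L = a" "\<forall>x\<in>{0<..<1} - L. a \<le> \<tau> x"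
      using main[OF \<open>0 < a\<close> \<open>a < 1\<close>] by blast
    then show ?thesis using unit_int.finite_measure_mono[of "{x\<in>{0<..<1}. \<tau> x < a}" L] by force
  qed
  have ge2: "a \<le> measure unit_int {x\<in>{0<..<1}. \<tau> x < a}" if "0 < a" "a \<le> 1" for a
  proof (rule dense_le)
    fix y assume "y < a"
    define b where "b = max y (a / 2)"
    have b: "0 < b" "b < 1" "b < a" using \<open>y < a\<close> that by (auto simp: b_def)
    have "y \<le> b" by (simp add: b_def)
    also have "b \<le> measure unit_int {x\<in>{0<..<1}. \<tau> x \<le> b}" by (rule le[OF b(1,2)])
    also have "\<dots> \<le> measure unit_int {x\<in>{0<..<1}. \<tau> x < a}"
      by (rule unit_int.finite_measure_mono) (use b tau_sets in auto)
    finally show "y \<le> measure unit_int {x\<in>{0<..<1}. \<tau> x < a}" .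
  qed
  have total: "measure unit_int {0<..<1} = 1"
    using emeasure_unit_int_interval(1)[of 1] by (simp add: measure_def)
  have tau_less: "measure unit_int {x\<in>{0<..<1}. \<tau> x < a} = a" if a: "0 \<le> a" "a \<le> 1" for a
  proof -
    consider "a = 0" | "0 < a" "a < 1" | "a = 1" using a by linarith
    then show ?thesis
    proof cases
      case 1
      have "{x\<in>{0<..<1}. \<tau> x < 0} = {}" by (auto simp: \<tau>_def not_less)
      then show ?thesis unfolding 1 by (metis measure_empty)
    next
      case 2
      then show ?thesis using ge ge2 by (intro antisym) auto
    next
      case 3
      have "measure unit_int {x\<in>{0<..<1}. \<tau> x < a} \<le> measure unit_int {0<..<1}"
        by (rule unit_int.finite_measure_mono) (auto intro!: sets_unit_intI)
      then show ?thesis using 3 ge2[of 1] total by simp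
    qed
  qed
  have "measure unit_int {x\<in>{0<..<1}. \<tau> x \<le> 0} \<le> 0"
  proof (rule dense_ge)
    fix y :: real assume "0 < y"
    define b where "b = min y 1"
    have "measure unit_int {x\<in>{0<..<1}. \<tau> x \<le> 0} \<le> measure unit_int {x\<in>{0<..<1}. \<tau> x < b}"
      by (rule unit_int.finite_measure_mono[OF _ tau_sets(1)]) (use \<open>0 < y\<close> in \<open>auto simp: b_def\<close>)
    also have "\<dots> = b" using \<open>0 < y\<close> by (intro tau_less) (auto simp: b_def)
    also have "b \<le> y" by (simp add: b_def)
    finally show "measure unit_int {x\<in>{0<..<1}. \<tau> x \<le> 0} \<le> y" .
  qed
  then have "{x\<in>{0<..<1}. \<tau> x \<le> 0} \<in> null_sets unit_int"
    using tau_sets(2)[of 0] by (intro null_setsI) (auto simp: unit_int.emeasure_eq_measure measure_le_0_iff)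
  then have ae0: "AE x in unit_int. 0 < \<tau> x"
    by (rule AE_I') (auto simp: space_unit_int)
  have "measure unit_int ({0<..<1} - {x\<in>{0<..<1}. \<tau> x < 1}) = measure unit_int {0<..<1} - measure unit_int {x\<in>{0<..<1}. \<tau> x < 1}"
    by (intro unit_int.finite_measure_Diff tau_sets sets_unit_intI) auto
  then have "measure unit_int ({0<..<1} - {x\<in>{0<..<1}. \<tau> x < 1}) = 0"
    using total tau_less[of 1] by simp
  then have "{0<..<1} - {x\<in>{0<..<1}. \<tau> x < 1} \<in> null_sets unit_int"
    by (intro null_setsI sets.Diff tau_sets sets_unit_intI) (simp_all add: unit_int.emeasure_eq_measure)
  then have ae1: "AE x in unit_int. \<tau> x < 1"
    by (rule AE_I') (auto simp: space_unit_int)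
  \<comment> \<open>\<tau> lies strictly between 0 and 1 almost everywhere. The exceptional points
    get the value \<open>1 / 2\<close>, since decreasing functions are controlled on the open
    interval only.\<close>
  define \<sigma> where "\<sigma> x = (if 0 < \<tau> x \<and> \<tau> x < 1 then \<tau> x else 1 / 2)" for x
  have sigma_meas [measurable]: "\<sigma> \<in> borel_measurable unit_int" unfolding \<sigma>_def by measurable
  have ae: "AE x in unit_int. \<sigma> x = \<tau> x"
    using ae0 ae1 by eventually_elim (simp add: \<sigma>_def)
  show thesis
  proof (rule that[of \<sigma>])
    show "\<sigma> \<in> borel_measurable unit_int" by measurable
    show "0 < \<sigma> x" "\<sigma> x < 1" for x by (auto simp: \<sigma>_def)
    show "emeasure unit_int {x\<in>{0<..<1}. \<sigma> x < a} = ennreal a" if "0 \<le> a" "a \<le> 1" for a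
    proof -
      have "{x\<in>space unit_int. \<sigma> x < a} \<in> sets unit_int" by measurable
      then have "{x\<in>{0<..<1}. \<sigma> x < a} \<in> sets unit_int" by (simp add: space_unit_int)
      then have "emeasure unit_int {x\<in>{0<..<1}. \<sigma> x < a} = emeasure unit_int {x\<in>{0<..<1}. \<tau> x < a}"
        using ae tau_sets by (intro emeasure_eq_AE) auto
      then show ?thesis using tau_less[OF that] by (simp add: unit_int.emeasure_eq_measure)
    qed
    show "AE x in unit_int. rearr01 g (\<sigma> x) \<le> g x"
      using ae AE_space
    proof eventually_elim
      case (elim x)
      then have x: "x \<in> {0<..<1}" by (simp add: space_unit_int)
      \<comment> \<open>All points with a larger value of \<open>g\<close> precede \<open>x\<close>,
        so the distribution function of \<open>g\<close> at level \<open>g x\<close> is at most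
        \<open>\<tau> x\<close>. Inverting this gives the claim.\<close>
      have "{y \<in> {0<..<1}. g x < g y} \<subseteq> R x" by (auto simp: R_def)
      then have "distrib g (g x) \<le> emeasure unit_int (R x)"
        unfolding distrib_def by (rule emeasure_mono) (rule R_sets[OF x])
      then have "distrib g (g x) \<le> ennreal (\<tau> x)" by (simp add: \<tau>_def unit_int.emeasure_eq_measure)
      then have "\<not> g x < rearr01 g (\<tau> x)"
        using less_rearr01_iff[OF assms, of "\<tau> x" "g x"] by (simp add: \<tau>_def not_less)
      then show ?case using elim by simp
    qed
  qed
qed

text \<open>\<open>k\<close> is the composition of \<open>h\<close> with the map \<sigma> of
  \<open>ryff\<close>. This composition preserves the distribution function of every decreasing
  function, hence that of \<open>h\<close> and of the product of \<open>h\<close> with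
  \<open>rearr01 g\<close>; as \<open>rearr01 g (\<sigma> x) \<le> g x\<close> almost everywhere,
  \<open>k\<close> attains the bound of Hardy and Littlewood.\<close>

lemma resonance:
  assumes [measurable]: "g \<in> M_plus" and h: "decr h"
  obtains k where "k \<in> M_plus" "\<And>s. 0 \<le> s \<Longrightarrow> rearr01 k s = rearr01 h s"
    "(\<integral>\<^sub>1x. h x * rearr01 g x) \<le> (\<integral>\<^sub>1x. k x * g x)"
proof -
  obtain \<sigma> where [measurable]: "\<sigma> \<in> borel_measurable unit_int"
    and pos: "\<And>x. 0 < \<sigma> x" "\<And>x. \<sigma> x < 1"
    and less: "\<And>a. 0 \<le> a \<Longrightarrow> a \<le> 1 \<Longrightarrow> emeasure unit_int {x\<in>{0<..<1}. \<sigma> x < a} = ennreal a"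
    and ae: "AE x in unit_int. rearr01 g (\<sigma> x) \<le> g x"
    using ryff[OF assms(1)] by blast
  have sets: "{x\<in>{0<..<1}. \<sigma> x < a} \<in> sets unit_int" "{x\<in>{0<..<1}. \<sigma> x \<le> a} \<in> sets unit_int" for a
  proof -
    have "{x\<in>space unit_int. \<sigma> x < a} \<in> sets unit_int" "{x\<in>space unit_int. \<sigma> x \<le> a} \<in> sets unit_int" by measurable
    then show "{x\<in>{0<..<1}. \<sigma> x < a} \<in> sets unit_int" "{x\<in>{0<..<1}. \<sigma> x \<le> a} \<in> sets unit_int"
      by (simp_all add: space_unit_int)
  qed
  have le: "emeasure unit_int {x\<in>{0<..<1}. \<sigma> x \<le> a} = ennreal a" if "0 \<le> a" "a < 1" for a
  proof (rule antisym)
    show "ennreal a \<le> emeasure unit_int {x\<in>{0<..<1}. \<sigma> x \<le> a}"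
      using less[of a] that sets by (auto intro!: emeasure_mono simp flip: less)
    show "emeasure unit_int {x\<in>{0<..<1}. \<sigma> x \<le> a} \<le> ennreal a"
    proof (rule dense_ge)
      fix y assume y: "ennreal a < y"
      have "\<exists>b. a < b \<and> b \<le> 1 \<and> ennreal b \<le> y"
      proof (cases y)
        case (real r)
        then have "a < r" using y that by (simp add: ennreal_less_iff)
        then show ?thesis using that real by (intro exI[of _ "min r 1"]) (auto intro: ennreal_leI)
      next
        case top
        then show ?thesis using that by (intro exI[of _ 1]) auto
      qed
      then obtain b where b: "a < b" "b \<le> 1" "ennreal b \<le> y" by blast
      have "emeasure unit_int {x\<in>{0<..<1}. \<sigma> x \<le> a} \<le> emeasure unit_int {x\<in>{0<..<1}. \<sigma> x < b}"
        by (rule emeasure_mono) (use b sets in auto)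
      also have "\<dots> = ennreal b" using b that by (intro less) auto
      finally show "emeasure unit_int {x\<in>{0<..<1}. \<sigma> x \<le> a} \<le> y" using b(3) by simp
    qed
  qed
  have level: "{x\<in>{0<..<1}. v < h (\<sigma> x)} \<in> sets unit_int \<and> distrib (\<lambda>x. h (\<sigma> x)) v = distrib h v"
    if h: "decr h" for h v
  proof -
    obtain c where c: "segment c {x\<in>{0<..<1}. v < h x}" using decr_superlevel[OF h] by blast
    have iff: "v < h (\<sigma> x) \<longleftrightarrow> \<sigma> x \<in> {x\<in>{0<..<1}. v < h x}" for x using pos by simp
    from c show ?thesis
    proof (cases rule: segment_cases)
      case 1
      then have "{x\<in>{0<..<1}. v < h (\<sigma> x)} = {x\<in>{0<..<1}. \<sigma> x < c}" using pos unfolding iff 1(3) by simp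
      then show ?thesis using sets less[OF 1(1,2)] distrib_segment[OF c] by (simp add: distrib_def)
    next
      case 2
      then have "{x\<in>{0<..<1}. v < h (\<sigma> x)} = {x\<in>{0<..<1}. \<sigma> x \<le> c}" using pos unfolding iff 2(3) by simp
      then show ?thesis using sets le[OF 2(1,2)] distrib_segment[OF c] by (simp add: distrib_def)
    qed
  qed
  have meas [measurable]: "(\<lambda>x. h (\<sigma> x)) \<in> M_plus" if "decr h" for h
    using level[OF that] by (intro borel_measurableI_greater) (simp add: space_unit_int)
  have d: "decr (\<lambda>x. h x * rearr01 g x)" by (rule decr_mult[OF h decr_rearr01])
  have "(\<integral>\<^sub>1x. h x * rearr01 g x) = (\<integral>\<^sub>1x. h (\<sigma> x) * rearr01 g (\<sigma> x))"
    using nn_integral_distrib[OF decr_measurable[OF d]] nn_integral_distrib[OF meas[OF d]] level[OF d] by simp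
  also have "\<dots> \<le> (\<integral>\<^sub>1x. h (\<sigma> x) * g x)"
    using ae by (intro nn_integral_mono_AE) (auto elim!: eventually_mono intro: mult_left_mono)
  finally have "(\<integral>\<^sub>1x. h x * rearr01 g x) \<le> (\<integral>\<^sub>1x. h (\<sigma> x) * g x)" .
  moreover have "rearr01 (\<lambda>x. h (\<sigma> x)) s = rearr01 h s" if "0 \<le> s" for s
    using level[OF h] that by (intro rearr01_cong meas h decr_measurable) auto
  ultimately show thesis using that[OF meas[OF h]] by blast
qed

section \<open>The second associate norm\<close>

context
  fixes Z :: "(real \<Rightarrow> ennreal) \<Rightarrow> ennreal"
  assumes Z: "ri_norm Z"
begin

lemmas Z_unfolded = Z[unfolded ri_norm_def]

lemma ri_zero_iff: "f \<in> M_plus \<Longrightarrow> Z f = 0 \<longleftrightarrow> (AE x in unit_int. f x = 0)"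
  by (rule Z_unfolded[THEN conjunct1, rule_format])

lemma ri_scale: "f \<in> M_plus \<Longrightarrow> 0 \<le> c \<Longrightarrow> Z (\<lambda>x. ennreal c * f x) = ennreal c * Z f"
  by (rule Z_unfolded[THEN conjunct2, THEN conjunct1, rule_format])

lemma ri_add: "f \<in> M_plus \<Longrightarrow> g \<in> M_plus \<Longrightarrow> Z (\<lambda>x. f x + g x) \<le> Z f + Z g"
  by (rule Z_unfolded[THEN conjunct2, THEN conjunct2, THEN conjunct1, rule_format])

lemma ri_mono_AE: "f \<in> M_plus \<Longrightarrow> g \<in> M_plus \<Longrightarrow> AE x in unit_int. f x \<le> g x \<Longrightarrow> Z f \<le> Z g"
  by (rule Z_unfolded[THEN conjunct2, THEN conjunct2, THEN conjunct2, THEN conjunct1, rule_format])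

lemma ri_mono: "f \<in> M_plus \<Longrightarrow> g \<in> M_plus \<Longrightarrow> (\<And>x. f x \<le> g x) \<Longrightarrow> Z f \<le> Z g"
  by (rule ri_mono_AE) auto

lemma ri_fatou:
  assumes "\<And>j. F j \<in> M_plus" "f \<in> M_plus" "AE x in unit_int. incseq (\<lambda>j. F j x) \<and> (\<lambda>j. F j x) \<longlonglongrightarrow> f x"
  shows "(\<lambda>j. Z (F j)) \<longlonglongrightarrow> Z f"
  by (rule Z_unfolded[THEN conjunct2, THEN conjunct2, THEN conjunct2, THEN conjunct2, THEN conjunct1, rule_format, THEN conjunct2]) (use assms in auto)

lemma ri_one: "Z (\<lambda>_. 1) < \<infinity>"
  by (rule Z_unfolded[THEN conjunct2, THEN conjunct2, THEN conjunct2, THEN conjunct2, THEN conjunct2, THEN conjunct1])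

lemma ri_integral: "\<exists>C::real. \<forall>f\<in>M_plus. (\<integral>\<^sub>1x. f x) \<le> ennreal C * Z f"
  by (rule Z_unfolded[THEN conjunct2, THEN conjunct2, THEN conjunct2, THEN conjunct2, THEN conjunct2, THEN conjunct2, THEN conjunct1])

lemma ri_rearr:
  "f \<in> M_plus \<Longrightarrow> g \<in> M_plus \<Longrightarrow> (\<And>s. 0 < s \<Longrightarrow> s < 1 \<Longrightarrow> rearr01 f s = rearr01 g s) \<Longrightarrow> Z f = Z g"
  by (rule Z_unfolded[THEN conjunct2, THEN conjunct2, THEN conjunct2, THEN conjunct2, THEN conjunct2, THEN conjunct2, THEN conjunct2, rule_format]) auto

lemma assoc_upper: "f \<in> M_plus \<Longrightarrow> Z f \<le> 1 \<Longrightarrow> (\<integral>\<^sub>1x. f x * g x) \<le> assoc Z g"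
  unfolding assoc_def by (rule SUP_upper) auto

lemma ri_hoelder:
  assumes [measurable]: "f \<in> M_plus" "g \<in> M_plus" and g: "assoc Z g \<le> 1"
  shows "(\<integral>\<^sub>1x. f x * g x) \<le> Z f"
proof (cases "Z f")
  case (real c)
  show ?thesis
  proof (cases "c = 0")
    case True
    then have "AE x in unit_int. f x = 0" using real ri_zero_iff[OF assms(1)] by simp
    then have "(\<integral>\<^sub>1x. f x * g x) = (\<integral>\<^sub>1x. 0)"
      by (intro nn_integral_cong_AE) auto
    then show ?thesis by simp
  next
    case False
    then have c: "0 < c" using real by simp
    have "Z (\<lambda>x. ennreal (1 / c) * f x) = ennreal (1 / c) * ennreal c" using c real by (subst ri_scale) auto
    also have "\<dots> = 1" using c by (simp flip: ennreal_mult)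
    finally have "(\<integral>\<^sub>1x. ennreal (1 / c) * f x * g x) \<le> 1"
      using assoc_upper[of "\<lambda>x. ennreal (1 / c) * f x" g] g by (auto intro: order_trans)
    then have "ennreal (1 / c) * (\<integral>\<^sub>1x. f x * g x) \<le> 1"
      by (simp add: mult.assoc nn_integral_cmult)
    then show ?thesis using ennreal_le_scaled[OF c] real by simp
  qed
qed simp

text \<open>Strict separation of \<open>f\<close> from the unit ball of \<open>Z\<close>, by projecting \<open>f\<close> in \<open>L\<^sup>2\<close>
  onto the intersection of the ball with the order interval \<open>[0, f]\<close>. Since the ball is solid, the minimal
  distance within this interval is the minimal distance to the whole ball.\<close>

lemma separation_bounded:
  fixes F :: "real \<Rightarrow> real"
  assumes F [measurable]: "F \<in> borel_measurable unit_int" and F0: "\<And>x. 0 \<le> F x" and FB: "\<And>x. F x \<le> B"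
    and big: "1 < Z (\<lambda>x. ennreal (F x))"
  shows "\<exists>h\<in>M_plus. assoc Z h \<le> 1 \<and> 1 < (\<integral>\<^sub>1x. ennreal (F x) * h x)"
proof -
  define K where "K = {g \<in> borel_measurable unit_int. (\<forall>x. 0 \<le> g x \<and> g x \<le> F x) \<and> Z (\<lambda>x. ennreal (g x)) \<le> 1}"
  define J where "J g = (LINT x|unit_int. (F x - g x)\<^sup>2)" for g :: "real \<Rightarrow> real"
  have B0: "0 \<le> B" using F0[of 0] FB[of 0] by linarith
  have K_meas: "g \<in> borel_measurable unit_int" if "g \<in> K" for g using that by (simp add: K_def)
  have K_bounds: "0 \<le> g x" "g x \<le> F x" "g x \<le> B" if "g \<in> K" for g x
    using that FB[of x] order_trans[of "g x" "F x" B] by (auto simp: K_def)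
  have bdd_int: "integrable unit_int u" if "u \<in> borel_measurable unit_int" "\<And>x. \<bar>u x\<bar> \<le> c" for u :: "real \<Rightarrow> real" and c
    using that by (intro unit_int.integrable_const_bound[of _ c]) auto
  have int_sq: "integrable unit_int (\<lambda>x. (u x)\<^sup>2)" if "u \<in> borel_measurable unit_int" "\<And>x. \<bar>u x\<bar> \<le> c" for u :: "real \<Rightarrow> real" and c
    using that power_mono[of "\<bar>u _\<bar>" c 2] by (intro bdd_int[of _ "c\<^sup>2"]) auto
  have int_prod: "integrable unit_int (\<lambda>x. u x * v x)" if "u \<in> borel_measurable unit_int" "v \<in> borel_measurable unit_int"
    "\<And>x. \<bar>u x\<bar> \<le> c" "\<And>x. \<bar>v x\<bar> \<le> d" for u v :: "real \<Rightarrow> real" and c d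
  proof (rule bdd_int[of _ "c * d"])
    show "\<bar>u x * v x\<bar> \<le> c * d" for x
      unfolding abs_mult using that(3,4)[of x] by (intro mult_mono) auto
  qed (use that in measurable)
  \<comment> \<open>The ball is convex and solid, so a convex combination cut off at
    \<open>F\<close> is again in \<open>K\<close>, even if \<open>g'\<close> is not below
    \<open>F\<close>.\<close>
  have convK: "(\<lambda>x. min (F x) ((1 - e) * g x + e * g' x)) \<in> K"
    if e: "0 \<le> e" "e \<le> 1" and g: "g \<in> K" and g': "g' \<in> borel_measurable unit_int" "\<And>x. 0 \<le> g' x" "Z (\<lambda>x. ennreal (g' x)) \<le> 1"
    for e g g'
  proof -
    note [measurable] = K_meas[OF g] g'(1)
    have "Z (\<lambda>x. ennreal (min (F x) ((1 - e) * g x + e * g' x))) \<le> Z (\<lambda>x. ennreal (1 - e) * ennreal (g x) + ennreal e * ennreal (g' x))"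
      using e K_bounds(1)[OF g] g'(2)
      by (intro ri_mono) (auto simp flip: ennreal_mult ennreal_plus intro!: ennreal_leI)
    also have "\<dots> \<le> Z (\<lambda>x. ennreal (1 - e) * ennreal (g x)) + Z (\<lambda>x. ennreal e * ennreal (g' x))"
      by (rule ri_add) auto
    also have "\<dots> = ennreal (1 - e) * Z (\<lambda>x. ennreal (g x)) + ennreal e * Z (\<lambda>x. ennreal (g' x))"
      using e by (subst (1 2) ri_scale) auto
    also have "\<dots> \<le> ennreal (1 - e) * 1 + ennreal e * 1"
      using g g'(3) by (intro add_mono mult_left_mono) (auto simp: K_def)
    also have "\<dots> = 1" using e by (simp flip: ennreal_plus)
    finally show ?thesis using e K_bounds(1)[OF g] g'(2) F0 by (auto simp: K_def)
  qed
  have zero: "(\<lambda>_. 0) \<in> K" using F0 ri_zero_iff[of "\<lambda>_. 0"] by (simp add: K_def)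
  have J0: "0 \<le> J g" for g unfolding J_def by simp
  define d where "d = Inf (J ` K)"
  have bdd: "bdd_below (J ` K)" using J0 by (intro bdd_belowI[of _ 0]) auto
  have d_le: "d \<le> J g" if "g \<in> K" for g unfolding d_def using that bdd by (intro cInf_lower) auto
  have "\<exists>g\<in>K. J g < d + 1 / real (Suc n)" for n
  proof -
    have "d < d + 1 / real (Suc n)" by simp
    then show ?thesis unfolding d_def using cInf_less_iff[OF _ bdd] zero by blast
  qed
  then obtain G where GK: "\<And>n. G n \<in> K" and GJ: "\<And>n. J (G n) < d + 1 / real (Suc n)" by metis
  note [measurable] = K_meas[OF GK]
  have abs_diff: "\<bar>F x - g x\<bar> \<le> B" "\<bar>g x - g' x\<bar> \<le> B" if "g \<in> K" "g' \<in> K" for g g' x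
    using K_bounds[OF that(1), of x] K_bounds[OF that(2), of x] FB[of x] F0[of x] by auto
  \<comment> \<open>The parallelogram identity, with \<open>J M \<ge> d\<close> at the midpoint
    \<open>M\<close>, makes the minimizing sequence Cauchy in the mean square.\<close>
  have par: "(LINT x|unit_int. (G n x - G m x)\<^sup>2) \<le> 2 / real (Suc n) + 2 / real (Suc m)" for n m
  proof -
    define M where "M x = (1 - 1 / 2) * G n x + 1 / 2 * G m x" for x
    have M: "min (F x) (M x) = M x" for x using K_bounds(2)[OF GK, of n x] K_bounds(2)[OF GK, of m x] by (simp add: M_def)
    have MK: "M \<in> K"
      using convK[of "1 / 2" "G n" "G m"] GK[of m] GK[of n] unfolding M_def[symmetric] M by (simp add: K_def)
    note [measurable] = K_meas[OF MK]
    have i: "integrable unit_int (\<lambda>x. (F x - g x)\<^sup>2)" if "g \<in> K" for g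
      using K_meas[OF that] abs_diff(1)[OF that that] by (intro int_sq[of _ B]) auto
    have "(LINT x|unit_int. (G n x - G m x)\<^sup>2)
        = (LINT x|unit_int. 2 * (F x - G n x)\<^sup>2 + 2 * (F x - G m x)\<^sup>2 - 4 * (F x - M x)\<^sup>2)"
      by (rule Bochner_Integration.integral_cong) (auto simp: M_def power2_eq_square algebra_simps)
    also have "\<dots> = 2 * J (G n) + 2 * J (G m) - 4 * J M"
      unfolding J_def using i[OF GK] i[OF MK] by simp
    also have "\<dots> \<le> 2 / real (Suc n) + 2 / real (Suc m)"
    proof -
      have "2 / real (Suc n) = 2 * (1 / real (Suc n))" "2 / real (Suc m) = 2 * (1 / real (Suc m))" by simp_all
      then show ?thesis using GJ[of n] GJ[of m] d_le[OF MK] by linarith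
    qed
    finally show ?thesis .
  qed
  have total: "measure unit_int (space unit_int) = 1"
    using emeasure_unit_int_interval(1)[of 1] by (simp add: measure_def space_unit_int)
  have cauchy: "\<exists>N. \<forall>i\<ge>N. \<forall>j\<ge>N. (LINT x|unit_int. norm (G i x - G j x)) < e" if "e > 0" for e
  proof -
    obtain N where N: "inverse (real (Suc N)) < e\<^sup>2 / 8" using reals_Archimedean[of "e\<^sup>2 / 8"] \<open>e > 0\<close> by auto
    have "(LINT x|unit_int. norm (G i x - G j x)) < e" if "i \<ge> N" "j \<ge> N" for i j
    proof -
      \<comment> \<open>Young's inequality passes from the mean square to the mean, in which the
        almost everywhere convergent subsequence is extracted.\<close>
      have young: "norm u \<le> e / 2 + u\<^sup>2 / (2 * e)" for u :: real
      proof -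
        have "0 \<le> (\<bar>u\<bar> - e)\<^sup>2" by simp
        also have "\<dots> = u\<^sup>2 - 2 * e * \<bar>u\<bar> + e\<^sup>2" by (simp add: power2_eq_square algebra_simps)
        finally show ?thesis using \<open>e > 0\<close> by (simp add: field_simps power2_eq_square)
      qed
      have int_G: "integrable unit_int (\<lambda>x. G i x - G j x)" "integrable unit_int (\<lambda>x. (G i x - G j x)\<^sup>2)"
        by (rule bdd_int[of _ B] int_sq[of _ B], measurable, rule abs_diff(2)[OF GK GK])+
      have "(LINT x|unit_int. norm (G i x - G j x)) \<le> (LINT x|unit_int. e / 2 + (G i x - G j x)\<^sup>2 / (2 * e))"
        by (intro integral_mono young integrable_norm int_G Bochner_Integration.integrable_add integrable_divide_zero) simp_all
      also have "\<dots> = e / 2 + (LINT x|unit_int. (G i x - G j x)\<^sup>2) / (2 * e)"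
        using int_G(2) total by simp
      also have "\<dots> \<le> e / 2 + (2 / real (Suc i) + 2 / real (Suc j)) / (2 * e)"
        using par[of i j] \<open>e > 0\<close> by (intro add_left_mono divide_right_mono) auto
      also have "\<dots> \<le> e / 2 + (2 / real (Suc N) + 2 / real (Suc N)) / (2 * e)"
        using that \<open>e > 0\<close> by (intro add_left_mono divide_right_mono add_mono divide_left_mono) auto
      also have "\<dots> = e / 2 + 2 * inverse (real (Suc N)) / e"
      proof -
        have "(2 / x + 2 / x) / (2 * e) = 2 * inverse x / e" if "x > 0" for x :: real
          using that \<open>e > 0\<close> by (simp add: field_simps)
        from this[of "real (Suc N)"] show ?thesis by linarith
      qed
      also have "\<dots> < e / 2 + 2 * (e\<^sup>2 / 8) / e"
        using N \<open>e > 0\<close> by (intro add_strict_left_mono divide_strict_right_mono mult_strict_left_mono) auto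
      also have "\<dots> < e" using \<open>e > 0\<close> by (simp add: power2_eq_square field_simps)
      finally show ?thesis .
    qed
    then show ?thesis by blast
  qed
  obtain r where r: "strict_mono r" "AE x in unit_int. Cauchy (\<lambda>i. G (r i) x)"
  proof (rule cauchy_L1_AE_cauchy_subseq[of unit_int G])
    show "integrable unit_int (G n)" for n
      using K_bounds[OF GK, of n] by (intro bdd_int[of _ B]) auto
  qed (use cauchy in auto)
  \<comment> \<open>A lower limit, because the norm is continuous along increasing sequences: the
    infima over the tails of the subsequence increase to \<open>H\<close> and have norm at most 1,
    hence so does \<open>H\<close>.\<close>
  define H where "H x = liminf (\<lambda>i. ennreal (G (r i) x))" for x
  have H_meas [measurable]: "H \<in> M_plus" unfolding H_def by measurable
  have HF: "H x \<le> ennreal (F x)" for x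
  proof -
    have "H x \<le> liminf (\<lambda>i. ennreal (F x))" unfolding H_def
      by (intro Liminf_mono always_eventually) (auto intro!: ennreal_leI K_bounds GK)
    then show ?thesis by (simp add: Liminf_const)
  qed
  define g0 where "g0 x = enn2real (H x)" for x
  have g0H: "ennreal (g0 x) = H x" for x
    using HF[of x] unfolding g0_def by (metis ennreal_enn2real ennreal_neq_top less_top top_unique)
  have g0F: "g0 x \<le> F x" "0 \<le> g0 x" for x
  proof -
    show "0 \<le> g0 x" by (simp add: g0_def)
    show "g0 x \<le> F x" using HF[of x] F0[of x] g0H[of x] by (metis ennreal_le_iff)
  qed
  have lim: "AE x in unit_int. (\<lambda>i. G (r i) x) \<longlonglongrightarrow> g0 x"
    using r(2)
  proof eventually_elim
    case (elim x)
    then obtain l where l: "(\<lambda>i. G (r i) x) \<longlonglongrightarrow> l" using Cauchy_convergent convergent_def by blast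
    have "0 \<le> l" using l K_bounds(1)[OF GK] by (intro LIMSEQ_le_const) auto
    have "(\<lambda>i. ennreal (G (r i) x)) \<longlonglongrightarrow> ennreal l" using l by (rule tendsto_ennrealI)
    then have "H x = ennreal l" unfolding H_def by (intro lim_imp_Liminf) auto
    then show ?case using l \<open>0 \<le> l\<close> by (simp add: g0_def)
  qed
  have ZH: "Z H \<le> 1"
  proof (rule LIMSEQ_le_const2)
    define L where "L n x = (INF i\<in>{n..}. ennreal (G (r i) x))" for n x
    have [measurable]: "L n \<in> M_plus" for n unfolding L_def by measurable
    have inc: "incseq (\<lambda>n. L n x)" for x unfolding L_def
      by (rule incseq_SucI) (auto intro!: INF_superset_mono)
    have "H x = (SUP n. L n x)" for x unfolding H_def L_def by (simp add: liminf_SUP_INF)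
    then have "(\<lambda>n. L n x) \<longlonglongrightarrow> H x" for x using LIMSEQ_SUP[OF inc[of x]] by simp
    then show "(\<lambda>n. Z (L n)) \<longlonglongrightarrow> Z H" using inc by (intro ri_fatou) auto
    have "Z (L n) \<le> 1" for n
    proof -
      have "Z (L n) \<le> Z (\<lambda>x. ennreal (G (r n) x))"
        by (rule ri_mono) (auto simp: L_def intro: INF_lower)
      also have "\<dots> \<le> 1" using GK by (simp add: K_def)
      finally show ?thesis .
    qed
    then show "\<exists>N. \<forall>n\<ge>N. Z (L n) \<le> 1" by blast
  qed
  have g0_meas [measurable]: "g0 \<in> borel_measurable unit_int" unfolding g0_def by measurable
  have g0K: "g0 \<in> K" using g0F ZH by (simp add: K_def g0H)
  have "J g0 \<le> d"
  proof (rule LIMSEQ_le)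
    show "(\<lambda>i. J (G (r i))) \<longlonglongrightarrow> J g0" unfolding J_def
    proof (rule integral_dominated_convergence[where w="\<lambda>_. B\<^sup>2"])
      show "AE x in unit_int. (\<lambda>i. (F x - G (r i) x)\<^sup>2) \<longlonglongrightarrow> (F x - g0 x)\<^sup>2"
        using lim by eventually_elim (auto intro!: tendsto_intros)
      show "AE x in unit_int. norm ((F x - G (r i) x)\<^sup>2) \<le> B\<^sup>2" for i
        using abs_diff(1)[OF GK GK] power_mono[of "\<bar>F _ - G (r i) _\<bar>" B 2] by (intro AE_I2) auto
    qed auto
    show "(\<lambda>i. d + 1 / real (Suc (r i))) \<longlonglongrightarrow> d"
    proof -
      have "(\<lambda>i. d + 1 / real (Suc i)) \<longlonglongrightarrow> d + 0"
        by (intro tendsto_add tendsto_const LIMSEQ_Suc[OF lim_1_over_n])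
      then show ?thesis using LIMSEQ_subseq_LIMSEQ[OF _ r(1)] by (force simp: o_def)
    qed
    show "\<exists>N. \<forall>n\<ge>N. J (G (r n)) \<le> d + 1 / real (Suc (r n))" using GJ by (auto intro: less_imp_le)
  qed
  then have min: "J g0 \<le> J g" if "g \<in> K" for g using d_le[OF that] by simp
  define h where "h x = F x - g0 x" for x
  have h_meas [measurable]: "h \<in> borel_measurable unit_int" unfolding h_def by measurable
  have h0: "0 \<le> h x" "\<bar>h x\<bar> \<le> B" for x using g0F[of x] FB[of x] abs_diff(1)[OF g0K g0K, of x] by (auto simp: h_def)
  define \<alpha> where "\<alpha> = (LINT x|unit_int. g0 x * h x)"
  have g0B: "\<bar>g0 x\<bar> \<le> B" for x using K_bounds[OF g0K, of x] by auto
  \<comment> \<open>The variational inequality at the minimizer \<open>g0\<close>: moving towards a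
    bounded element \<open>g\<close> of the ball cannot reduce the distance to \<open>F\<close> at
    first order.\<close>
  have var: "(LINT x|unit_int. g x * h x) \<le> \<alpha>"
    if g [measurable]: "g \<in> borel_measurable unit_int" and g0: "\<And>x. 0 \<le> g x" and gc: "\<And>x. g x \<le> c"
      and Zg: "Z (\<lambda>x. ennreal (g x)) \<le> 1" for g c
  proof -
    have gdiff: "\<bar>g x - g0 x\<bar> \<le> c + B" for x using g0[of x] gc[of x] K_bounds[OF g0K, of x] by auto
    define a where "a = (LINT x|unit_int. (g x - g0 x) * h x)"
    define b where "b = (LINT x|unit_int. (g x - g0 x)\<^sup>2)"
    have i: "integrable unit_int (\<lambda>x. (g x - g0 x) * h x)" "integrable unit_int (\<lambda>x. (g x - g0 x)\<^sup>2)" "integrable unit_int (\<lambda>x. (h x)\<^sup>2)"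
      by (rule int_prod[OF _ _ gdiff h0(2)] int_sq[OF _ gdiff] int_sq[OF _ h0(2)]; measurable)+
    have key: "2 * a \<le> e * b" if e: "0 < e" "e \<le> 1" for e
    proof -
      have ke: "(\<lambda>x. min (F x) ((1 - e) * g0 x + e * g x)) \<in> K" using e g0 g Zg by (intro convK g0K) auto
      have "(F x - min (F x) ((1 - e) * g0 x + e * g x))\<^sup>2 \<le> (h x - e * (g x - g0 x))\<^sup>2" for x
        by (simp add: min_def h_def algebra_simps)
      moreover have "(h x - e * (g x - g0 x))\<^sup>2 = (h x)\<^sup>2 - 2 * e * ((g x - g0 x) * h x) + e\<^sup>2 * (g x - g0 x)\<^sup>2" for x
        by (simp add: power2_eq_square algebra_simps)
      ultimately have "J (\<lambda>x. min (F x) ((1 - e) * g0 x + e * g x))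
          \<le> (LINT x|unit_int. (h x)\<^sup>2 - 2 * e * ((g x - g0 x) * h x) + e\<^sup>2 * (g x - g0 x)\<^sup>2)"
        unfolding J_def using i K_meas[OF ke] abs_diff(1)[OF ke ke]
        by (intro integral_mono int_sq[of _ B]) (auto intro!: Bochner_Integration.integrable_add Bochner_Integration.integrable_diff)
      also have "\<dots> = J g0 - 2 * e * a + e\<^sup>2 * b"
        using i by (simp add: J_def h_def[symmetric] a_def b_def)
      finally have "2 * e * a \<le> e\<^sup>2 * b" using min[OF ke] by simp
      then have "e * (2 * a) \<le> e * (e * b)" by (simp add: power2_eq_square mult_ac)
      then show ?thesis using e by simp
    qed
    have b0: "0 \<le> b" by (simp add: b_def)
    have "a \<le> 0"
    proof (rule ccontr)
      assume "\<not> a \<le> 0"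
      then have a: "0 < a" by simp
      \<comment> \<open>This choice gives \<open>e * b \<le> a\<close>, against
        \<open>2 * a \<le> e * b\<close> and \<open>0 < a\<close>.\<close>
      define e where "e = min 1 (a / (b + 1))"
      have "0 < e" "e \<le> 1" using a b0 by (auto simp: e_def)
      have "e * b \<le> a / (b + 1) * b" using b0 by (intro mult_right_mono) (auto simp: e_def)
      also have "\<dots> \<le> a" using a b0 by (simp add: field_simps)
      finally show False using key[OF \<open>0 < e\<close> \<open>e \<le> 1\<close>] a by simp
    qed
    moreover have "a = (LINT x|unit_int. g x * h x) - \<alpha>"
    proof -
      have "integrable unit_int (\<lambda>x. g x * h x)" "integrable unit_int (\<lambda>x. g0 x * h x)"
      proof -
        have "\<bar>g x\<bar> \<le> c" for x using g0[of x] gc[of x] by simp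
        then show "integrable unit_int (\<lambda>x. g x * h x)" by (intro int_prod[OF _ _ _ h0(2)]) measurable
        show "integrable unit_int (\<lambda>x. g0 x * h x)" by (rule int_prod[OF _ _ g0B h0(2)]) measurable
      qed
      then show ?thesis by (simp add: a_def \<alpha>_def left_diff_distrib)
    qed
    ultimately show ?thesis by simp
  qed
  have assoc_h: "assoc Z (\<lambda>x. ennreal (h x)) \<le> ennreal \<alpha>"
    unfolding assoc_def
  proof (rule SUP_least, clarify)
    fix g assume g [measurable]: "g \<in> M_plus" and Zg: "Z g \<le> 1"
    have "(\<integral>\<^sub>1x. g x * ennreal (h x)) = (SUP n. \<integral>\<^sub>1x. min (g x) (of_nat n) * ennreal (h x))"
    proof (subst nn_integral_monotone_convergence_SUP[symmetric])
      show "incseq (\<lambda>n x. min (g x) (of_nat n) * ennreal (h x))"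
        by (auto simp: incseq_def le_fun_def intro!: mult_right_mono min.mono)
      have "(SUP n. min (g x) (of_nat n)) = g x" for x
        by (metis inf_SUP inf_ennreal_def inf_top.right_neutral ennreal_SUP_of_nat_eq_top inf_min)
      then show "(\<integral>\<^sub>1x. g x * ennreal (h x)) = (\<integral>\<^sub>1x. (SUP n. min (g x) (of_nat n) * ennreal (h x)))"
        by (simp flip: SUP_mult_right_ennreal)
    qed auto
    also have "\<dots> \<le> ennreal \<alpha>"
    proof (rule SUP_least)
      fix n
      \<comment> \<open>The variational inequality needs a bounded function, so \<open>g\<close> is
        truncated at \<open>n\<close>; the truncations reach \<open>g\<close> by monotone
        convergence.\<close>
      define gn where "gn x = enn2real (min (g x) (of_nat n))" for x
      have gn: "ennreal (gn x) = min (g x) (of_nat n)" for x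
        unfolding gn_def by (intro ennreal_enn2real) (auto simp: min_less_iff_disj of_nat_less_top)
      have [measurable]: "gn \<in> borel_measurable unit_int" unfolding gn_def by measurable
      have gn_le: "gn x \<le> real n" "0 \<le> gn x" for x
      proof -
        show "0 \<le> gn x" by (simp add: gn_def)
        have "ennreal (gn x) \<le> ennreal (real n)" unfolding gn by (simp add: ennreal_of_nat_eq_real_of_nat)
        then show "gn x \<le> real n" by (simp add: ennreal_le_iff)
      qed
      have "Z (\<lambda>x. ennreal (gn x)) \<le> Z g" by (rule ri_mono) (auto simp: gn)
      then have "(LINT x|unit_int. gn x * h x) \<le> \<alpha>"
        using gn_le Zg by (intro var[of _ "real n"]) auto
      moreover have "(\<integral>\<^sub>1x. min (g x) (of_nat n) * ennreal (h x)) = ennreal (LINT x|unit_int. gn x * h x)"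
      proof -
        have "(\<integral>\<^sub>1x. min (g x) (of_nat n) * ennreal (h x)) = (\<integral>\<^sub>1x. ennreal (gn x * h x))"
          using gn_le h0 by (intro nn_integral_cong) (simp add: gn[symmetric] ennreal_mult)
        also have "\<dots> = ennreal (LINT x|unit_int. gn x * h x)"
          using gn_le h0 by (intro nn_integral_eq_integral int_prod[of _ _ "real n" B]) auto
        finally show ?thesis .
      qed
      ultimately show "(\<integral>\<^sub>1x. min (g x) (of_nat n) * ennreal (h x)) \<le> ennreal \<alpha>"
        by (simp add: ennreal_leI)
    qed
    finally show "(\<integral>\<^sub>1x. g x * ennreal (h x)) \<le> ennreal \<alpha>" .
  qed
  define \<beta> where "\<beta> = (LINT x|unit_int. F x * h x)"
  have \<alpha>0: "0 \<le> \<alpha>" unfolding \<alpha>_def using g0F h0 by (intro Bochner_Integration.integral_nonneg mult_nonneg_nonneg) auto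
  have "\<alpha> < \<beta>"
  proof -
    have int_h: "integrable unit_int (\<lambda>x. (h x)\<^sup>2)" using h0 by (intro int_sq[of _ B]) auto
    have "integrable unit_int (\<lambda>x. F x * h x)" "integrable unit_int (\<lambda>x. g0 x * h x)"
      using h0 g0B F0 FB by (auto intro!: int_prod[of _ _ B B])
    then have "\<beta> - \<alpha> = (LINT x|unit_int. F x * h x - g0 x * h x)" by (simp add: \<alpha>_def \<beta>_def)
    also have "\<dots> = (LINT x|unit_int. (h x)\<^sup>2)"
      by (rule Bochner_Integration.integral_cong) (auto simp: h_def power2_eq_square algebra_simps)
    finally have eq: "\<beta> - \<alpha> = (LINT x|unit_int. (h x)\<^sup>2)" .
    have "(LINT x|unit_int. (h x)\<^sup>2) \<noteq> 0"
    proof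
      assume "(LINT x|unit_int. (h x)\<^sup>2) = 0"
      then have "AE x in unit_int. (h x)\<^sup>2 = 0"
        using integral_nonneg_eq_0_iff_AE[OF int_h] by simp
      then have "AE x in unit_int. ennreal (F x) \<le> H x"
        by eventually_elim (simp add: h_def g0H[symmetric])
      then have "Z (\<lambda>x. ennreal (F x)) \<le> Z H" by (intro ri_mono_AE) auto
      then show False using big ZH by simp
    qed
    moreover have "0 \<le> (LINT x|unit_int. (h x)\<^sup>2)" by simp
    ultimately show ?thesis using eq by linarith
  qed
  \<comment> \<open>Any number strictly between \<alpha> and \<beta> serves: division by it brings
    the associate norm of \<open>h\<close> below 1 and keeps the pairing with \<open>F\<close> above
    1.\<close>
  define c where "c = (\<alpha> + \<beta>) / 2"
  have c: "\<alpha> < c" "c < \<beta>" "0 < c" using \<open>\<alpha> < \<beta>\<close> \<alpha>0 by (auto simp: c_def)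
  show ?thesis
  proof (intro bexI conjI)
    have scale: "(\<integral>\<^sub>1x. u x * ennreal (h x / c)) = ennreal (1 / c) * (\<integral>\<^sub>1x. u x * ennreal (h x))"
      if [measurable]: "u \<in> M_plus" for u
    proof -
      have "ennreal (h x / c) = ennreal (1 / c) * ennreal (h x)" for x
        using h0[of x] c by (simp flip: ennreal_mult)
      then show ?thesis by (subst nn_integral_cmult[symmetric]) (auto simp: mult_ac)
    qed
    show "assoc Z (\<lambda>x. ennreal (h x / c)) \<le> 1"
      unfolding assoc_def
    proof (rule SUP_least, clarify)
      fix g assume g: "g \<in> M_plus" "Z g \<le> 1"
      have "(\<integral>\<^sub>1x. g x * ennreal (h x / c)) \<le> ennreal (1 / c) * ennreal \<alpha>"
        unfolding scale[OF g(1)] by (intro mult_left_mono order_trans[OF assoc_upper[OF g] assoc_h]) simp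
      also have "\<dots> \<le> 1" using c \<alpha>0 by (simp flip: ennreal_mult ennreal_1)
      finally show "(\<integral>\<^sub>1x. g x * ennreal (h x / c)) \<le> 1" .
    qed
    have "(\<integral>\<^sub>1x. ennreal (F x) * ennreal (h x)) = ennreal \<beta>"
      unfolding \<beta>_def using h0 F0 FB
      by (subst nn_integral_eq_integral[symmetric]) (auto simp: ennreal_mult intro!: int_prod[of _ _ B B])
    then have "(\<integral>\<^sub>1x. ennreal (F x) * ennreal (h x / c)) = ennreal (\<beta> / c)"
      using c by (subst scale) (auto simp flip: ennreal_mult)
    moreover have "1 < \<beta> / c" using c by simp
    ultimately show "1 < (\<integral>\<^sub>1x. ennreal (F x) * ennreal (h x / c))"
      by (metis ennreal_1 ennreal_less_iff zero_le_one)
    show "(\<lambda>x. ennreal (h x / c)) \<in> M_plus" by measurable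
  qed
qed

text \<open>The hard half of \<open>Z'' = Z\<close>, as an upper bound. If \<open>Z f\<close>
  exceeded \<open>K\<close>, by the Fatou property some bounded truncation of \<open>f\<close> would
  have norm above \<open>K\<close>; divided by \<open>K\<close> it would be strictly separated from
  the unit ball, against the assumed bound.\<close>

lemma lorentz_luxemburg:
  assumes [measurable]: "f \<in> M_plus" and K: "0 < K"
    and bound: "\<And>h. h \<in> M_plus \<Longrightarrow> assoc Z h \<le> 1 \<Longrightarrow> (\<integral>\<^sub>1x. f x * h x) \<le> ennreal K"
  shows "Z f \<le> ennreal K"
proof (rule ccontr)
  assume "\<not> Z f \<le> ennreal K"
  then have "ennreal K < Z f" by simp
  moreover have "(\<lambda>n. Z (\<lambda>x. min (f x) (of_nat n))) \<longlonglongrightarrow> Z f"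
  proof (rule ri_fatou)
    have inc: "incseq (\<lambda>n. min (f x) (of_nat n))" for x
      unfolding incseq_def by (intro allI impI min.mono order_refl of_nat_mono)
    have "(SUP n. min (f x) (of_nat n)) = f x" for x
      by (metis inf_SUP inf_top.right_neutral ennreal_SUP_of_nat_eq_top inf_min)
    then show "AE x in unit_int. incseq (\<lambda>n. min (f x) (of_nat n)) \<and> (\<lambda>n. min (f x) (of_nat n)) \<longlonglongrightarrow> f x"
      using inc LIMSEQ_SUP[OF inc] by (intro AE_I2) auto
  qed auto
  ultimately have "\<forall>\<^sub>F n in sequentially. ennreal K < Z (\<lambda>x. min (f x) (of_nat n))"
    by (rule order_tendstoD(1)[rotated])
  then obtain n where n: "ennreal K < Z (\<lambda>x. min (f x) (of_nat n))"
    by (auto simp: eventually_sequentially)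
  define F where "F x = enn2real (min (f x) (of_nat n)) / K" for x
  have F: "ennreal (F x) = ennreal (1 / K) * min (f x) (of_nat n)" for x
  proof -
    have "min (f x) (of_nat n) = ennreal (enn2real (min (f x) (of_nat n)))"
      by (intro ennreal_enn2real[symmetric]) (auto simp: min_less_iff_disj of_nat_less_top)
    moreover have "ennreal (F x) = ennreal (1 / K) * ennreal (enn2real (min (f x) (of_nat n)))"
      using K by (simp add: F_def flip: ennreal_mult)
    ultimately show ?thesis by simp
  qed
  have "\<exists>h\<in>M_plus. assoc Z h \<le> 1 \<and> 1 < (\<integral>\<^sub>1x. ennreal (F x) * h x)"
  proof (rule separation_bounded)
    show "F \<in> borel_measurable unit_int" unfolding F_def by measurable
    show "0 \<le> F x" for x using K by (simp add: F_def)
    show "F x \<le> real n / K" for x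
    proof -
      have "enn2real (min (f x) (of_nat n)) \<le> enn2real (of_nat n)"
        by (intro enn2real_mono) (auto simp: of_nat_less_top)
      then show ?thesis using K by (simp add: F_def divide_right_mono)
    qed
    have "ennreal (1 / K) * ennreal K < ennreal (1 / K) * Z (\<lambda>x. min (f x) (of_nat n))"
      using n K by (intro ennreal_mult_strict_left_mono) auto
    also have "\<dots> = Z (\<lambda>x. ennreal (F x))" unfolding F using K by (intro ri_scale[symmetric]) auto
    finally show "1 < Z (\<lambda>x. ennreal (F x))" using K by (simp flip: ennreal_mult)
  qed
  then obtain h where h [measurable]: "h \<in> M_plus" and h1: "assoc Z h \<le> 1" "1 < (\<integral>\<^sub>1x. ennreal (F x) * h x)"
    by blast
  have "(\<integral>\<^sub>1x. ennreal (F x) * h x) = ennreal (1 / K) * (\<integral>\<^sub>1x. min (f x) (of_nat n) * h x)"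
    unfolding F by (subst nn_integral_cmult[symmetric]) (auto simp: mult_ac)
  also have "\<dots> \<le> ennreal (1 / K) * (\<integral>\<^sub>1x. f x * h x)"
    by (intro mult_left_mono nn_integral_mono mult_right_mono) auto
  also have "\<dots> \<le> ennreal (1 / K) * ennreal K" by (intro mult_left_mono bound h h1(1)) auto
  also have "\<dots> = 1" using K by (simp flip: ennreal_mult)
  finally show False using h1(2) by simp
qed

end

section \<open>The averaging operators\<close>

text \<open>Up to the factor \<open>fact (m - 1)\<close>, \<open>S m\<close> is the \<open>m\<close>-th power of the averaging operator \<open>S 1\<close>;
  \<open>Q m\<close> is its adjoint.\<close>

definition S :: "nat \<Rightarrow> (real \<Rightarrow> ennreal) \<Rightarrow> real \<Rightarrow> ennreal" where
  "S m g s = ennreal (1 / s) * (\<integral>\<^sup>+r. ennreal (ln (s / r) ^ (m - 1)) * g r \<partial>lebesgue_on {0<..<s})"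

definition Q :: "nat \<Rightarrow> (real \<Rightarrow> ennreal) \<Rightarrow> real \<Rightarrow> ennreal" where
  "Q m F r = (\<integral>\<^sub>1s. F s * ennreal (1 / s) * ennreal (ln (s / r) ^ (m - 1)) * indicator {r<..<1} s)"

lemma tilde_assoc_S: "tilde_assoc X m g = assoc X (S m (rearr01 g))"
  by (simp only: tilde_assoc_def S_def[abs_def])

lemma S_eq:
  assumes "0 < s" "s \<le> 1"
  shows "S m g s = ennreal (1 / s) * (\<integral>\<^sub>1r. ennreal (ln (s / r) ^ (m - 1)) * g r * indicator {..<s} r)"
proof -
  have "(\<integral>\<^sup>+r. ennreal (ln (s / r) ^ (m - 1)) * g r \<partial>lebesgue_on {0<..<s})
      = (\<integral>\<^sup>+r. ennreal (ln (s / r) ^ (m - 1)) * g r * indicator {0<..<s} r \<partial>lebesgue)"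
    by (rule nn_integral_restrict_space) auto
  also have "\<dots> = (\<integral>\<^sup>+r. ennreal (ln (s / r) ^ (m - 1)) * g r * indicator {..<s} r * indicator {0<..<1} r \<partial>lebesgue)"
    using assms by (intro nn_integral_cong) (auto split: split_indicator)
  also have "\<dots> = (\<integral>\<^sub>1r. ennreal (ln (s / r) ^ (m - 1)) * g r * indicator {..<s} r)"
    by (rule nn_integral_restrict_space[symmetric]) auto
  finally show ?thesis by (simp add: S_def)
qed

text \<open>The substitution \<open>r = s \<rho>\<close> removes \<open>s\<close> from the domain
  and the kernel and leaves it in the argument of \<open>g\<close> only, so that
  \<open>S m g\<close> visibly inherits monotonicity.\<close>

lemma S_scaled:
  assumes [measurable]: "g \<in> M_plus" and s: "0 < s" "s \<le> 1"
  shows "S m g s = (\<integral>\<^sub>1\<rho>. ennreal (ln (1 / \<rho>) ^ (m - 1)) * g (s * \<rho>))"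
proof -
  define k where "k r = ennreal (ln (s / r) ^ (m - 1)) * indicator {..<s} r * (g r * indicator {0<..<1} r)" for r
  have [measurable]: "(\<lambda>r. g r * indicator {0<..<1} r) \<in> borel_measurable lebesgue"
    using borel_measurable_restrict_space_iff_ennreal[of "{0<..<1}" lebesgue g] assms(1) by simp
  have "(\<lambda>r. ennreal (ln (s / r) ^ (m - 1)) * indicator {..<s} r) \<in> borel_measurable borel"
    by measurable
  then have [measurable]: "(\<lambda>r. ennreal (ln (s / r) ^ (m - 1)) * indicator {..<s} r) \<in> borel_measurable lebesgue"
    by (intro measurable_completion) simp
  have k: "k \<in> borel_measurable lebesgue" unfolding k_def by measurable
  have "S m g s = ennreal (1 / s) * (\<integral>\<^sup>+r. k r \<partial>lebesgue)"
    unfolding S_eq[OF s] by (subst nn_integral_restrict_space) (auto simp: k_def[abs_def] mult_ac)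
  also have "(\<integral>\<^sup>+r. k r \<partial>lebesgue) = ennreal s * (\<integral>\<^sup>+\<rho>. k (s * \<rho>) \<partial>lebesgue)"
    using nn_integral_real_affine_lebesgue[OF k, of s 0] s by simp
  also have "ennreal (1 / s) * (ennreal s * (\<integral>\<^sup>+\<rho>. k (s * \<rho>) \<partial>lebesgue)) = (\<integral>\<^sup>+\<rho>. k (s * \<rho>) \<partial>lebesgue)"
    using s by (simp add: mult.assoc[symmetric] flip: ennreal_mult)
  also have "\<dots> = (\<integral>\<^sup>+\<rho>. ennreal (ln (1 / \<rho>) ^ (m - 1)) * g (s * \<rho>) * indicator {0<..<1} \<rho> \<partial>lebesgue)"
  proof (rule nn_integral_cong)
    fix \<rho> :: real
    have "s * \<rho> < 1" if "0 < \<rho>" "\<rho> < 1"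
      using mult_le_one[of s \<rho>] mult_strict_left_mono[of \<rho> 1 s] s that by linarith
    then have "0 < s * \<rho> \<longleftrightarrow> 0 < \<rho>" "s * \<rho> < s \<longleftrightarrow> \<rho> < 1" "0 < \<rho> \<Longrightarrow> \<rho> < 1 \<Longrightarrow> s * \<rho> < 1"
      using s by (auto simp: zero_less_mult_iff)
    then show "k (s * \<rho>) = ennreal (ln (1 / \<rho>) ^ (m - 1)) * g (s * \<rho>) * indicator {0<..<1} \<rho>"
      using s by (auto simp: k_def split: split_indicator)
  qed
  also have "\<dots> = (\<integral>\<^sub>1\<rho>. ennreal (ln (1 / \<rho>) ^ (m - 1)) * g (s * \<rho>))"
    by (rule nn_integral_restrict_space[symmetric]) auto
  finally show ?thesis .
qed

lemma S_mono:
  assumes "0 < s" "s \<le> 1" "\<And>r. 0 < r \<Longrightarrow> r < s \<Longrightarrow> f r \<le> g r"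
  shows "S m f s \<le> S m g s"
  unfolding S_eq[OF assms(1,2)] using assms(3)
  by (intro mult_left_mono unit_integral_mono) (auto split: split_indicator intro: mult_left_mono)

lemma S_cong:
  assumes "0 < s" "s \<le> 1" "\<And>r. 0 < r \<Longrightarrow> r < s \<Longrightarrow> f r = g r"
  shows "S m f s = S m g s"
  using assms by (intro antisym S_mono) auto

lemma S_cmult:
  assumes [measurable]: "g \<in> M_plus" and s: "0 < s" "s \<le> 1"
  shows "S m (\<lambda>r. c * g r) s = c * S m g s"
proof -
  have "(\<integral>\<^sub>1r. ennreal (ln (s / r) ^ (m - 1)) * (c * g r) * indicator {..<s} r)
     = (\<integral>\<^sub>1r. c * (ennreal (ln (s / r) ^ (m - 1)) * g r * indicator {..<s} r))"
    by (simp add: mult_ac)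
  also have "\<dots> = c * (\<integral>\<^sub>1r. ennreal (ln (s / r) ^ (m - 1)) * g r * indicator {..<s} r)"
    by (rule nn_integral_cmult) measurable
  finally show ?thesis by (simp add: S_eq[OF s] mult_ac)
qed

lemma S_add:
  assumes [measurable]: "f \<in> M_plus" "g \<in> M_plus" and s: "0 < s" "s \<le> 1"
  shows "S m (\<lambda>r. f r + g r) s = S m f s + S m g s"
proof -
  have "(\<integral>\<^sub>1r. ennreal (ln (s / r) ^ (m - 1)) * (f r + g r) * indicator {..<s} r)
      = (\<integral>\<^sub>1r. ennreal (ln (s / r) ^ (m - 1)) * f r * indicator {..<s} r + ennreal (ln (s / r) ^ (m - 1)) * g r * indicator {..<s} r)"
    by (simp add: distrib_left distrib_right)
  also have "\<dots> = (\<integral>\<^sub>1r. ennreal (ln (s / r) ^ (m - 1)) * f r * indicator {..<s} r)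
      + (\<integral>\<^sub>1r. ennreal (ln (s / r) ^ (m - 1)) * g r * indicator {..<s} r)"
    by (rule nn_integral_add) measurable
  finally show ?thesis by (simp add: S_eq[OF s] distrib_left)
qed

lemma S_rearr:
  assumes "decr g" "0 < s" "s \<le> 1"
  shows "S m (rearr01 g) s = S m g s"
  using nn_integral_rearr01_decr[OF assms(1), of "\<lambda>r. ennreal (ln (s / r) ^ (m - 1)) * indicator {..<s} r"]
  by (simp add: S_eq[OF assms(2,3)] mult_ac)

lemma decr_S:
  assumes "decr g"
  shows "decr (S m g)"
proof (rule decrI)
  fix x y :: real assume xy: "0 < x" "x \<le> y" "y < 1"
  have "g (y * \<rho>) \<le> g (x * \<rho>)" if "0 < \<rho>" "\<rho> < 1" for \<rho>
    using xy that mult_strict_mono[of y 1 \<rho> 1] by (intro decrD[OF assms] mult_right_mono) auto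
  then show "S m g y \<le> S m g x"
    using xy by (simp add: S_scaled[OF decr_measurable[OF assms]] unit_integral_mono mult_left_mono)
qed

lemma triangle_fubini:
  assumes [measurable]: "a \<in> M_plus" "b \<in> M_plus" "(\<lambda>(s, r). \<kappa> s r) \<in> borel_measurable (unit_int \<Otimes>\<^sub>M unit_int)"
  shows "(\<integral>\<^sub>1s. a s * (\<integral>\<^sub>1r. \<kappa> s r * b r * indicator {..<s} r) * indicator {..<t} s)
    = (\<integral>\<^sub>1r. b r * (\<integral>\<^sub>1s. a s * \<kappa> s r * indicator {r<..<t} s))"
proof -
  define i where "i s r = (if r < s \<and> s < t then 1 else 0 :: ennreal)" for s r :: real
  have [measurable]: "(\<lambda>(s, r). i s r) \<in> borel_measurable (unit_int \<Otimes>\<^sub>M unit_int)"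
    unfolding i_def by measurable
  have [measurable]: "(\<lambda>(s, r). a s * \<kappa> s r * b r * i s r) \<in> borel_measurable (unit_int \<Otimes>\<^sub>M unit_int)"
    by measurable
  have [measurable]: "(\<lambda>r. \<kappa> s r) \<in> M_plus" if "s \<in> space unit_int" for s
    using measurable_Pair2[OF assms(3) that] by simp
  have [measurable]: "(\<lambda>s. \<kappa> s r) \<in> M_plus" if "r \<in> space unit_int" for r
    using measurable_Pair1[OF assms(3) that] by simp
  have [measurable]: "(\<lambda>r. i s r) \<in> M_plus" "(\<lambda>s. i s r) \<in> M_plus" for s r
    unfolding i_def by measurable
  have "(\<integral>\<^sub>1s. a s * (\<integral>\<^sub>1r. \<kappa> s r * b r * indicator {..<s} r) * indicator {..<t} s)
      = (\<integral>\<^sub>1s. (\<integral>\<^sub>1r. a s * \<kappa> s r * b r * i s r))"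
  proof (rule nn_integral_cong)
    fix s assume s [measurable]: "s \<in> space unit_int"
    have "a s * (\<integral>\<^sub>1r. \<kappa> s r * b r * indicator {..<s} r) * indicator {..<t} s
        = (\<integral>\<^sub>1r. (a s * indicator {..<t} s) * (\<kappa> s r * b r * indicator {..<s} r))"
      using s by (subst nn_integral_cmult) (auto simp: mult_ac)
    also have "\<dots> = (\<integral>\<^sub>1r. a s * \<kappa> s r * b r * i s r)"
      by (rule nn_integral_cong) (auto simp: i_def mult_ac split: split_indicator)
    finally show "a s * (\<integral>\<^sub>1r. \<kappa> s r * b r * indicator {..<s} r) * indicator {..<t} s
        = (\<integral>\<^sub>1r. a s * \<kappa> s r * b r * i s r)" .
  qed
  also have "\<dots> = (\<integral>\<^sub>1r. (\<integral>\<^sub>1s. a s * \<kappa> s r * b r * i s r))"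
    by (rule unit_int2.Fubini'[symmetric]) measurable
  also have "\<dots> = (\<integral>\<^sub>1r. b r * (\<integral>\<^sub>1s. a s * \<kappa> s r * indicator {r<..<t} s))"
  proof (rule nn_integral_cong)
    fix r assume r [measurable]: "r \<in> space unit_int"
    have "b r * (\<integral>\<^sub>1s. a s * \<kappa> s r * indicator {r<..<t} s)
        = (\<integral>\<^sub>1s. b r * (a s * \<kappa> s r * indicator {r<..<t} s))"
      using r by (subst nn_integral_cmult) auto
    also have "\<dots> = (\<integral>\<^sub>1s. a s * \<kappa> s r * b r * i s r)"
      by (rule nn_integral_cong) (auto simp: i_def mult_ac split: split_indicator)
    finally show "(\<integral>\<^sub>1s. a s * \<kappa> s r * b r * i s r)
        = b r * (\<integral>\<^sub>1s. a s * \<kappa> s r * indicator {r<..<t} s)" by simp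
  qed
  finally show ?thesis .
qed

lemma nn_integral_S:
  assumes [measurable]: "a \<in> M_plus" "g \<in> M_plus"
  shows "(\<integral>\<^sub>1s. a s * S m g s * indicator {..<t} s)
    = (\<integral>\<^sub>1r. g r * (\<integral>\<^sub>1s. a s * ennreal (1 / s) * ennreal (ln (s / r) ^ (m - 1)) * indicator {r<..<t} s))"
proof -
  have "(\<integral>\<^sub>1s. a s * S m g s * indicator {..<t} s)
      = (\<integral>\<^sub>1s. (a s * ennreal (1 / s)) * (\<integral>\<^sub>1r. ennreal (ln (s / r) ^ (m - 1)) * g r * indicator {..<s} r) * indicator {..<t} s)"
    by (rule unit_integral_cong) (simp add: S_eq mult.assoc)
  also have "\<dots> = (\<integral>\<^sub>1r. g r * (\<integral>\<^sub>1s. a s * ennreal (1 / s) * ennreal (ln (s / r) ^ (m - 1)) * indicator {r<..<t} s))"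
    by (rule triangle_fubini) measurable
  finally show ?thesis .
qed

lemma S_Q_dual:
  assumes [measurable]: "F \<in> M_plus" "g \<in> M_plus"
  shows "(\<integral>\<^sub>1s. F s * S m g s) = (\<integral>\<^sub>1r. Q m F r * g r)"
proof -
  have "(\<integral>\<^sub>1s. F s * S m g s) = (\<integral>\<^sub>1s. F s * S m g s * indicator {..<1} s)"
    by (rule unit_integral_cong) auto
  also have "\<dots> = (\<integral>\<^sub>1r. Q m F r * g r)"
    by (subst nn_integral_S) (auto simp: Q_def mult_ac)
  finally show ?thesis .
qed

lemma decr_Q: "decr (Q m F)"
proof (rule decrI)
  fix x y :: real assume xy: "0 < x" "x \<le> y" "y < 1"
  show "Q m F y \<le> Q m F x" unfolding Q_def
  proof (rule unit_integral_mono)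
    fix s :: real assume s: "0 < s" "s < 1"
    have "ln (s / y) ^ (m - 1) \<le> ln (s / x) ^ (m - 1)" if "y < s"
      using that xy by (intro power_mono) (auto simp: field_simps)
    then show "F s * ennreal (1 / s) * ennreal (ln (s / y) ^ (m - 1)) * indicator {y<..<1} s
        \<le> F s * ennreal (1 / s) * ennreal (ln (s / x) ^ (m - 1)) * indicator {x<..<1} s"
      using xy by (auto split: split_indicator intro!: mult_left_mono ennreal_leI)
  qed
qed

lemma log_kernel_integral:
  assumes "0 < r" "r \<le> t" "t \<le> 1" "1 \<le> m"
  shows "(\<integral>\<^sub>1s. ennreal (1 / s) * ennreal (ln (s / r) ^ (m - 1)) * indicator {r<..<t} s) = ennreal (ln (t / r) ^ m / real m)"
proof -
  have "(\<integral>\<^sub>1s. ennreal (1 / s) * ennreal (ln (s / r) ^ (m - 1)) * indicator {r<..<t} s)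
      = (\<integral>\<^sub>1s. ennreal (ln (s / r) ^ (m - 1) / s) * indicator {r<..<t} s)"
    using assms by (intro unit_integral_cong) (auto split: split_indicator simp flip: ennreal_mult)
  also have "\<dots> = ennreal (ln (t / r) ^ m / real m - ln (r / r) ^ m / real m)"
  proof (rule unit_int_FTC)
    fix x assume x: "r \<le> x" "x \<le> t"
    have "((\<lambda>x. ln (x / r) ^ m / real m) has_real_derivative real m * ln (x / r) ^ (m - 1) * (1 / x) / real m) (at x)"
      using x assms by (auto intro!: derivative_eq_intros)
    then show "((\<lambda>x. ln (x / r) ^ m / real m) has_real_derivative ln (x / r) ^ (m - 1) / x) (at x)"
      using assms(4) by simp
    show "0 \<le> ln (x / r) ^ (m - 1) / x" using x assms by (auto intro!: divide_nonneg_pos zero_le_power)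
  qed (use assms in auto)
  also have "ln (r / r) ^ m = 0" using assms by (cases m) auto
  finally show ?thesis by simp
qed

text \<open>After interchanging the integrals, the kernel becomes the integral of
  \<open>ln (s / r) ^ (m - 1) / s\<close> over \<open>(r, t)\<close>, which raises the power of the
  logarithm by one and produces the factor \<open>1 / m\<close>. Dividing by \<open>t\<close> gives
  the semigroup law \<open>S_1_S\<close>.\<close>

lemma nn_integral_S_prefix:
  assumes [measurable]: "g \<in> M_plus" and t: "0 < t" "t \<le> 1" and m: "1 \<le> m"
  shows "(\<integral>\<^sub>1s. S m g s * indicator {..<t} s)
    = ennreal (1 / real m) * (\<integral>\<^sub>1r. ennreal (ln (t / r) ^ m) * g r * indicator {..<t} r)"
proof -
  have "(\<integral>\<^sub>1s. S m g s * indicator {..<t} s)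
      = (\<integral>\<^sub>1r. g r * (\<integral>\<^sub>1s. ennreal (1 / s) * ennreal (ln (s / r) ^ (m - 1)) * indicator {r<..<t} s))"
    using nn_integral_S[of "\<lambda>_. 1" g m t] by simp
  also have "\<dots> = (\<integral>\<^sub>1r. ennreal (1 / real m) * (ennreal (ln (t / r) ^ m) * g r * indicator {..<t} r))"
  proof (rule unit_integral_cong)
    fix r :: real assume r: "0 < r" "r < 1"
    show "g r * (\<integral>\<^sub>1s. ennreal (1 / s) * ennreal (ln (s / r) ^ (m - 1)) * indicator {r<..<t} s)
        = ennreal (1 / real m) * (ennreal (ln (t / r) ^ m) * g r * indicator {..<t} r)"
    proof (cases "r < t")
      case True
      then have "ennreal (ln (t / r) ^ m / real m) = ennreal (1 / real m) * ennreal (ln (t / r) ^ m)"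
        using r by (simp flip: ennreal_mult)
      then show ?thesis using log_kernel_integral[of r t m] True r t m by (simp add: mult_ac)
    next
      case False
      then have "{r<..<t} = {}" by auto
      then show ?thesis using False by simp
    qed
  qed
  also have "\<dots> = ennreal (1 / real m) * (\<integral>\<^sub>1r. ennreal (ln (t / r) ^ m) * g r * indicator {..<t} r)"
    by (rule nn_integral_cmult) measurable
  finally show ?thesis .
qed

lemma S_1_S:
  assumes "g \<in> M_plus" "0 < t" "t \<le> 1" "1 \<le> m"
  shows "S 1 (S m g) t = ennreal (1 / real m) * S (m + 1) g t"
  using nn_integral_S_prefix[OF assms] assms by (simp add: S_eq mult_ac)

lemma S_1_one:
  assumes "0 < t" "t \<le> 1"
  shows "S 1 (\<lambda>_. 1) t = 1"
proof -
  have "(\<integral>\<^sub>1r. indicator {..<t} r) = (\<integral>\<^sub>1r. indicator {0<..<t} r)"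
    by (rule unit_integral_cong) (auto split: split_indicator)
  also have "\<dots> = emeasure unit_int {0<..<t}"
    using assms by (intro nn_integral_indicator sets_unit_intI) auto
  also have "\<dots> = ennreal t" using assms by (intro emeasure_unit_int_interval) auto
  finally show ?thesis using assms by (simp add: S_eq flip: ennreal_mult)
qed

lemma S_one:
  assumes "0 < t" "t \<le> 1" "1 \<le> m"
  shows "S m (\<lambda>_. 1) t = ennreal (fact (m - 1))"
  using assms(3,1,2)
proof (induction m arbitrary: t rule: nat_induct_at_least)
  case base
  then show ?case using S_1_one by simp
next
  case (Suc m)
  have one: "(\<lambda>_. 1) \<in> M_plus" by simp
  have "S 1 (S m (\<lambda>_. 1)) t = S 1 (\<lambda>r. ennreal (fact (m - 1)) * 1) t"
    using Suc by (intro S_cong) auto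
  also have "\<dots> = ennreal (fact (m - 1)) * S 1 (\<lambda>_. 1) t" using Suc.prems one by (intro S_cmult) auto
  also have "\<dots> = ennreal (fact (m - 1))" unfolding S_1_one[OF Suc.prems] by simp
  finally have "ennreal (1 / real m) * S (Suc m) (\<lambda>_. 1) t = ennreal (fact (m - 1))"
    using S_1_S[OF one Suc.prems Suc.hyps(1)] by simp
  then have "S (Suc m) (\<lambda>_. 1) t = ennreal (real m) * ennreal (fact (m - 1))"
    using ennreal_cancel(2)[of "real m" "S (Suc m) (\<lambda>_. 1) t"] Suc.hyps(1) by simp
  also have "\<dots> = ennreal (real m * fact (m - 1))" by (rule ennreal_mult[symmetric]) auto
  also have "real m * fact (m - 1) = fact (Suc m - 1)" using Suc.hyps(1) by (simp add: fact_num_eq_if)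
  finally show ?case .
qed

lemma S_const:
  assumes "0 < t" "t \<le> 1" "1 \<le> m"
  shows "S m (\<lambda>_. c) t = c * ennreal (fact (m - 1))"
  using S_cmult[of "\<lambda>_. 1" t m c] S_one[OF assms] assms by simp

lemma S_ge:
  assumes "decr g" "0 < s" "s < 1" "1 \<le> m"
  shows "g s * ennreal (fact (m - 1)) \<le> S m g s"
proof -
  have "g s * ennreal (fact (m - 1)) = S m (\<lambda>_. g s) s" using assms by (simp add: S_const)
  also have "\<dots> \<le> S m g s" using assms by (intro S_mono) (auto intro: decrD[OF assms(1)])
  finally show ?thesis .
qed

lemma S_integral_ge:
  assumes "decr g" "1 \<le> m"
  shows "(\<integral>\<^sub>1s. g s) \<le> (\<integral>\<^sub>1s. S m g s)"
proof (rule unit_integral_mono)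
  fix s :: real assume s: "0 < s" "s < 1"
  have "(1::real) \<le> fact (m - 1)" by (rule fact_ge_1)
  then have "g s * 1 \<le> g s * ennreal (fact (m - 1))" by (intro mult_left_mono) (simp_all flip: ennreal_1)
  also have "\<dots> \<le> S m g s" using s assms by (intro S_ge)
  finally show "g s \<le> S m g s" by simp
qed

section \<open>The function norm with a prescribed associate norm\<close>

text \<open>The part of the axioms of a function norm that the construction of \<open>X_norm\<close> depends on.\<close>

definition weak_norm :: "((real \<Rightarrow> ennreal) \<Rightarrow> ennreal) \<Rightarrow> bool" where
  "weak_norm Y \<longleftrightarrow>
     (\<exists>c>0. Y (\<lambda>_. ennreal c) \<le> 1) \<and>
     (\<exists>C\<ge>0. \<forall>F\<in>M_plus. Y F \<le> 1 \<longrightarrow> (\<integral>\<^sub>1x. F x) \<le> ennreal C) \<and>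
     (\<forall>F\<in>M_plus. Y (rearr01 F) = Y F) \<and>
     (\<forall>F\<in>M_plus. \<forall>c>0. Y (\<lambda>x. ennreal c * F x) = ennreal c * Y F)"

lemma ri_norm_weak_norm:
  assumes X: "ri_norm X"
  shows "weak_norm X"
  unfolding weak_norm_def
proof (intro conjI ballI allI impI)
  obtain a where a: "0 \<le> a" "X (\<lambda>_. 1) = ennreal a"
    using ri_one[OF X] by (cases "X (\<lambda>_. 1)") auto
  have "X (\<lambda>_. ennreal (1 / (a + 1))) = ennreal (1 / (a + 1)) * ennreal a"
    using ri_scale[OF X, of "\<lambda>_. 1" "1 / (a + 1)"] a by simp
  also have "\<dots> \<le> 1" using a by (simp flip: ennreal_mult ennreal_1)
  finally show "\<exists>c>0. X (\<lambda>_. ennreal c) \<le> 1" using a by (intro exI[of _ "1 / (a + 1)"]) auto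
  obtain C where C: "\<And>f. f \<in> M_plus \<Longrightarrow> (\<integral>\<^sub>1x. f x) \<le> ennreal C * X f"
    using ri_integral[OF X] by blast
  show "\<exists>C\<ge>0. \<forall>F\<in>M_plus. X F \<le> 1 \<longrightarrow> (\<integral>\<^sub>1x. F x) \<le> ennreal C"
  proof (intro exI[of _ "max 0 C"] conjI ballI impI)
    fix F assume F: "F \<in> M_plus" "X F \<le> 1"
    have "(\<integral>\<^sub>1x. F x) \<le> ennreal C * X F" by (rule C[OF F(1)])
    also have "\<dots> \<le> ennreal C * 1" by (rule mult_left_mono[OF F(2)]) simp
    also have "\<dots> \<le> ennreal (max 0 C)" by (simp add: ennreal_leI)
    finally show "(\<integral>\<^sub>1x. F x) \<le> ennreal (max 0 C)" .
  qed simp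
  show "X (rearr01 F) = X F" if "F \<in> M_plus" for F
    using that by (intro ri_rearr[OF X] rearr01_rearr01) auto
  show "X (\<lambda>x. ennreal c * F x) = ennreal c * X F" if "F \<in> M_plus" "0 < c" for F c
    using that by (intro ri_scale[OF X]) auto
qed

lemma assoc_least: "(\<And>f. f \<in> M_plus \<Longrightarrow> Y f \<le> 1 \<Longrightarrow> (\<integral>\<^sub>1s. f s * g s) \<le> K) \<Longrightarrow> assoc Y g \<le> K"
  unfolding assoc_def by (rule SUP_least) auto

lemma assoc_cong: "(\<And>s. 0 < s \<Longrightarrow> s < 1 \<Longrightarrow> g s = g' s) \<Longrightarrow> assoc Y g = assoc Y g'"
  unfolding assoc_def by (intro SUP_cong refl unit_integral_cong) auto

lemma assoc_cmult:
  assumes [measurable]: "g \<in> M_plus"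
  shows "assoc Y (\<lambda>s. ennreal c * g s) = ennreal c * assoc Y g"
proof -
  have "(\<integral>\<^sub>1s. f s * (ennreal c * g s)) = ennreal c * (\<integral>\<^sub>1s. f s * g s)" if [measurable]: "f \<in> M_plus" for f
    by (subst nn_integral_cmult[symmetric]) (auto simp: mult_ac)
  then show ?thesis unfolding assoc_def by (simp add: SUP_mult_left_ennreal cong: SUP_cong_simp)
qed

lemma tilde_assoc_decr: "decr g \<Longrightarrow> tilde_assoc Y m g = assoc Y (S m g)"
  unfolding tilde_assoc_S by (rule assoc_cong) (simp add: S_rearr)

lemma tilde_assoc_cmult:
  assumes "g \<in> M_plus" "0 \<le> c"
  shows "tilde_assoc Y m (\<lambda>x. ennreal c * g x) = ennreal c * tilde_assoc Y m g"
proof -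
  have "tilde_assoc Y m (\<lambda>x. ennreal c * g x) = assoc Y (\<lambda>s. ennreal c * S m (rearr01 g) s)"
    unfolding tilde_assoc_S
  proof (rule assoc_cong)
    fix s :: real assume s: "0 < s" "s < 1"
    have "S m (rearr01 (\<lambda>x. ennreal c * g x)) s = S m (\<lambda>r. ennreal c * rearr01 g r) s"
      using s assms by (intro S_cong) (auto simp: rearr01_cmult)
    then show "S m (rearr01 (\<lambda>x. ennreal c * g x)) s = ennreal c * S m (rearr01 g) s"
      using s by (simp add: S_cmult)
  qed
  then show ?thesis
    using decr_measurable[OF decr_S[OF decr_rearr01]] by (simp add: tilde_assoc_S assoc_cmult)
qed

context
  fixes Y :: "(real \<Rightarrow> ennreal) \<Rightarrow> ennreal" and m :: nat
  assumes Y: "weak_norm Y" and m: "1 \<le> m"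
begin

text \<open>\<open>S m\<close> multiplies constants by \<open>fact (m - 1)\<close>, and integrals
  are bounded by \<open>C\<close> on the unit ball of \<open>Y\<close>; \<delta> compensates both
  factors, with \<open>C + 1\<close> to avoid division by zero.\<close>

lemma tilde_assoc_const: "\<exists>\<delta>>0. tilde_assoc Y m (\<lambda>_. ennreal \<delta>) \<le> 1"
proof -
  obtain C where C: "0 \<le> C" "\<And>F. F \<in> M_plus \<Longrightarrow> Y F \<le> 1 \<Longrightarrow> (\<integral>\<^sub>1x. F x) \<le> ennreal C"
    using Y unfolding weak_norm_def by blast
  define \<delta> :: real where "\<delta> = 1 / (fact (m - 1) * (C + 1))"
  have "0 < \<delta>" using C(1) by (simp add: \<delta>_def)
  have "tilde_assoc Y m (\<lambda>_. ennreal \<delta>) \<le> 1"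
    unfolding tilde_assoc_decr[OF decr_const]
  proof (rule assoc_least)
    fix f assume f [measurable]: "f \<in> M_plus" and Yf: "Y f \<le> 1"
    have "(\<integral>\<^sub>1s. f s * S m (\<lambda>_. ennreal \<delta>) s) = (\<integral>\<^sub>1s. f s * ennreal (1 / (C + 1)))"
      using C(1) \<open>0 < \<delta>\<close> m by (intro unit_integral_cong) (simp add: S_const \<delta>_def flip: ennreal_mult)
    also have "\<dots> = (\<integral>\<^sub>1s. f s) * ennreal (1 / (C + 1))" by (rule nn_integral_multc) measurable
    also have "\<dots> \<le> ennreal C * ennreal (1 / (C + 1))" by (intro mult_right_mono C f Yf) simp
    also have "\<dots> \<le> 1" using C(1) by (simp flip: ennreal_mult ennreal_1)
    finally show "(\<integral>\<^sub>1s. f s * S m (\<lambda>_. ennreal \<delta>) s) \<le> 1" .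
  qed
  then show ?thesis using \<open>0 < \<delta>\<close> by blast
qed

text \<open>A small positive constant lies in the unit ball of \<open>Y\<close>, and pairing with it
  measures the integral of \<open>S m g\<close>.\<close>

lemma tilde_assoc_coercive:
  obtains c where "0 < c" "\<And>g. decr g \<Longrightarrow> assoc Y (S m g) \<le> 1 \<Longrightarrow> (\<integral>\<^sub>1s. S m g s) \<le> ennreal c"
proof -
  obtain c where c: "0 < c" "Y (\<lambda>_. ennreal c) \<le> 1" using Y unfolding weak_norm_def by blast
  show thesis
  proof (rule that[of "1 / c"])
    fix g assume g: "decr g" "assoc Y (S m g) \<le> 1"
    have [measurable]: "S m g \<in> M_plus" by (rule decr_measurable[OF decr_S[OF g(1)]])
    have "ennreal c * (\<integral>\<^sub>1s. S m g s) = (\<integral>\<^sub>1s. ennreal c * S m g s)"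
      by (rule nn_integral_cmult[symmetric]) measurable
    also have "\<dots> \<le> assoc Y (S m g)" unfolding assoc_def using c by (intro SUP_upper) auto
    finally have "ennreal c * (\<integral>\<^sub>1s. S m g s) \<le> 1" using g(2) by simp
    then show "(\<integral>\<^sub>1s. S m g s) \<le> ennreal (1 / c)" by (rule ennreal_le_inverse[OF c(1)])
  qed (use c in simp)
qed

lemma tilde_assoc_integral:
  obtains C where "0 < C" "\<And>g. g \<in> M_plus \<Longrightarrow> tilde_assoc Y m g \<le> 1 \<Longrightarrow> (\<integral>\<^sub>1s. rearr01 g s) \<le> ennreal C"
proof -
  obtain c where c: "0 < c" "\<And>g. decr g \<Longrightarrow> assoc Y (S m g) \<le> 1 \<Longrightarrow> (\<integral>\<^sub>1s. S m g s) \<le> ennreal c"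
    using tilde_assoc_coercive by blast
  show thesis
  proof (rule that[OF c(1)])
    fix g assume g: "g \<in> M_plus" "tilde_assoc Y m g \<le> 1"
    have "(\<integral>\<^sub>1s. rearr01 g s) \<le> (\<integral>\<^sub>1s. S m (rearr01 g) s)" by (intro S_integral_ge decr_rearr01 m)
    also have "\<dots> \<le> ennreal c" using g by (intro c decr_rearr01) (simp add: tilde_assoc_S)
    finally show "(\<integral>\<^sub>1s. rearr01 g s) \<le> ennreal c" .
  qed
qed

text \<open>A witness for the choice that defines \<open>tilde\<close>: the associate functional of
  \<open>tilde_assoc Y m\<close>. With both functions rearranged, invariance under rearrangement is
  immediate, and the triangle inequality becomes the axiom that needs work.\<close>

definition tilde_norm :: "(real \<Rightarrow> ennreal) \<Rightarrow> ennreal" where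
  "tilde_norm f = (SUP g\<in>{g\<in>M_plus. tilde_assoc Y m g \<le> 1}. \<integral>\<^sub>1s. rearr01 f s * rearr01 g s)"

lemma tilde_norm_upper:
  "g \<in> M_plus \<Longrightarrow> tilde_assoc Y m g \<le> 1 \<Longrightarrow> (\<integral>\<^sub>1s. rearr01 f s * rearr01 g s) \<le> tilde_norm f"
  unfolding tilde_norm_def by (rule SUP_upper) auto

lemma tilde_norm_least:
  "(\<And>g. g \<in> M_plus \<Longrightarrow> tilde_assoc Y m g \<le> 1 \<Longrightarrow> (\<integral>\<^sub>1s. rearr01 f s * rearr01 g s) \<le> K) \<Longrightarrow> tilde_norm f \<le> K"
  unfolding tilde_norm_def by (rule SUP_least) auto

lemma tilde_norm_mono:
  assumes "f \<in> M_plus" "g \<in> M_plus" "AE x in unit_int. f x \<le> g x"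
  shows "tilde_norm f \<le> tilde_norm g"
  unfolding tilde_norm_def
  by (intro SUP_subset_mono order_refl unit_integral_mono mult_right_mono rearr01_mono_AE assms) auto

text \<open>Rearrangement is not subadditive pointwise. Instead \<open>resonance\<close> supplies
  one \<open>k\<close> equimeasurable with \<open>g\<close> whose pairing with the sum itself is as
  large as that of the rearrangements. Pairing with \<open>k\<close> is additive, and Hardy and
  Littlewood bound each summand.\<close>

lemma tilde_norm_add:
  assumes [measurable]: "f1 \<in> M_plus" "f2 \<in> M_plus"
  shows "tilde_norm (\<lambda>x. f1 x + f2 x) \<le> tilde_norm f1 + tilde_norm f2"
proof (rule tilde_norm_least)
  fix g assume g [measurable]: "g \<in> M_plus" and Ng: "tilde_assoc Y m g \<le> 1"
  obtain k where k_meas [measurable]: "k \<in> M_plus" and k: "\<And>s. 0 \<le> s \<Longrightarrow> rearr01 k s = rearr01 (rearr01 g) s"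
    "(\<integral>\<^sub>1x. rearr01 g x * rearr01 (\<lambda>x. f1 x + f2 x) x) \<le> (\<integral>\<^sub>1x. k x * (f1 x + f2 x))"
    using resonance[of "\<lambda>x. f1 x + f2 x", OF _ decr_rearr01[of g]] by auto
  have part: "(\<integral>\<^sub>1x. k x * f x) \<le> tilde_norm f" if [measurable]: "f \<in> M_plus" for f
  proof -
    have "(\<integral>\<^sub>1x. k x * f x) \<le> (\<integral>\<^sub>1x. rearr01 k x * rearr01 f x)"
      by (rule hardy_littlewood) measurable
    also have "\<dots> = (\<integral>\<^sub>1x. rearr01 f x * rearr01 g x)"
      by (rule unit_integral_cong) (simp add: k(1) rearr01_rearr01 mult.commute)
    also have "\<dots> \<le> tilde_norm f" by (rule tilde_norm_upper[OF g Ng])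
    finally show ?thesis .
  qed
  have "(\<integral>\<^sub>1x. rearr01 (\<lambda>x. f1 x + f2 x) x * rearr01 g x) \<le> (\<integral>\<^sub>1x. k x * (f1 x + f2 x))"
    using k(2) by (simp add: mult.commute)
  also have "\<dots> = (\<integral>\<^sub>1x. k x * f1 x) + (\<integral>\<^sub>1x. k x * f2 x)"
    by (subst nn_integral_add[symmetric]) (auto simp: distrib_left)
  also have "\<dots> \<le> tilde_norm f1 + tilde_norm f2" by (intro add_mono part) measurable
  finally show "(\<integral>\<^sub>1x. rearr01 (\<lambda>x. f1 x + f2 x) x * rearr01 g x) \<le> tilde_norm f1 + tilde_norm f2" .
qed

lemma tilde_norm_ri_norm: "ri_norm tilde_norm"
  unfolding ri_norm_def
proof (intro conjI ballI allI impI)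
  obtain \<delta> where \<delta>: "0 < \<delta>" "tilde_assoc Y m (\<lambda>_. ennreal \<delta>) \<le> 1" using tilde_assoc_const by blast
  have lower: "ennreal \<delta> * (\<integral>\<^sub>1x. f x) \<le> tilde_norm f" if [measurable]: "f \<in> M_plus" for f
  proof -
    have "ennreal \<delta> * (\<integral>\<^sub>1x. f x) = (\<integral>\<^sub>1x. ennreal \<delta> * rearr01 f x)"
      by (subst nn_integral_cmult) (auto simp: nn_integral_rearr01)
    also have "\<dots> = (\<integral>\<^sub>1x. rearr01 f x * rearr01 (\<lambda>_. ennreal \<delta>) x)"
      using nn_integral_rearr01_decr[OF decr_const, of "rearr01 f" "ennreal \<delta>"] by (simp add: mult.commute)
    also have "\<dots> \<le> tilde_norm f" by (rule tilde_norm_upper) (use \<delta> in auto)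
    finally show ?thesis .
  qed
  show "(tilde_norm f = 0) = (AE x in unit_int. f x = 0)" if [measurable]: "f \<in> M_plus" for f
  proof
    assume "tilde_norm f = 0"
    then have "(\<integral>\<^sub>1x. f x) = 0" using lower[of f] \<delta>(1) by simp
    then show "AE x in unit_int. f x = 0" by (simp add: nn_integral_0_iff_AE)
  next
    assume z: "AE x in unit_int. f x = 0"
    have "tilde_norm f \<le> 0"
    proof (rule tilde_norm_least)
      fix g
      have "(\<integral>\<^sub>1x. rearr01 f x * rearr01 g x) = (\<integral>\<^sub>1x. 0)"
        using rearr01_zero[OF that z] by (intro unit_integral_cong) auto
      then show "(\<integral>\<^sub>1x. rearr01 f x * rearr01 g x) \<le> 0" by simp
    qed
    then show "tilde_norm f = 0" by simp
  qed
  show "tilde_norm (\<lambda>x. ennreal c * f x) = ennreal c * tilde_norm f" if f [measurable]: "f \<in> M_plus" and c: "0 \<le> c" for f c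
  proof -
    have "(\<integral>\<^sub>1s. rearr01 (\<lambda>x. ennreal c * f x) s * rearr01 g s) = ennreal c * (\<integral>\<^sub>1s. rearr01 f s * rearr01 g s)" for g
    proof -
      have "(\<integral>\<^sub>1s. rearr01 (\<lambda>x. ennreal c * f x) s * rearr01 g s) = (\<integral>\<^sub>1s. ennreal c * (rearr01 f s * rearr01 g s))"
        by (rule unit_integral_cong) (simp add: rearr01_cmult[OF f c] mult.assoc)
      then show ?thesis by (simp add: nn_integral_cmult)
    qed
    then show ?thesis unfolding tilde_norm_def by (simp add: SUP_mult_left_ennreal)
  qed
  show "tilde_norm (\<lambda>x. f x + g x) \<le> tilde_norm f + tilde_norm g" if "f \<in> M_plus" "g \<in> M_plus" for f g
    using that by (rule tilde_norm_add)
  show "tilde_norm f \<le> tilde_norm g" if "f \<in> M_plus" "g \<in> M_plus" "AE x in unit_int. f x \<le> g x" for f g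
    using that by (rule tilde_norm_mono)
  show "tilde_norm (\<lambda>_. 1) < \<infinity>"
  proof -
    obtain C where C: "\<And>g. g \<in> M_plus \<Longrightarrow> tilde_assoc Y m g \<le> 1 \<Longrightarrow> (\<integral>\<^sub>1s. rearr01 g s) \<le> ennreal C"
      using tilde_assoc_integral by blast
    have "tilde_norm (\<lambda>_. 1) \<le> ennreal C"
      by (rule tilde_norm_least) (use C in \<open>simp add: nn_integral_rearr01_decr[OF decr_const]\<close>)
    also have "\<dots> < \<infinity>" by simp
    finally show ?thesis .
  qed
  show "\<exists>C::real. \<forall>f\<in>M_plus. (\<integral>\<^sub>1x. f x) \<le> ennreal C * tilde_norm f"
  proof (intro exI[of _ "1 / \<delta>"] ballI)
    fix f assume f: "f \<in> M_plus"
    show "(\<integral>\<^sub>1x. f x) \<le> ennreal (1 / \<delta>) * tilde_norm f"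
      using mult_left_mono[OF lower[OF f], of "ennreal (1 / \<delta>)"] by (simp add: ennreal_cancel(1)[OF \<delta>(1)])
  qed
  show "tilde_norm f = tilde_norm g" if "\<forall>s\<in>{0<..<1}. rearr01 f s = rearr01 g s" for f g
    unfolding tilde_norm_def using that by (intro SUP_cong refl unit_integral_cong) auto
  fix F f assume f [measurable]: "f \<in> M_plus"
    and F: "(\<forall>j::nat. F j \<in> M_plus) \<and> (AE x in unit_int. incseq (\<lambda>j. F j x) \<and> (\<lambda>j. F j x) \<longlonglongrightarrow> f x)"
  have [measurable]: "F j \<in> M_plus" for j using F by blast
  have ae: "AE x in unit_int. incseq (\<lambda>j. F j x) \<and> (\<lambda>j. F j x) \<longlonglongrightarrow> f x" using F by blast
  have step: "AE x in unit_int. F j x \<le> F (Suc j) x" for j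
    using ae by eventually_elim (auto dest: incseq_SucD)
  show inc: "incseq (\<lambda>j. tilde_norm (F j))"
    by (intro incseq_SucI tilde_norm_mono step) measurable
  have "(\<integral>\<^sub>1s. rearr01 f s * rearr01 g s) = (SUP j. \<integral>\<^sub>1s. rearr01 (F j) s * rearr01 g s)" for g
  proof -
    have "(\<integral>\<^sub>1s. rearr01 f s * rearr01 g s) = (\<integral>\<^sub>1s. (SUP j. rearr01 (F j) s * rearr01 g s))"
      using rearr01_SUP[of F f] ae by (intro unit_integral_cong) (simp flip: SUP_mult_right_ennreal)
    also have "\<dots> = (SUP j. \<integral>\<^sub>1s. rearr01 (F j) s * rearr01 g s)"
    proof (rule nn_integral_monotone_convergence_SUP_AE)
      show "AE s in unit_int. rearr01 (F j) s * rearr01 g s \<le> rearr01 (F (Suc j)) s * rearr01 g s" for j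
      proof (intro AE_I2 mult_right_mono)
        fix s assume "s \<in> space unit_int"
        then show "rearr01 (F j) s \<le> rearr01 (F (Suc j)) s"
          by (intro rearr01_mono_AE step) (auto simp: space_unit_int)
      qed simp
    qed measurable
    finally show ?thesis .
  qed
  then have "tilde_norm f = (SUP j. tilde_norm (F j))"
    unfolding tilde_norm_def by (simp add: SUP_commute[of _ UNIV])
  then show "(\<lambda>j. tilde_norm (F j)) \<longlonglongrightarrow> tilde_norm f" using LIMSEQ_SUP[OF inc] by simp
qed

text \<open>The upper bound is Hardy and Littlewood together with scaling. For the lower bound,
  duality writes \<open>tilde_assoc Y m g\<close> as the supremum of the pairings of
  \<open>Q m F\<close> with \<open>rearr01 g\<close> over the unit ball of \<open>Y\<close>; since
  \<open>Q m F\<close> decreases, \<open>resonance\<close> replaces it by an equimeasurable function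
  paired with \<open>g\<close> itself.\<close>

lemma assoc_tilde_norm:
  assumes g [measurable]: "g \<in> M_plus"
  shows "assoc tilde_norm g = tilde_assoc Y m g"
proof (rule antisym)
  show "assoc tilde_norm g \<le> tilde_assoc Y m g"
  proof (rule assoc_least)
    fix f assume f [measurable]: "f \<in> M_plus" and Zf: "tilde_norm f \<le> 1"
    show "(\<integral>\<^sub>1s. f s * g s) \<le> tilde_assoc Y m g"
    proof (rule dense_ge)
      fix y assume y: "tilde_assoc Y m g < y"
      show "(\<integral>\<^sub>1s. f s * g s) \<le> y"
      proof (cases y)
        case (real K)
        then have K: "0 < K" using y by (auto simp: order_less_le)
        have "tilde_assoc Y m (\<lambda>x. ennreal (1 / K) * g x) \<le> ennreal (1 / K) * ennreal K"
          using K y real by (subst tilde_assoc_cmult) (auto intro!: mult_left_mono)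
        then have "tilde_assoc Y m (\<lambda>x. ennreal (1 / K) * g x) \<le> 1" using K by (simp flip: ennreal_mult)
        then have "(\<integral>\<^sub>1s. rearr01 f s * rearr01 (\<lambda>x. ennreal (1 / K) * g x) s) \<le> 1"
          using tilde_norm_upper[of "\<lambda>x. ennreal (1 / K) * g x" f] Zf by (auto intro: order_trans)
        then have "(\<integral>\<^sub>1s. f s * (ennreal (1 / K) * g s)) \<le> 1"
          using hardy_littlewood[of f "\<lambda>x. ennreal (1 / K) * g x"] by (auto intro: order_trans)
        also have "(\<integral>\<^sub>1s. f s * (ennreal (1 / K) * g s)) = ennreal (1 / K) * (\<integral>\<^sub>1s. f s * g s)"
          by (subst nn_integral_cmult[symmetric]) (auto simp: mult_ac)
        finally show ?thesis using K real by (simp add: ennreal_le_scaled)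
      qed simp
    qed
  qed
  show "tilde_assoc Y m g \<le> assoc tilde_norm g"
    unfolding tilde_assoc_S
  proof (rule assoc_least)
    fix F assume F [measurable]: "F \<in> M_plus" and YF: "Y F \<le> 1"
    obtain k where k_meas [measurable]: "k \<in> M_plus" and k: "\<And>s. 0 \<le> s \<Longrightarrow> rearr01 k s = rearr01 (Q m F) s"
      "(\<integral>\<^sub>1x. Q m F x * rearr01 g x) \<le> (\<integral>\<^sub>1x. k x * g x)"
      using resonance[OF g decr_Q] by blast
    have "tilde_norm k \<le> 1"
    proof (rule tilde_norm_least)
      fix g' assume g' [measurable]: "g' \<in> M_plus" and Ng': "tilde_assoc Y m g' \<le> 1"
      have "(\<integral>\<^sub>1s. rearr01 k s * rearr01 g' s) = (\<integral>\<^sub>1s. rearr01 (Q m F) s * rearr01 g' s)"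
        by (rule unit_integral_cong) (simp add: k(1))
      also have "\<dots> = (\<integral>\<^sub>1s. Q m F s * rearr01 g' s)"
        by (rule nn_integral_rearr01_decr[OF decr_Q]) measurable
      also have "\<dots> = (\<integral>\<^sub>1s. F s * S m (rearr01 g') s)"
        by (rule S_Q_dual[symmetric]) measurable
      also have "\<dots> \<le> assoc Y (S m (rearr01 g'))" unfolding assoc_def using F YF by (intro SUP_upper) auto
      also have "\<dots> \<le> 1" using Ng' by (simp add: tilde_assoc_S)
      finally show "(\<integral>\<^sub>1s. rearr01 k s * rearr01 g' s) \<le> 1" .
    qed
    have "(\<integral>\<^sub>1s. F s * S m (rearr01 g) s) = (\<integral>\<^sub>1s. Q m F s * rearr01 g s)"
      by (rule S_Q_dual) measurable
    also have "\<dots> \<le> (\<integral>\<^sub>1s. k s * g s)" by (rule k(2))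
    also have "\<dots> \<le> assoc tilde_norm g"
      unfolding assoc_def using \<open>tilde_norm k \<le> 1\<close> k_meas by (intro SUP_upper) auto
    finally show "(\<integral>\<^sub>1s. F s * S m (rearr01 g) s) \<le> assoc tilde_norm g" .
  qed
qed

section \<open>The norm \<open>tilde Y m\<close> as a supremum over decreasing functions\<close>

lemma tilde_spec: "ri_norm (tilde Y m)" "g \<in> M_plus \<Longrightarrow> assoc (tilde Y m) g = tilde_assoc Y m g"
proof -
  have "ri_norm (tilde Y m) \<and> (\<forall>g\<in>M_plus. assoc (tilde Y m) g = tilde_assoc Y m g)"
    unfolding tilde_def
    by (rule someI[of "\<lambda>Z. ri_norm Z \<and> (\<forall>g\<in>M_plus. assoc Z g = tilde_assoc Y m g)" tilde_norm])
      (use tilde_norm_ri_norm assoc_tilde_norm in blast)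
  then show "ri_norm (tilde Y m)" "g \<in> M_plus \<Longrightarrow> assoc (tilde Y m) g = tilde_assoc Y m g" by auto
qed

lemma tilde_upper:
  assumes "H \<in> M_plus" "decr g" "assoc Y (S m g) \<le> 1"
  shows "(\<integral>\<^sub>1s. H s * g s) \<le> tilde Y m H"
  using assms decr_measurable[OF assms(2)]
  by (intro ri_hoelder[OF tilde_spec(1)]) (simp_all add: tilde_spec(2) tilde_assoc_decr)

text \<open>By Lorentz and Luxemburg it suffices to pair \<open>H\<close> with the unit ball of the
  associate norm. As \<open>H\<close> decreases, Hardy and Littlewood allow each \<open>h\<close>
  there to be replaced by its rearrangement, through which the associate norm is defined.\<close>

lemma tilde_least:
  assumes H: "decr H" and K: "0 < K"
    and "\<And>g. decr g \<Longrightarrow> assoc Y (S m g) \<le> 1 \<Longrightarrow> (\<integral>\<^sub>1s. H s * g s) \<le> ennreal K"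
  shows "tilde Y m H \<le> ennreal K"
proof (rule lorentz_luxemburg[OF tilde_spec(1) decr_measurable[OF H] K])
  fix h assume h [measurable]: "h \<in> M_plus" and Zh: "assoc (tilde Y m) h \<le> 1"
  have [measurable]: "H \<in> M_plus" by (rule decr_measurable[OF H])
  have "(\<integral>\<^sub>1x. H x * h x) \<le> (\<integral>\<^sub>1x. rearr01 H x * rearr01 h x)"
    by (rule hardy_littlewood) measurable
  also have "\<dots> = (\<integral>\<^sub>1x. H x * rearr01 h x)"
    by (rule nn_integral_rearr01_decr[OF H]) measurable
  also have "\<dots> \<le> ennreal K"
    using Zh h by (intro assms(3) decr_rearr01) (simp add: tilde_spec(2) tilde_assoc_S)
  finally show "(\<integral>\<^sub>1x. H x * h x) \<le> ennreal K" .
qed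

end

section \<open>Majorants and logarithmic scales\<close>

lemma ln_2_div_pos: "0 < s \<Longrightarrow> s \<le> 1 \<Longrightarrow> 0 < ln (2 / s :: real)"
  by (simp add: field_simps)

lemma ln_2_div_mono: "0 < s \<Longrightarrow> s \<le> r \<Longrightarrow> ln (2 / r) \<le> ln (2 / s :: real)"
  by (simp add: field_simps)

lemma ln_2_div_ge: "0 < s \<Longrightarrow> s \<le> 1 \<Longrightarrow> ln 2 \<le> ln (2 / s :: real)"
  by (subst ln_le_cancel_iff) (auto simp: field_simps)

definition majorant :: "(real \<Rightarrow> ennreal) \<Rightarrow> real \<Rightarrow> ennreal" where
  "majorant \<psi> r = (SUP s\<in>{r..<1}. \<psi> s)"

lemma decr_majorant: "decr (majorant \<psi>)"
  unfolding majorant_def by (rule decrI, rule SUP_subset_mono) auto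

lemma majorant_upper: "r \<le> s \<Longrightarrow> s < 1 \<Longrightarrow> \<psi> s \<le> majorant \<psi> r"
  unfolding majorant_def by (rule SUP_upper) auto

lemma majorant_least: "(\<And>s. r \<le> s \<Longrightarrow> s < 1 \<Longrightarrow> \<psi> s \<le> K) \<Longrightarrow> majorant \<psi> r \<le> K"
  unfolding majorant_def by (rule SUP_least) auto

lemma Q_1_eq: "Q 1 F r = (\<integral>\<^sub>1s. F s * ennreal (1 / s) * indicator {r<..<1} s)"
  by (simp add: Q_def)

lemma ln_ratio_integral:
  assumes "0 < r" "r \<le> t" "t \<le> 1"
  shows "(\<integral>\<^sub>1s. ennreal (1 / s) * indicator {r<..<t} s) = ennreal (ln (t / r))"
  using log_kernel_integral[OF assms, of 1] by simp

text \<open>In the variable \<open>ln (1 / r)\<close> the function \<open>Q 1 F\<close> is convex and vanishes at \<open>0\<close>.\<close>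

lemma Q_1_log_quotient:
  assumes F: "decr F" and sr: "0 < s" "s \<le> r" "r < 1"
  shows "ennreal (ln (2 / s)) * Q 1 F r \<le> ennreal (ln (2 / r)) * Q 1 F s"
proof -
  have [measurable]: "F \<in> M_plus" by (rule decr_measurable[OF F])
  \<comment> \<open>In the logarithmic variable, \<open>F r\<close> is the slope of
    \<open>Q 1 F\<close> at \<open>r\<close>. It bounds the slope of the chord between 1 and
    \<open>r\<close> from above (\<open>up\<close>) and that of the chord between \<open>r\<close>
    and \<open>s\<close> from below (\<open>low\<close>).\<close>
  have up: "Q 1 F r \<le> F r * ennreal (ln (1 / r))"
  proof -
    have "Q 1 F r \<le> (\<integral>\<^sub>1\<sigma>. F r * (ennreal (1 / \<sigma>) * indicator {r<..<1} \<sigma>))"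
      unfolding Q_1_eq using sr
      by (intro unit_integral_mono) (auto split: split_indicator intro!: mult_right_mono decrD[OF F])
    also have "\<dots> = F r * (\<integral>\<^sub>1\<sigma>. ennreal (1 / \<sigma>) * indicator {r<..<1} \<sigma>)"
      by (rule nn_integral_cmult) measurable
    finally show ?thesis using sr by (simp add: ln_ratio_integral)
  qed
  have low: "Q 1 F r + F r * ennreal (ln (r / s)) \<le> Q 1 F s"
  proof -
    have "F r * ennreal (ln (r / s)) = (\<integral>\<^sub>1\<sigma>. F r * (ennreal (1 / \<sigma>) * indicator {s<..<r} \<sigma>))"
      using sr by (subst nn_integral_cmult) (auto simp: ln_ratio_integral)
    then have "Q 1 F r + F r * ennreal (ln (r / s))
        = (\<integral>\<^sub>1\<sigma>. F \<sigma> * ennreal (1 / \<sigma>) * indicator {r<..<1} \<sigma> + F r * (ennreal (1 / \<sigma>) * indicator {s<..<r} \<sigma>))"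
      unfolding Q_1_eq by (simp add: nn_integral_add)
    also have "\<dots> \<le> Q 1 F s" unfolding Q_1_eq
      using sr by (intro unit_integral_mono) (auto split: split_indicator intro!: mult_right_mono decrD[OF F])
    finally show ?thesis .
  qed
  have e: "ln (2 / s) = ln (2 / r) + ln (r / s)" using sr by (simp add: ln_div)
  have pos: "0 \<le> ln (2 / r)" "0 \<le> ln (r / s)" "0 \<le> ln (1 / r)" "ln (1 / r) \<le> ln (2 / r)"
    using sr by (auto simp: field_simps)
  have "ennreal (ln (2 / s)) * Q 1 F r = ennreal (ln (2 / r)) * Q 1 F r + ennreal (ln (r / s)) * Q 1 F r"
    unfolding e using pos by (simp add: distrib_right)
  also have "\<dots> \<le> ennreal (ln (2 / r)) * Q 1 F r + ennreal (ln (r / s)) * (F r * ennreal (ln (2 / r)))"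
    using pos by (intro add_left_mono mult_left_mono order_trans[OF up]) (auto intro: mult_left_mono ennreal_leI)
  also have "\<dots> = ennreal (ln (2 / r)) * (Q 1 F r + F r * ennreal (ln (r / s)))"
    by (simp add: distrib_left mult_ac)
  also have "\<dots> \<le> ennreal (ln (2 / r)) * Q 1 F s" by (rule mult_left_mono[OF low]) simp
  finally show ?thesis .
qed

lemma Q_1_le:
  assumes F: "decr F" and sr: "0 < s" "s \<le> r" "r < 1"
  shows "Q 1 F r \<le> ennreal (ln (2 / r) / ln (2 / s)) * Q 1 F s"
proof -
  have l: "0 < ln (2 / s)" using sr ln_2_div_pos[of s] by simp
  have "ennreal (1 / ln (2 / s)) * (ennreal (ln (2 / s)) * Q 1 F r) \<le> ennreal (1 / ln (2 / s)) * (ennreal (ln (2 / r)) * Q 1 F s)"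
    by (rule mult_left_mono[OF Q_1_log_quotient[OF assms]]) simp
  then show ?thesis using l by (simp add: mult.assoc[symmetric] flip: ennreal_mult')
qed

text \<open>From one scale to the next, \<open>ln (2 / s)\<close> doubles, so that the weight grows at most by a bounded factor.\<close>

definition scale :: "nat \<Rightarrow> real" where
  "scale l = 2 * (1 / 2) ^ (2 ^ l)"

lemma scale_bounds: "0 < scale l" "1 \<le> l \<Longrightarrow> scale l < 1"
proof -
  show "0 < scale l" by (simp add: scale_def)
  assume "1 \<le> l"
  then have "(2::nat) ^ 1 \<le> 2 ^ l" by (intro power_increasing) auto
  then have "(1 / 2 :: real) ^ (2 ^ l) \<le> (1 / 2) ^ 2" by (intro power_decreasing) auto
  then show "scale l < 1" by (simp add: scale_def power2_eq_square)
qed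

lemma ln_scale: "ln (2 / scale l) = 2 ^ l * ln 2"
  by (simp add: scale_def power_divide ln_realpow)

text \<open>The index of the block between consecutive scales that contains \<open>r\<close>:
  \<open>scale (level r + 1) < r \<le> scale (level r)\<close>. Level 0 starts at
  \<open>scale 0 = 1\<close>, which is not a point of the open interval. Points chosen by level
  depend measurably on \<open>r\<close>.\<close>

definition level :: "real \<Rightarrow> nat" where
  "level r = nat \<lfloor>log 2 (ln (2 / r) / ln 2)\<rfloor>"

lemma level_measurable [measurable]: "level \<in> measurable unit_int (count_space UNIV)"
  unfolding level_def by measurable

lemma level_bounds:
  assumes "0 < r" "r < 1"
  shows "2 ^ level r * ln 2 \<le> ln (2 / r)" "ln (2 / r) < 2 ^ (level r + 1) * ln 2"
proof -
  define x where "x = ln (2 / r) / ln 2"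
  have x: "1 \<le> x" using assms by (simp add: x_def field_simps)
  have l: "0 \<le> log 2 x" using x by simp
  have n: "real (level r) = of_int \<lfloor>log 2 x\<rfloor>" using l by (simp add: level_def x_def)
  have "real (level r) \<le> log 2 x" "log 2 x < real (level r + 1)" unfolding of_nat_add of_nat_1 n by linarith+
  then have "2 powr real (level r) \<le> x" "x < 2 powr real (level r + 1)"
    using x by (auto simp: le_log_iff log_less_iff)
  then have "2 ^ level r \<le> x" "x < 2 ^ (level r + 1)" by (simp_all only: powr_realpow zero_less_numeral)
  then show "2 ^ level r * ln 2 \<le> ln (2 / r)" "ln (2 / r) < 2 ^ (level r + 1) * ln 2"
    by (simp_all add: x_def field_simps)
qed

section \<open>Equivalent norms\<close>

text \<open>Demanded for all functions, measurable or not: \<open>X_norm\<close> sees its argument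
  only through the decreasing function \<open>rearr01 f\<close>, and in this form the relation
  applies directly to \<open>rearr M u\<close>.\<close>

definition equiv_norms :: "((real \<Rightarrow> ennreal) \<Rightarrow> ennreal) \<Rightarrow> ((real \<Rightarrow> ennreal) \<Rightarrow> ennreal) \<Rightarrow> bool" where
  "equiv_norms A B \<longleftrightarrow> (\<exists>c>0. \<forall>f. A f \<le> ennreal c * B f \<and> B f \<le> ennreal c * A f)"

lemma equiv_normsI:
  assumes "0 < c" "0 < d" "\<And>f. A f \<le> ennreal c * B f" "\<And>f. B f \<le> ennreal d * A f"
  shows "equiv_norms A B"
  unfolding equiv_norms_def
proof (intro exI[of _ "max c d"] conjI allI)
  fix f
  show "A f \<le> ennreal (max c d) * B f"
    by (rule order_trans[OF assms(3)]) (intro mult_right_mono ennreal_leI, auto)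
  show "B f \<le> ennreal (max c d) * A f"
    by (rule order_trans[OF assms(4)]) (intro mult_right_mono ennreal_leI, auto)
qed (use assms in auto)

lemma equiv_norms_sym: "equiv_norms A B \<Longrightarrow> equiv_norms B A"
  unfolding equiv_norms_def by blast

lemma equiv_norms_trans:
  assumes "equiv_norms A B" "equiv_norms B C"
  shows "equiv_norms A C"
proof -
  obtain c where c: "0 < c" "\<And>f. A f \<le> ennreal c * B f" "\<And>f. B f \<le> ennreal c * A f"
    using assms(1) unfolding equiv_norms_def by blast
  obtain d where d: "0 < d" "\<And>f. B f \<le> ennreal d * C f" "\<And>f. C f \<le> ennreal d * B f"
    using assms(2) unfolding equiv_norms_def by blast
  have cd: "ennreal c * (ennreal d * x) = ennreal (c * d) * x" for x
    using c(1) d(1) by (simp add: ennreal_mult mult.assoc)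
  show ?thesis
  proof (rule equiv_normsI[of "c * d" "c * d"])
    fix f
    show "A f \<le> ennreal (c * d) * C f"
      unfolding cd[symmetric] by (rule order_trans[OF c(2) mult_left_mono[OF d(2)]]) simp
    show "C f \<le> ennreal (c * d) * A f"
      unfolding mult.commute[of c] ennreal_mult[OF less_imp_le[OF d(1)] less_imp_le[OF c(1)]] mult.assoc
      by (rule order_trans[OF d(3) mult_left_mono[OF c(3)]]) simp
  qed (use c d in auto)
qed

lemma equiv_norms_same_space:
  assumes "equiv_norms A B"
  shows "same_space_equiv_norms M A B"
proof -
  obtain c where c: "0 < c" "\<And>f. A f \<le> ennreal c * B f" "\<And>f. B f \<le> ennreal c * A f"
    using assms unfolding equiv_norms_def by blast
  have iff: "A f < \<infinity> \<longleftrightarrow> B f < \<infinity>" for f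
    using c(2)[of f] c(3)[of f] by (auto simp: ennreal_mult_less_top intro: le_less_trans)
  have low: "ennreal (1 / c) * A f \<le> B f" for f
    using mult_left_mono[OF c(2), of "ennreal (1 / c)"] by (simp add: ennreal_cancel(1)[OF c(1)])
  show ?thesis
    unfolding same_space_equiv_norms_def
  proof (rule conjI, goal_cases)
    case 1
    show "ri_space M A = ri_space M B" using iff by (simp add: ri_space_def ri_space_norm_def)
  next
    case 2
    show ?case
      by (rule exI[of _ "1 / c"], rule exI[of _ c]) (use c low in \<open>auto simp: ri_space_norm_def\<close>)
  qed
qed

section \<open>The weight\<close>

definition weight :: "(real \<Rightarrow> real) \<Rightarrow> real \<Rightarrow> real" where
  "weight \<Phi> s = ln (2 / s) / inv_into {0..} \<Phi> (ln (2 / s))"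

context
  fixes \<Phi> :: "real \<Rightarrow> real"
  assumes adm: "admissible \<Phi>"
begin

abbreviation w :: "real \<Rightarrow> real" where "w \<equiv> weight \<Phi>"

abbreviation over :: "(real \<Rightarrow> ennreal) \<Rightarrow> real \<Rightarrow> ennreal" where
  "over f \<equiv> \<lambda>s. f s * ennreal (1 / w s)"

text \<open>Convexity and \<open>\<Phi> 0 = 0\<close> give
  \<open>\<Phi> t \<le> t * \<Phi> 1\<close> below 1 and the reverse above 1. Hence \<open>a\<close>
  and \<open>b\<close>, which are \<open>y / \<Phi> 1\<close> truncated at 1 from either side,
  enclose a solution, and \<open>a > 0\<close> stays where \<Phi> is differentiable.\<close>

lemma Phi_surj:
  assumes y: "0 < y"
  shows "\<exists>t>0. \<Phi> t = y"
proof -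
  have zero: "\<Phi> 0 = 0" and mono: "strict_mono_on {0..} \<Phi>" and conv: "convex_on {0..} \<Phi>"
    using adm by (auto simp: admissible_def)
  obtain \<Phi>' where D: "\<And>t. 0 < t \<Longrightarrow> (\<Phi> has_real_derivative \<Phi>' t) (at t)"
    using adm by (auto simp: admissible_def)
  have line: "\<Phi> (u * t) \<le> u * \<Phi> t" if "0 \<le> u" "u \<le> 1" "0 \<le> t" for u t
    using convex_onD[OF conv, of u 0 t] that zero by simp
  have pos: "0 < \<Phi> 1" using strict_mono_onD[OF mono, of 0 1] zero by simp
  define a where "a = min 1 (y / \<Phi> 1)"
  define b where "b = max 1 (y / \<Phi> 1)"
  have a: "0 < a" "a \<le> 1" using y pos by (auto simp: a_def)
  have b: "1 \<le> b" by (simp add: b_def)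
  have "\<Phi> a \<le> a * \<Phi> 1" using line[of a 1] a by simp
  also have "\<dots> \<le> y / \<Phi> 1 * \<Phi> 1" using pos by (intro mult_right_mono) (auto simp: a_def)
  finally have lo: "\<Phi> a \<le> y" using pos by simp
  have "\<Phi> 1 \<le> 1 / b * \<Phi> b" using line[of "1 / b" b] b by simp
  then have "b * \<Phi> 1 \<le> \<Phi> b" using b by (simp add: field_simps)
  moreover have "y / \<Phi> 1 * \<Phi> 1 \<le> b * \<Phi> 1" using pos by (intro mult_right_mono) (auto simp: b_def)
  ultimately have hi: "y \<le> \<Phi> b" using pos by simp
  have "continuous_on {a..b} \<Phi>"
    using a by (intro continuous_at_imp_continuous_on ballI DERIV_isCont[OF D]) auto
  then obtain t where "a \<le> t" "\<Phi> t = y" using IVT'[of \<Phi> a y b] lo hi a b by auto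
  then show ?thesis using a by (intro exI[of _ t]) auto
qed

lemma Phi_inv:
  assumes "0 < y"
  shows "0 < inv_into {0..} \<Phi> y" "\<Phi> (inv_into {0..} \<Phi> y) = y"
proof -
  obtain t where t: "0 < t" "\<Phi> t = y" using Phi_surj[OF assms] by blast
  have "inj_on \<Phi> {0..}" using adm by (auto simp: admissible_def intro: strict_mono_on_imp_inj_on)
  then have "inv_into {0..} \<Phi> y = t" using t by (intro inv_into_f_eq) auto
  then show "0 < inv_into {0..} \<Phi> y" "\<Phi> (inv_into {0..} \<Phi> y) = y" using t by auto
qed

lemma weight_pos: "0 < s \<Longrightarrow> s \<le> 1 \<Longrightarrow> 0 < w s"
  unfolding weight_def by (intro divide_pos_pos Phi_inv ln_2_div_pos)

text \<open>Convexity of \<open>\<Phi>\<close> makes the weight decreasing, and concavity of \<open>sqrt \<circ> \<Phi>\<close> bounds its growth.\<close>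

lemma weight_bounds:
  assumes "0 < s" "s \<le> r" "r \<le> 1"
  shows "w r \<le> w s" "w s \<le> w r * sqrt (ln (2 / s) / ln (2 / r))"
proof -
  have zero: "\<Phi> 0 = 0" and mono: "strict_mono_on {0..} \<Phi>" and conv: "convex_on {0..} \<Phi>"
    and conc: "concave_on {0..} (\<lambda>t. sqrt (\<Phi> t))"
    using adm by (auto simp: admissible_def)
  define y where "y = ln (2 / s)"
  define z where "z = ln (2 / r)"
  have z: "0 < z" "z \<le> y" using assms ln_2_div_pos[of r] ln_2_div_mono[of s r] by (auto simp: y_def z_def)
  then have y: "0 < y" by simp
  define t where "t = inv_into {0..} \<Phi> y"
  define u where "u = inv_into {0..} \<Phi> z"
  have t: "0 < t" "\<Phi> t = y" unfolding t_def by (rule Phi_inv[OF y])+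
  have u: "0 < u" "\<Phi> u = z" unfolding u_def by (rule Phi_inv[OF z(1)])+
  have "u \<le> t"
  proof (rule ccontr)
    assume "\<not> u \<le> t"
    then have "\<Phi> t < \<Phi> u" using strict_mono_onD[OF mono, of t u] t u by auto
    then show False using t u z by simp
  qed
  \<comment> \<open>\<open>u\<close> is a convex combination of 0 and \<open>t\<close>. Convexity of
    \<Phi> and concavity of its square root, applied to it, say \<open>z / y \<le> u / t\<close> and
    \<open>u / t \<le> sqrt (z / y)\<close>.\<close>
  then have q: "0 \<le> u / t" "u / t \<le> 1" using t u by auto
  have "z \<le> u / t * y" using convex_onD[OF conv q, of 0 t] t u zero by simp
  then show "w r \<le> w s"
    using t u unfolding weight_def y_def[symmetric] z_def[symmetric] t_def[symmetric] u_def[symmetric]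
    by (simp add: field_simps)
  have "u / t * sqrt y \<le> sqrt z" using concave_onD[OF conc q, of 0 t] t u zero by simp
  then have "u / t * sqrt y * sqrt y \<le> sqrt z * sqrt y" using y by (intro mult_right_mono) auto
  then have "u * y \<le> sqrt z * sqrt y * t" using t y by (simp add: field_simps)
  then have "y / t \<le> sqrt z * sqrt y / u" using t u by (simp add: field_simps)
  also have "\<dots> = (z / sqrt z) * sqrt y / u" using real_div_sqrt[of z] z by simp
  also have "\<dots> = z / u * sqrt (y / z)" by (simp add: real_sqrt_divide)
  finally show "w s \<le> w r * sqrt (ln (2 / s) / ln (2 / r))"
    unfolding weight_def y_def[symmetric] z_def[symmetric] t_def[symmetric] u_def[symmetric] .
qed

lemma decr_weight_power: "decr (\<lambda>s. ennreal (w s ^ m))"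
  by (rule decrI, rule ennreal_leI, rule power_mono) (auto intro: weight_bounds less_imp_le[OF weight_pos])

lemma decr_weight: "decr (\<lambda>s. ennreal (w s))"
  using decr_weight_power[of 1] by simp

lemma weight_measurable [measurable]: "w \<in> borel_measurable unit_int"
proof -
  have "(\<lambda>s. enn2real (ennreal (w s))) \<in> borel_measurable unit_int"
    using decr_measurable[OF decr_weight] by measurable
  then show ?thesis
    by (rule measurable_cong[THEN iffD1, rotated]) (simp add: space_unit_int less_imp_le[OF weight_pos])
qed

lemma weight_ge: "0 < s \<Longrightarrow> s < 1 \<Longrightarrow> w 1 \<le> w s"
  by (rule weight_bounds) auto

text \<open>The square root of the logarithm is relaxed to a linear bound. This suffices for
  finiteness, since \<open>S m\<close> controls the \<open>m\<close>-th power of the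
  logarithm.\<close>

lemma weight_le:
  assumes "0 < s" "s < 1"
  shows "w s \<le> 2 * w 1 * (1 + ln (1 / s))"
proof -
  define x where "x = ln (1 / s)"
  have x: "0 \<le> x" using assms by (simp add: x_def)
  have l: "ln (2 / s) = ln 2 + x" using assms by (simp add: x_def ln_div)
  have l2: "1 / 2 \<le> ln (2::real)" using ln2_ge_two_thirds by simp
  have "x * 1 \<le> x * (2 * ln 2)" using x l2 by (intro mult_left_mono) auto
  then have "ln (2 / s) / ln 2 \<le> (1 + x) * 2" unfolding l
    using x l2 by (simp add: field_simps)
  also have "\<dots> \<le> (2 * (1 + x))\<^sup>2" using x by (simp add: power2_eq_square algebra_simps)
  finally have "sqrt (ln (2 / s) / ln 2) \<le> 2 * (1 + x)" using x by (intro real_le_lsqrt) auto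
  then have "w 1 * sqrt (ln (2 / s) / ln (2 / 1)) \<le> w 1 * (2 * (1 + x))"
    using weight_pos[of 1] by (intro mult_left_mono) auto
  then have "w s \<le> w 1 * (2 * (1 + x))"
    using weight_bounds(2)[of s 1] assms by auto
  then show ?thesis unfolding x_def by (simp only: mult_ac)
qed

section \<open>The norms as suprema over decreasing functions\<close>

lemma X_norm_eq: "X_norm \<Phi> m Y f = tilde Y m (\<lambda>s. ennreal (w s ^ m) * rearr01 f s)"
  by (simp add: X_norm_def weight_def)

lemma decr_weighted: "decr (\<lambda>s. ennreal (w s ^ m) * rearr01 f s)"
  by (intro decr_mult decr_weight_power decr_rearr01)

lemma X_norm_upper:
  assumes Y: "weak_norm Y" "1 \<le> m" and g: "decr g" and c: "0 < c" "assoc Y (S m g) \<le> ennreal c"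
  shows "(\<integral>\<^sub>1s. ennreal (w s ^ m) * rearr01 f s * g s) \<le> ennreal c * X_norm \<Phi> m Y f"
proof -
  have [measurable]: "g \<in> M_plus" by (rule decr_measurable[OF g])
  note [measurable] = decr_measurable[OF decr_weighted[of m f]]
  define k where "k s = ennreal (1 / c) * g s" for s
  have k: "decr k" unfolding k_def by (intro decr_mult decr_const g)
  have "assoc Y (S m k) = assoc Y (\<lambda>s. ennreal (1 / c) * S m g s)"
    unfolding k_def by (rule assoc_cong) (simp add: S_cmult)
  also have "\<dots> = ennreal (1 / c) * assoc Y (S m g)"
    by (rule assoc_cmult[OF decr_measurable[OF decr_S[OF g]]])
  also have "\<dots> \<le> ennreal (1 / c) * ennreal c" by (rule mult_left_mono[OF c(2)]) simp
  also have "\<dots> = 1" using c by (simp flip: ennreal_mult)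
  finally have "(\<integral>\<^sub>1s. ennreal (w s ^ m) * rearr01 f s * k s) \<le> X_norm \<Phi> m Y f"
    unfolding X_norm_eq by (intro tilde_upper Y k) measurable
  then have "ennreal c * (\<integral>\<^sub>1s. ennreal (w s ^ m) * rearr01 f s * k s) \<le> ennreal c * X_norm \<Phi> m Y f"
    by (rule mult_left_mono) simp
  also have "ennreal c * (\<integral>\<^sub>1s. ennreal (w s ^ m) * rearr01 f s * k s)
      = (\<integral>\<^sub>1s. ennreal c * (ennreal (w s ^ m) * rearr01 f s * k s))"
    using decr_measurable[OF k] by (intro nn_integral_cmult[symmetric]) measurable
  also have "\<dots> = (\<integral>\<^sub>1s. ennreal (w s ^ m) * rearr01 f s * g s)"
  proof (rule unit_integral_cong)
    fix s :: real
    have "ennreal c * (ennreal (1 / c) * x) = x" for x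
      using c by (simp add: mult.assoc[symmetric] flip: ennreal_mult)
    then show "ennreal c * (ennreal (w s ^ m) * rearr01 f s * k s) = ennreal (w s ^ m) * rearr01 f s * g s"
      unfolding k_def by (metis mult.left_commute)
  qed
  finally show ?thesis .
qed

lemma X_norm_least:
  assumes Y: "weak_norm Y" "1 \<le> m"
    and bound: "\<And>g. decr g \<Longrightarrow> assoc Y (S m g) \<le> 1 \<Longrightarrow>
      (\<integral>\<^sub>1s. ennreal (w s ^ m) * rearr01 f s * g s) \<le> K"
  shows "X_norm \<Phi> m Y f \<le> K"
\<comment> \<open>The dual bound is available for positive real constants; approximation from above
  includes \<open>K = 0\<close>.\<close>
proof (rule dense_ge)
  fix y assume y: "K < y"
  show "X_norm \<Phi> m Y f \<le> y"
  proof (cases y)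
    case (real z)
    then have "0 < z" using y by (auto simp: order_less_le)
    then have "X_norm \<Phi> m Y f \<le> ennreal z" unfolding X_norm_eq
      using y real by (intro tilde_least Y decr_weighted) (auto intro: order_trans[OF bound])
    then show ?thesis using real by simp
  qed simp
qed

lemma X_norm_cong:
  assumes Y: "weak_norm Y" "1 \<le> m" and "\<And>s. 0 < s \<Longrightarrow> s < 1 \<Longrightarrow> rearr01 f s = rearr01 g s"
  shows "X_norm \<Phi> m Y f = X_norm \<Phi> m Y g"
  unfolding X_norm_eq
  by (rule antisym; rule ri_mono_AE[OF tilde_spec(1)[OF Y]])
    (use assms(3) decr_measurable[OF decr_weighted] in \<open>auto intro!: AE_I2 simp: space_unit_int\<close>)

lemma power_one_plus_le:
  assumes "0 \<le> (x::real)"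
  shows "(1 + x) ^ m \<le> 2 ^ m * (1 + x ^ m)"
proof (cases "x \<le> 1")
  case True
  then have "(1 + x) ^ m \<le> 2 ^ m" using assms by (intro power_mono) auto
  also have "\<dots> \<le> 2 ^ m * (1 + x ^ m)" using assms by simp
  finally show ?thesis .
next
  case False
  then have "(1 + x) ^ m \<le> (2 * x) ^ m" using assms by (intro power_mono) auto
  also have "\<dots> \<le> 2 ^ m * (1 + x ^ m)" using assms by (simp add: power_mult_distrib)
  finally show ?thesis .
qed

text \<open>\<open>w ^ m\<close> is at most a multiple of \<open>1 + ln (1 / s) ^ m\<close>, and the
  integral of \<open>ln (1 / s) ^ m\<close> against \<open>g\<close> is \<open>m\<close> times the
  integral of \<open>S m g\<close>. This makes constants have finite norm.\<close>

lemma weight_power_integral: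
  assumes Y: "weak_norm Y" "1 \<le> m"
  obtains C where "0 < C" "\<And>g. decr g \<Longrightarrow> assoc Y (S m g) \<le> 1 \<Longrightarrow> (\<integral>\<^sub>1s. ennreal (w s ^ m) * g s) \<le> ennreal C"
proof -
  obtain c where c: "0 < c" "\<And>g. decr g \<Longrightarrow> assoc Y (S m g) \<le> 1 \<Longrightarrow> (\<integral>\<^sub>1s. S m g s) \<le> ennreal c"
    using tilde_assoc_coercive[OF Y] by blast
  define A where "A = (2 * w 1) ^ m * 2 ^ m"
  have A: "0 < A" using weight_pos[of 1] by (simp add: A_def)
  have w: "w s ^ m \<le> A * (1 + ln (1 / s) ^ m)" if "0 < s" "s < 1" for s
  proof -
    have "0 \<le> ln (1 / s)" using that by simp
    have "w s ^ m \<le> (2 * w 1 * (1 + ln (1 / s))) ^ m"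
      using that weight_pos[of s] weight_le[of s] by (intro power_mono) auto
    also have "\<dots> = (2 * w 1) ^ m * (1 + ln (1 / s)) ^ m" by (rule power_mult_distrib)
    also have "\<dots> \<le> (2 * w 1) ^ m * (2 ^ m * (1 + ln (1 / s) ^ m))"
      using \<open>0 \<le> ln (1 / s)\<close> weight_pos[of 1] by (intro mult_left_mono power_one_plus_le) auto
    finally show ?thesis by (simp add: A_def mult.assoc)
  qed
  show thesis
  proof (rule that[of "A * (c + real m * c)"])
    show "0 < A * (c + real m * c)" using A c Y(2) by (intro mult_pos_pos add_pos_nonneg) auto
    fix g assume g: "decr g" "assoc Y (S m g) \<le> 1"
    have [measurable]: "g \<in> M_plus" by (rule decr_measurable[OF g(1)])
    have "(\<integral>\<^sub>1s. g s) \<le> (\<integral>\<^sub>1s. S m g s)" by (rule S_integral_ge[OF g(1) Y(2)])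
    also have "\<dots> \<le> ennreal c" by (rule c(2)[OF g])
    finally have 1: "(\<integral>\<^sub>1s. g s) \<le> ennreal c" .
    have "(\<integral>\<^sub>1s. ennreal (ln (1 / s) ^ m) * g s) = (\<integral>\<^sub>1s. ennreal (ln (1 / s) ^ m) * g s * indicator {..<1} s)"
      by (rule unit_integral_cong) auto
    also have "\<dots> = ennreal (real m) * (ennreal (1 / real m) * (\<integral>\<^sub>1s. ennreal (ln (1 / s) ^ m) * g s * indicator {..<1} s))"
      using Y(2) by (simp add: mult.assoc[symmetric] flip: ennreal_mult)
    also have "\<dots> = ennreal (real m) * (\<integral>\<^sub>1s. S m g s * indicator {..<1} s)"
      using Y(2) by (subst nn_integral_S_prefix) auto
    also have "(\<integral>\<^sub>1s. S m g s * indicator {..<1} s) = (\<integral>\<^sub>1s. S m g s)"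
      by (rule unit_integral_cong) auto
    also have "ennreal (real m) * (\<integral>\<^sub>1s. S m g s) \<le> ennreal (real m) * ennreal c"
      by (rule mult_left_mono[OF c(2)[OF g]]) simp
    finally have 2: "(\<integral>\<^sub>1s. ennreal (ln (1 / s) ^ m) * g s) \<le> ennreal (real m) * ennreal c" .
    have "(\<integral>\<^sub>1s. ennreal (w s ^ m) * g s)
        \<le> (\<integral>\<^sub>1s. ennreal A * (g s + ennreal (ln (1 / s) ^ m) * g s))"
    proof (rule unit_integral_mono)
      fix s :: real assume s: "0 < s" "s < 1"
      have l: "0 \<le> ln (1 / s) ^ m" using s by simp
      have "ennreal (w s ^ m) * g s \<le> ennreal (A * (1 + ln (1 / s) ^ m)) * g s"
        by (intro mult_right_mono ennreal_leI w s) simp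
      also have "\<dots> = ennreal A * (g s + ennreal (ln (1 / s) ^ m) * g s)"
      proof -
        have "ennreal (1 + ln (1 / s) ^ m) = 1 + ennreal (ln (1 / s) ^ m)" using l by simp
        then show ?thesis using A l by (simp add: ennreal_mult distrib_right mult.assoc)
      qed
      finally show "ennreal (w s ^ m) * g s \<le> ennreal A * (g s + ennreal (ln (1 / s) ^ m) * g s)" .
    qed
    also have "\<dots> = ennreal A * ((\<integral>\<^sub>1s. g s) + (\<integral>\<^sub>1s. ennreal (ln (1 / s) ^ m) * g s))"
      by (subst nn_integral_cmult, measurable, subst nn_integral_add, measurable)
    also have "\<dots> \<le> ennreal A * (ennreal c + ennreal (real m) * ennreal c)"
      by (intro mult_left_mono add_mono 1 2) simp
    also have "\<dots> = ennreal (A * (c + real m * c))"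
      using A c by (simp add: ennreal_mult ennreal_plus)
    finally show "(\<integral>\<^sub>1s. ennreal (w s ^ m) * g s) \<le> ennreal (A * (c + real m * c))" .
  qed
qed

text \<open>What permits iteration. A small constant is in the unit ball by
  \<open>weight_power_integral\<close>; integrals are bounded by testing with a constant
  \<open>g\<close>, because \<open>w\<close> is bounded below by \<open>w 1\<close>.\<close>

lemma X_norm_weak_norm:
  assumes Y: "weak_norm Y" "1 \<le> m"
  shows "weak_norm (X_norm \<Phi> m Y)"
  unfolding weak_norm_def
proof (intro conjI ballI allI impI)
  obtain C where C: "0 < C" "\<And>g. decr g \<Longrightarrow> assoc Y (S m g) \<le> 1 \<Longrightarrow> (\<integral>\<^sub>1s. ennreal (w s ^ m) * g s) \<le> ennreal C"
    using weight_power_integral[OF Y] by blast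
  have "X_norm \<Phi> m Y (\<lambda>_. ennreal (1 / C)) \<le> 1"
  proof (rule X_norm_least[OF Y])
    fix g assume g: "decr g" "assoc Y (S m g) \<le> 1"
    have [measurable]: "g \<in> M_plus" by (rule decr_measurable[OF g(1)])
    note [measurable] = decr_measurable[OF decr_weight_power[of m]]
    have "(\<integral>\<^sub>1s. ennreal (w s ^ m) * rearr01 (\<lambda>_. ennreal (1 / C)) s * g s)
        = (\<integral>\<^sub>1s. ennreal (1 / C) * (ennreal (w s ^ m) * g s))"
      using nn_integral_rearr01_decr[OF decr_const, of "\<lambda>s. ennreal (w s ^ m) * g s" "ennreal (1 / C)"]
      by (simp add: mult_ac)
    also have "\<dots> = ennreal (1 / C) * (\<integral>\<^sub>1s. ennreal (w s ^ m) * g s)"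
      by (rule nn_integral_cmult) measurable
    also have "\<dots> \<le> ennreal (1 / C) * ennreal C" by (intro mult_left_mono C g) simp
    also have "\<dots> = 1" using C(1) by (simp flip: ennreal_mult)
    finally show "(\<integral>\<^sub>1s. ennreal (w s ^ m) * rearr01 (\<lambda>_. ennreal (1 / C)) s * g s) \<le> 1" .
  qed
  then show "\<exists>c>0. X_norm \<Phi> m Y (\<lambda>_. ennreal c) \<le> 1" using C(1) by (intro exI[of _ "1 / C"]) auto
  obtain \<delta> where \<delta>: "0 < \<delta>" "tilde_assoc Y m (\<lambda>_. ennreal \<delta>) \<le> 1" using tilde_assoc_const[OF Y] by blast
  define a where "a = w 1 ^ m * \<delta>"
  have a: "0 < a" using weight_pos[of 1] \<delta>(1) by (simp add: a_def)
  show "\<exists>C\<ge>0. \<forall>F\<in>M_plus. X_norm \<Phi> m Y F \<le> 1 \<longrightarrow> (\<integral>\<^sub>1x. F x) \<le> ennreal C"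
  proof (intro exI[of _ "1 / a"] conjI ballI impI)
    fix F assume F [measurable]: "F \<in> M_plus" and XF: "X_norm \<Phi> m Y F \<le> 1"
    have "ennreal a * (\<integral>\<^sub>1x. F x) = (\<integral>\<^sub>1x. ennreal a * rearr01 F x)"
      by (subst nn_integral_cmult) (auto simp: nn_integral_rearr01)
    also have "\<dots> \<le> (\<integral>\<^sub>1s. ennreal (w s ^ m) * rearr01 F s * ennreal \<delta>)"
    proof (rule unit_integral_mono)
      fix s :: real assume s: "0 < s" "s < 1"
      have "a \<le> w s ^ m * \<delta>" unfolding a_def
        using s \<delta>(1) weight_pos[of 1] weight_ge[of s] by (intro mult_right_mono power_mono) auto
      then have "ennreal a * rearr01 F s \<le> ennreal (w s ^ m * \<delta>) * rearr01 F s"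
        by (intro mult_right_mono ennreal_leI) auto
      also have "\<dots> = ennreal (w s ^ m) * rearr01 F s * ennreal \<delta>"
        using s \<delta>(1) weight_pos[of s] by (simp add: ennreal_mult mult_ac)
      finally show "ennreal a * rearr01 F s \<le> ennreal (w s ^ m) * rearr01 F s * ennreal \<delta>" .
    qed
    also have "\<dots> \<le> ennreal 1 * X_norm \<Phi> m Y F"
      using \<delta> by (intro X_norm_upper Y decr_const) (simp_all add: tilde_assoc_decr[OF decr_const])
    also have "\<dots> \<le> 1" using XF by simp
    finally show "(\<integral>\<^sub>1x. F x) \<le> ennreal (1 / a)" by (rule ennreal_le_inverse[OF a])
  qed (use a in simp)
  show "X_norm \<Phi> m Y (rearr01 F) = X_norm \<Phi> m Y F" if "F \<in> M_plus" for F
    using that by (intro X_norm_cong Y rearr01_rearr01) auto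
  show "X_norm \<Phi> m Y (\<lambda>x. ennreal c * F x) = ennreal c * X_norm \<Phi> m Y F" if F: "F \<in> M_plus" and c: "0 < c" for F c
  proof -
    note [measurable] = decr_measurable[OF decr_weighted[of m F]] decr_measurable[OF decr_weighted[of m "\<lambda>x. ennreal c * F x"]]
    have "X_norm \<Phi> m Y (\<lambda>x. ennreal c * F x) = tilde Y m (\<lambda>s. ennreal c * (ennreal (w s ^ m) * rearr01 F s))"
      unfolding X_norm_eq
      by (rule antisym; rule ri_mono_AE[OF tilde_spec(1)[OF Y]])
        (use c in \<open>auto intro!: AE_I2 simp: space_unit_int rearr01_cmult[OF F] mult_ac\<close>)
    also have "\<dots> = ennreal c * X_norm \<Phi> m Y F"
      unfolding X_norm_eq using c by (intro ri_scale[OF tilde_spec(1)[OF Y]]) auto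
    finally show ?thesis .
  qed
qed

section \<open>One step of the iteration: lower bound\<close>

text \<open>The logarithmic kernel is bounded by its value at \<open>s = t\<close>, and
  \<open>w r / w s\<close> by \<open>sqrt (ln (2 / r) / ln (2 / s))\<close>. What remains to
  integrate, \<open>1 / (s * sqrt (ln (2 / s)))\<close>, has the antiderivative
  \<open>- 2 * sqrt (ln (2 / s))\<close>.\<close>

lemma weight_kernel_integral:
  assumes r: "0 < r" "r < t" "t \<le> 1" and h: "1 \<le> h"
  shows "ennreal (w r) * (\<integral>\<^sub>1s. ennreal (1 / w s) * ennreal (1 / s) * ennreal (ln (s / r) ^ (h - 1)) * indicator {r<..<t} s)
    \<le> ennreal (2 * ln (t / r) ^ h)"
proof -
  define b where "b = ln (2 / r)"
  define L where "L = ln (t / r) ^ (h - 1)"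
  have b: "0 < b" using r ln_2_div_pos[of r] by (simp add: b_def)
  have L: "0 \<le> L" using r by (simp add: L_def)
  have "ennreal (w r) * (\<integral>\<^sub>1s. ennreal (1 / w s) * ennreal (1 / s) * ennreal (ln (s / r) ^ (h - 1)) * indicator {r<..<t} s)
      = (\<integral>\<^sub>1s. ennreal (w r) * (ennreal (1 / w s) * ennreal (1 / s) * ennreal (ln (s / r) ^ (h - 1)) * indicator {r<..<t} s))"
    by (rule nn_integral_cmult[symmetric]) measurable
  also have "\<dots> \<le> (\<integral>\<^sub>1s. ennreal L * (ennreal (sqrt b / sqrt (ln (2 / s)) / s) * indicator {r<..<t} s))"
  proof (rule unit_integral_mono)
    fix s :: real assume s: "0 < s" "s < 1"
    show "ennreal (w r) * (ennreal (1 / w s) * ennreal (1 / s) * ennreal (ln (s / r) ^ (h - 1)) * indicator {r<..<t} s)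
      \<le> ennreal L * (ennreal (sqrt b / sqrt (ln (2 / s)) / s) * indicator {r<..<t} s)"
    proof (cases "r < s \<and> s < t")
      case True
      have ws: "0 < w s" "0 < w r" using s r by (auto intro: weight_pos)
      have "w r / w s \<le> sqrt b / sqrt (ln (2 / s))"
        using weight_bounds(2)[of r s] True r s ws(1) by (simp add: b_def real_sqrt_divide field_simps)
      moreover have "ln (s / r) ^ (h - 1) \<le> L"
        unfolding L_def using True r by (intro power_mono) (auto simp: field_simps)
      ultimately have "ln (s / r) ^ (h - 1) * (w r / w s / s) \<le> L * (sqrt b / sqrt (ln (2 / s)) / s)"
        using L s r True ws by (intro mult_mono divide_right_mono) auto
      then have "w r * (1 / w s * (1 / s) * ln (s / r) ^ (h - 1)) \<le> L * (sqrt b / sqrt (ln (2 / s)) / s)"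
        by (simp add: field_simps)
      moreover have "0 \<le> ln (s / r)" using True r by simp
      moreover have "0 \<le> ln (2 / s)" using s by simp
      ultimately show ?thesis using True r s ws L b by (simp add: ennreal_leI flip: ennreal_mult)
    qed auto
  qed
  also have "\<dots> = ennreal L * (\<integral>\<^sub>1s. ennreal (sqrt b / sqrt (ln (2 / s)) / s) * indicator {r<..<t} s)"
    by (rule nn_integral_cmult) measurable
  also have "(\<integral>\<^sub>1s. ennreal (sqrt b / sqrt (ln (2 / s)) / s) * indicator {r<..<t} s)
      = ennreal (- 2 * sqrt b * sqrt (ln (2 / t)) - (- 2 * sqrt b * sqrt (ln (2 / r))))"
  proof (rule unit_int_FTC)
    fix x assume x: "r \<le> x" "x \<le> t"
    then have l: "0 < ln (2 / x)" using r by (intro ln_2_div_pos) auto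
    show "0 \<le> sqrt b / sqrt (ln (2 / x)) / x" using l x r b by auto
    have "((\<lambda>x. ln (2 / x)) has_real_derivative - (1 / x)) (at x)"
      using x r by (auto intro!: derivative_eq_intros simp: power2_eq_square)
    then have "((\<lambda>x. sqrt (ln (2 / x))) has_real_derivative (inverse (sqrt (ln (2 / x))) / 2) * - (1 / x)) (at x)"
      by (intro DERIV_chain'[OF _ DERIV_real_sqrt] l)
    then have "((\<lambda>x. (- 2 * sqrt b) * sqrt (ln (2 / x))) has_real_derivative (- 2 * sqrt b) * ((inverse (sqrt (ln (2 / x))) / 2) * - (1 / x))) (at x)"
      by (rule DERIV_cmult)
    then show "((\<lambda>x. - 2 * sqrt b * sqrt (ln (2 / x))) has_real_derivative sqrt b / sqrt (ln (2 / x)) / x) (at x)"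
      by (simp add: field_simps)
  qed (use r in \<open>auto simp: b_def\<close>)
  also have "ennreal L * \<dots> \<le> ennreal (2 * ln (t / r) ^ h)"
  proof -
    define c where "c = ln (2 / t)"
    have c: "0 \<le> c" "c \<le> b" using r ln_2_div_pos[of t] ln_2_div_mono[of r t] by (auto simp: c_def b_def)
    \<comment> \<open>The difference of square roots, multiplied by \<open>sqrt b\<close>, is at
      most \<open>b - c = ln (t / r)\<close>: this supplies the missing power of the
      logarithm.\<close>
    have "sqrt c * sqrt c \<le> sqrt b * sqrt c" using c by (intro mult_right_mono) auto
    then have "- 2 * sqrt b * sqrt c - (- 2 * sqrt b * sqrt b) \<le> 2 * (b - c)" using b c by (simp add: mult.assoc)
    also have "b - c = ln (t / r)" using r by (simp add: b_def c_def ln_div)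
    finally have "L * (- 2 * sqrt b * sqrt c - (- 2 * sqrt b * sqrt b)) \<le> L * (2 * ln (t / r))"
      using L by (intro mult_left_mono) auto
    also have "L * (2 * ln (t / r)) = 2 * ln (t / r) ^ h"
      using h by (cases h) (auto simp: L_def)
    finally show ?thesis using L by (simp add: ennreal_leI c_def b_def flip: ennreal_mult')
  qed
  finally show ?thesis .
qed

text \<open>\<open>G = w g\<close> is admissible in the iterated norm up to the factor 2, and
  \<open>w ^ h * G = w ^ (1 + h) * g\<close>. To bound the associate norm of \<open>S h G\<close>,
  an element \<open>F\<close> of the ball is paired through the decreasing function
  \<open>w * rearr01 F\<close>, so comparing \<open>S h G / w\<close> with
  \<open>2 * h * S h g\<close> over initial intervals is enough. The \<open>h\<close> cancels
  against the \<open>1 / h\<close> in \<open>S_1_S\<close>.\<close>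

lemma X_norm_iterate_lower:
  assumes Y: "weak_norm Y" and h: "1 \<le> h"
  shows "X_norm \<Phi> (1 + h) Y f \<le> ennreal 2 * X_norm \<Phi> h (X_norm \<Phi> 1 Y) f"
proof (rule X_norm_least[OF Y])
  fix g assume g: "decr g" and Yg: "assoc Y (S (1 + h) g) \<le> 1"
  have g_meas [measurable]: "g \<in> M_plus" by (rule decr_measurable[OF g])
  define G where "G s = ennreal (w s) * g s" for s
  have G: "decr G" unfolding G_def by (intro decr_mult decr_weight g)
  have G_meas [measurable]: "G \<in> M_plus" by (rule decr_measurable[OF G])
  have SG [measurable]: "S h G \<in> M_plus" by (rule decr_measurable[OF decr_S[OF G]])
  have Sg [measurable]: "S h g \<in> M_plus" by (rule decr_measurable[OF decr_S[OF g]])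
  have S1: "assoc Y (S 1 (S h g)) \<le> ennreal (1 / real h)"
  proof -
    have "assoc Y (S 1 (S h g)) = assoc Y (\<lambda>s. ennreal (1 / real h) * S (1 + h) g s)"
      using S_1_S[OF g_meas] h by (intro assoc_cong) (simp add: add.commute)
    also have "\<dots> = ennreal (1 / real h) * assoc Y (S (1 + h) g)"
      by (rule assoc_cmult[OF decr_measurable[OF decr_S[OF g]]])
    also have "\<dots> \<le> ennreal (1 / real h) * 1" by (rule mult_left_mono[OF Yg]) simp
    finally show ?thesis by simp
  qed
  have "assoc (X_norm \<Phi> 1 Y) (S h G) \<le> ennreal 2"
  proof (rule assoc_least)
    fix F assume F [measurable]: "F \<in> M_plus" and XF: "X_norm \<Phi> 1 Y F \<le> 1"
    have "(\<integral>\<^sub>1s. F s * S h G s) \<le> (\<integral>\<^sub>1s. rearr01 F s * rearr01 (S h G) s)"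
      by (rule hardy_littlewood) measurable
    also have "\<dots> = (\<integral>\<^sub>1s. rearr01 F s * S h G s)"
      using nn_integral_rearr01_decr[OF decr_S[OF G], of "rearr01 F"] by (simp add: mult.commute)
    also have "\<dots> = (\<integral>\<^sub>1s. (ennreal (w s) * rearr01 F s) * (ennreal (1 / w s) * S h G s))"
    proof (rule unit_integral_cong)
      fix s :: real assume s: "0 < s" "s < 1"
      have "ennreal (w s) * ennreal (1 / w s) = 1"
        using weight_pos[of s] s by (simp flip: ennreal_mult)
      then show "rearr01 F s * S h G s = (ennreal (w s) * rearr01 F s) * (ennreal (1 / w s) * S h G s)"
        by (metis (no_types, lifting) mult.assoc mult.commute mult_1)
    qed
    also have "\<dots> \<le> (\<integral>\<^sub>1s. (ennreal (w s) * rearr01 F s) * (ennreal (2 * real h) * S h g s))"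
    proof (rule hardy)
      show "decr (\<lambda>s. ennreal (w s) * rearr01 F s)" by (intro decr_mult decr_weight decr_rearr01)
      fix t :: real assume t: "0 < t" "t \<le> 1"
      have "(\<integral>\<^sub>1s. ennreal (1 / w s) * S h G s * indicator {..<t} s)
          = (\<integral>\<^sub>1r. G r * (\<integral>\<^sub>1s. ennreal (1 / w s) * ennreal (1 / s) * ennreal (ln (s / r) ^ (h - 1)) * indicator {r<..<t} s))"
        by (rule nn_integral_S) measurable
      also have "\<dots> \<le> (\<integral>\<^sub>1r. ennreal 2 * (ennreal (ln (t / r) ^ h) * g r * indicator {..<t} r))"
      proof (rule unit_integral_mono)
        fix r :: real assume r: "0 < r" "r < 1"
        show "G r * (\<integral>\<^sub>1s. ennreal (1 / w s) * ennreal (1 / s) * ennreal (ln (s / r) ^ (h - 1)) * indicator {r<..<t} s)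
            \<le> ennreal 2 * (ennreal (ln (t / r) ^ h) * g r * indicator {..<t} r)"
        proof (cases "r < t")
          case True
          have "g r * (ennreal (w r) * (\<integral>\<^sub>1s. ennreal (1 / w s) * ennreal (1 / s) * ennreal (ln (s / r) ^ (h - 1)) * indicator {r<..<t} s))
              \<le> g r * ennreal (2 * ln (t / r) ^ h)"
            by (rule mult_left_mono[OF weight_kernel_integral]) (use r True t h in auto)
          then show ?thesis using True r by (simp add: G_def mult_ac ennreal_mult')
        next
          case False
          then have "{r<..<t} = {}" by auto
          then show ?thesis by simp
        qed
      qed
      also have "\<dots> = ennreal 2 * (\<integral>\<^sub>1r. ennreal (ln (t / r) ^ h) * g r * indicator {..<t} r)"
        by (rule nn_integral_cmult) measurable
      also have "\<dots> = ennreal (2 * real h) * (ennreal (1 / real h) * (\<integral>\<^sub>1r. ennreal (ln (t / r) ^ h) * g r * indicator {..<t} r))"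
        using h by (simp add: mult.assoc[symmetric] flip: ennreal_mult)
      also have "\<dots> = ennreal (2 * real h) * (\<integral>\<^sub>1s. S h g s * indicator {..<t} s)"
        using t h by (subst nn_integral_S_prefix) auto
      also have "\<dots> = (\<integral>\<^sub>1s. ennreal (2 * real h) * S h g s * indicator {..<t} s)"
        by (subst nn_integral_cmult[symmetric]) (auto simp: mult.assoc)
      finally show "(\<integral>\<^sub>1s. ennreal (1 / w s) * S h G s * indicator {..<t} s)
          \<le> (\<integral>\<^sub>1s. ennreal (2 * real h) * S h g s * indicator {..<t} s)" .
    qed measurable
    also have "\<dots> = ennreal (2 * real h) * (\<integral>\<^sub>1s. ennreal (w s ^ 1) * rearr01 F s * S h g s)"
      by (subst nn_integral_cmult[symmetric]) (auto simp: mult_ac)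
    also have "\<dots> \<le> ennreal (2 * real h) * (ennreal (1 / real h) * X_norm \<Phi> 1 Y F)"
      using h S1 by (intro mult_left_mono X_norm_upper Y decr_S g) auto
    also have "\<dots> \<le> ennreal (2 * real h) * (ennreal (1 / real h) * 1)" by (intro mult_left_mono XF) auto
    also have "\<dots> = ennreal 2" using h by (simp flip: ennreal_mult)
    finally show "(\<integral>\<^sub>1s. F s * S h G s) \<le> ennreal 2" .
  qed
  then have "(\<integral>\<^sub>1s. ennreal (w s ^ h) * rearr01 f s * G s) \<le> ennreal 2 * X_norm \<Phi> h (X_norm \<Phi> 1 Y) f"
    using h by (intro X_norm_upper X_norm_weak_norm Y G) auto
  also have "(\<integral>\<^sub>1s. ennreal (w s ^ h) * rearr01 f s * G s)
      = (\<integral>\<^sub>1s. ennreal (w s ^ (1 + h)) * rearr01 f s * g s)"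
    by (rule unit_integral_cong) (simp add: G_def ennreal_mult less_imp_le[OF weight_pos] mult_ac)
  finally show "(\<integral>\<^sub>1s. ennreal (w s ^ (1 + h)) * rearr01 f s * g s)
      \<le> ennreal 2 * X_norm \<Phi> h (X_norm \<Phi> 1 Y) f" .
qed simp

section \<open>One step of the iteration: upper bound\<close>

text \<open>For \<open>r < t\<close>, the supremum over \<open>[r, t]\<close> is at most
  \<open>G r / w t\<close>, as \<open>G\<close> and \<open>w\<close> decrease, and the one over
  \<open>[t, 1)\<close> is a constant \<open>K\<close>. Applying \<open>S h\<close> at
  \<open>t\<close> turns the first into \<open>S h G t / w t\<close> and multiplies the second by
  \<open>fact (h - 1)\<close>, which \<open>S_ge\<close> absorbs. Each is at most one copy of the
  majorant.\<close>

lemma S_majorant: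
  assumes G: "decr G" and t: "0 < t" "t < 1" and h: "1 \<le> h"
  shows "S h (majorant (over G)) t \<le> 2 * majorant (over (S h G)) t"
proof -
  have [measurable]: "G \<in> M_plus" by (rule decr_measurable[OF G])
  define K where "K = majorant (over G) t"
  have "S h (majorant (over G)) t \<le> S h (\<lambda>r. ennreal (1 / w t) * G r + K) t"
  proof (rule S_mono)
    fix r assume r: "0 < r" "r < t"
    show "majorant (over G) r \<le> ennreal (1 / w t) * G r + K"
    proof (rule majorant_least)
      fix s assume s: "r \<le> s" "s < 1"
      show "G s * ennreal (1 / w s) \<le> ennreal (1 / w t) * G r + K"
      proof (cases "s \<le> t")
        case True
        have "G s * ennreal (1 / w s) \<le> G r * ennreal (1 / w t)"
          using True s r t weight_pos[of t] weight_pos[of s] weight_bounds(1)[of s t]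
          by (intro mult_mono decrD[OF G] ennreal_leI divide_left_mono) auto
        then show ?thesis by (simp add: mult.commute add_increasing2)
      next
        case False
        then have "G s * ennreal (1 / w s) \<le> K" unfolding K_def using s by (intro majorant_upper) auto
        then show ?thesis by (simp add: add_increasing)
      qed
    qed
  qed (use t in auto)
  also have "\<dots> = ennreal (1 / w t) * S h G t + K * ennreal (fact (h - 1))"
    using t h by (subst S_add) (auto simp: S_cmult S_const)
  also have "\<dots> \<le> majorant (over (S h G)) t + majorant (over (S h G)) t"
  proof (rule add_mono)
    show "ennreal (1 / w t) * S h G t \<le> majorant (over (S h G)) t"
      using majorant_upper[of t t "\<lambda>s. S h G s * ennreal (1 / w s)"] t by (simp add: mult.commute)
    have "K * ennreal (fact (h - 1)) = (SUP s\<in>{t..<1}. G s * ennreal (1 / w s) * ennreal (fact (h - 1)))"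
      unfolding K_def majorant_def by (rule SUP_mult_right_ennreal)
    also have "\<dots> \<le> majorant (over (S h G)) t"
    proof (rule SUP_least)
      fix s assume s: "s \<in> {t..<1}"
      have "G s * ennreal (1 / w s) * ennreal (fact (h - 1)) = (G s * ennreal (fact (h - 1))) * ennreal (1 / w s)"
        by (simp add: mult_ac)
      also have "\<dots> \<le> S h G s * ennreal (1 / w s)"
        using s t h by (intro mult_right_mono S_ge G) auto
      also have "\<dots> \<le> majorant (over (S h G)) t"
        using s by (intro majorant_upper) auto
      finally show "G s * ennreal (1 / w s) * ennreal (fact (h - 1)) \<le> majorant (over (S h G)) t" .
    qed
    finally show "K * ennreal (fact (h - 1)) \<le> majorant (over (S h G)) t" .
  qed
  finally show ?thesis by (simp add: mult_2)
qed

text \<open>The weight varies at most by the square root of the quotient of the logarithms, so a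
  quotient of 4 costs a factor 2.\<close>

lemma decr_over_weight_compare:
  assumes \<phi>: "decr \<phi>" and sr: "0 < r" "r \<le> s" "s < 1" and ratio: "ln (2 / r) \<le> 4 * ln (2 / s)"
  shows "\<phi> s * ennreal (1 / w s) \<le> 2 * (\<phi> r * ennreal (1 / w r))"
proof -
  have l: "0 < ln (2 / s)" using sr ln_2_div_pos[of s] by simp
  have "sqrt (ln (2 / r) / ln (2 / s)) \<le> 2" using ratio l by (intro real_le_lsqrt) (auto simp: field_simps)
  then have "w s * sqrt (ln (2 / r) / ln (2 / s)) \<le> w s * 2"
    using weight_pos[of s] sr by (intro mult_left_mono) auto
  then have "w r \<le> w s * 2" using weight_bounds(2)[of r s] sr by simp
  then have "1 / w s \<le> 2 * (1 / w r)" using weight_pos[of s] weight_pos[of r] sr by (simp add: field_simps)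
  then have "\<phi> s * ennreal (1 / w s) \<le> \<phi> r * ennreal (2 * (1 / w r))"
    using sr by (intro mult_mono ennreal_leI decrD[OF \<phi>]) auto
  also have "\<dots> = 2 * (\<phi> r * ennreal (1 / w r))"
    using weight_pos[of r] sr by (subst ennreal_mult) (auto simp: mult_ac)
  finally show ?thesis .
qed

text \<open>Up to a factor, the supremum defining the majorant is attained either at the left end point or
  at one of finitely many scales, all of them much larger than this end point.\<close>

lemma majorant_selection:
  assumes \<phi>: "decr \<phi>"
  obtains \<gamma> :: "nat \<Rightarrow> real" where
    "\<And>j. 0 < \<gamma> j" "\<And>j. \<gamma> j < 1"
    "\<And>r. 0 < r \<Longrightarrow> r < 1 \<Longrightarrow> 1 / \<gamma> (level r) \<le> 2 / sqrt r"
    "\<And>r. 0 < r \<Longrightarrow> r < 1 \<Longrightarrow> majorant (over \<phi>) r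
       \<le> 2 * (\<phi> r * ennreal (1 / w r)) + 2 * (\<phi> (\<gamma> (level r)) * ennreal (1 / w (\<gamma> (level r))))"
proof -
  define \<psi> where "\<psi> s = \<phi> s * ennreal (1 / w s)" for s
  \<comment> \<open>\<open>L j\<close> is to maximize \<psi> among the scales with index from 1 to
    \<open>j - 1\<close>, with default 1 if there are none. The choice depends on \<open>r\<close>
    only through its level.\<close>
  have "\<exists>l\<ge>1. (l = 1 \<or> l < j) \<and> (\<forall>l'. 1 \<le> l' \<longrightarrow> l' < j \<longrightarrow> \<psi> (scale l') \<le> \<psi> (scale l))" for j
  proof (cases "2 \<le> j")
    case True
    then have ne: "(\<lambda>l. \<psi> (scale l)) ` {1..<j} \<noteq> {}" by auto
    then have "Max ((\<lambda>l. \<psi> (scale l)) ` {1..<j}) \<in> (\<lambda>l. \<psi> (scale l)) ` {1..<j}" by (intro Max_in) auto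
    then obtain l where l: "l \<in> {1..<j}" "Max ((\<lambda>l. \<psi> (scale l)) ` {1..<j}) = \<psi> (scale l)" by blast
    have "\<psi> (scale l') \<le> \<psi> (scale l)" if "1 \<le> l'" "l' < j" for l'
      unfolding l(2)[symmetric] using that by (intro Max_ge) auto
    then show ?thesis using l(1) by (intro exI[of _ l]) auto
  qed auto
  then obtain L where L1: "\<And>j. 1 \<le> L j" and Lj: "\<And>j. L j = 1 \<or> L j < j"
    and Lmax: "\<And>j l. 1 \<le> l \<Longrightarrow> l < j \<Longrightarrow> \<psi> (scale l) \<le> \<psi> (scale (L j))"
    by metis
  show thesis
  proof (rule that[of "\<lambda>j. scale (L j)"])
    show "0 < scale (L j)" "scale (L j) < 1" for j using scale_bounds L1 by auto
    fix r :: real assume r: "0 < r" "r < 1"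
    define j where "j = level r"
    note jr = level_bounds[OF r, folded j_def]
    \<comment> \<open>An index below \<open>level r\<close> at least halves the logarithm, so the
      selected scale is at least \<open>sqrt r\<close>. The factor 2 accommodates the default
      \<open>scale 1 = 1 / 2\<close>.\<close>
    show "1 / scale (L (level r)) \<le> 2 / sqrt r"
    proof -
      consider "L j = 1" | "L j < j" using Lj by blast
      then show ?thesis
      proof cases
        case 1
        have "sqrt r \<le> 1" using r by simp
        then show ?thesis using r unfolding j_def[symmetric] 1 by (simp add: scale_def power2_eq_square field_simps)
      next
        case 2
        then have "(2::real) ^ (L j + 1) \<le> 2 ^ j" by (intro power_increasing) auto
        then have "2 ^ (L j + 1) * ln 2 \<le> 2 ^ j * ln (2::real)" by (intro mult_right_mono) auto
        also have "\<dots> \<le> ln (2 / r)" by (rule jr(1))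
        finally have "2 * ln (2 / scale (L j)) \<le> ln (2 / r)" by (simp only: ln_scale power_add power_one_right mult_ac)
        also have "\<dots> \<le> ln (4 / r)" using r by (subst ln_le_cancel_iff) (auto simp: field_simps)
        also have "\<dots> = 2 * ln (2 / sqrt r)" using r by (simp add: ln_div ln_sqrt flip: ln_realpow) (simp add: ln_realpow[of 2 2, simplified])
        finally have "ln (2 / scale (L j)) \<le> ln (2 / sqrt r)" by simp
        then have "2 / scale (L j) \<le> 2 / sqrt r" using r scale_bounds(1)[of "L j"] by simp
        moreover have "1 / scale (L j) \<le> 2 / scale (L j)" using scale_bounds(1)[of "L j"] by (simp add: divide_right_mono)
        ultimately show ?thesis unfolding j_def[symmetric] by linarith
      qed
    qed
    have "majorant \<psi> r \<le> 2 * \<psi> r + 2 * \<psi> (scale (L j))"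
    proof (rule majorant_least)
      fix s assume s: "r \<le> s" "s < 1"
      have s0: "0 < s" using s r by simp
      define i where "i = level s"
      note ls = level_bounds[OF s0 s(2), folded i_def]
      show "\<psi> s \<le> 2 * \<psi> r + 2 * \<psi> (scale (L j))"
      \<comment> \<open>If the levels differ by at most one, the logarithms at \<open>r\<close> and
        \<open>s\<close> differ at most by a factor 4 and \<open>r\<close> itself serves. Otherwise
        \<open>s\<close> is rounded down to \<open>scale (i + 1)\<close>, one of the scales over
        which \<open>L j\<close> maximizes, at the cost of at most doubling the logarithm.\<close>
      proof (cases "j \<le> i + 1")
        case True
        then have "(2::real) ^ (j + 1) \<le> 2 ^ (i + 2)" by (intro power_increasing) auto
        then have "2 ^ (j + 1) * ln 2 \<le> 4 * (2 ^ i * ln (2::real))"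
          using mult_right_mono[of "2 ^ (j + 1)" "2 ^ (i + 2)" "ln (2::real)"] by simp
        then have "ln (2 / r) \<le> 4 * ln (2 / s)" using jr(2) ls(1) by linarith
        then have "\<psi> s \<le> 2 * \<psi> r" unfolding \<psi>_def using r s by (intro decr_over_weight_compare \<phi>) auto
        then show ?thesis by (simp add: add_increasing2)
      next
        case False
        define l where "l = i + 1"
        have l: "1 \<le> l" "l < j" using False by (auto simp: l_def)
        have "ln (2 / s) < ln (2 / scale l)" using ls(2) by (simp add: ln_scale l_def)
        then have "scale l \<le> s" using s0 scale_bounds(1)[of l] by (simp add: field_simps)
        moreover have "ln (2 / scale l) = 2 * (2 ^ i * ln 2)" by (simp add: ln_scale l_def)
        then have "ln (2 / scale l) \<le> 4 * ln (2 / s)" using ls(1) ln_2_div_pos[OF s0] s by linarith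
        ultimately have "\<psi> s \<le> 2 * \<psi> (scale l)" unfolding \<psi>_def
          using s scale_bounds(1)[of l] by (intro decr_over_weight_compare \<phi>) auto
        also have "\<dots> \<le> 2 * \<psi> (scale (L j))" using Lmax[OF l] by (intro mult_left_mono) auto
        finally show ?thesis by (simp add: add_increasing)
      qed
    qed
    then show "majorant (over \<phi>) r
       \<le> 2 * (\<phi> r * ennreal (1 / w r)) + 2 * (\<phi> (scale (L (level r))) * ennreal (1 / w (scale (L (level r)))))"
      by (simp add: \<psi>_def[abs_def] j_def)
  qed
qed

text \<open>From \<open>s\<close> to \<open>r\<close>, \<open>Q 1 F\<close> falls at least by the
  quotient of the logarithms, whereas \<open>w\<close> falls at most by its square root. For these
  functions division by \<open>w\<close> therefore keeps monotonicity.\<close>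

lemma decr_Q_1_over_weight:
  assumes F: "decr F"
  shows "decr (\<lambda>s. Q 1 F s * ennreal (1 / w s))"
proof (rule decrI)
  fix s r :: real assume sr: "0 < s" "s \<le> r" "r < 1"
  define a where "a = ln (2 / s)"
  define b where "b = ln (2 / r)"
  have b: "0 < b" "b \<le> a" using sr ln_2_div_pos[of r] ln_2_div_mono[of s r] by (auto simp: a_def b_def)
  have ws: "0 < w s" "0 < w r" using sr by (auto intro: weight_pos)
  have "sqrt (a / b) \<le> a / b" using b by (intro real_le_lsqrt) (auto simp: power2_eq_square field_simps intro: mult_mono)
  then have "w s \<le> w r * (a / b)"
    using weight_bounds(2)[of s r] sr ws mult_left_mono[of "sqrt (a / b)" "a / b" "w r"] by (simp add: a_def b_def)
  then have "b / a * (1 / w r) \<le> 1 / w s" using ws b by (simp add: field_simps)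
  have "Q 1 F r * ennreal (1 / w r) \<le> (ennreal (b / a) * Q 1 F s) * ennreal (1 / w r)"
    unfolding a_def b_def by (intro mult_right_mono Q_1_le F sr) simp
  also have "\<dots> = Q 1 F s * ennreal (b / a * (1 / w r))"
    using b ws by (subst ennreal_mult) (auto simp: mult_ac)
  also have "\<dots> \<le> Q 1 F s * ennreal (1 / w s)" using \<open>b / a * (1 / w r) \<le> 1 / w s\<close> by (intro mult_left_mono ennreal_leI) auto
  finally show "Q 1 F r * ennreal (1 / w r) \<le> Q 1 F s * ennreal (1 / w s)" .
qed

text \<open>\<open>w s / w b\<close> is at most \<open>ln (2 / s) / ln 2\<close>, and the quotient
  of logarithms from \<open>Q_1_le\<close> cancels this growth. With
  \<open>1 / b \<le> 2 / sqrt r\<close> and \<open>ln (2 / r) \<le> 8 * r powr (- 1 / 4)\<close> an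
  integrable power of \<open>r\<close> remains; 32 is \<open>2 * 2 * 8\<close>, the first 2 bounding
  \<open>1 / ln 2\<close>.\<close>

lemma weight_kernel_far:
  assumes "0 < s" "s \<le> r" "r < 1" "0 < b" "b < 1" "1 / b \<le> 2 / sqrt r"
  shows "w s * (1 / (b * w b)) * (ln (2 / r) / ln (2 / s)) \<le> 32 * r powr (- 3 / 4)"
proof -
  define a where "a = ln (2 / s)"
  have l2: "1 / 2 \<le> ln (2::real)" "0 < ln (2::real)" using ln2_ge_two_thirds by simp_all
  have a: "ln 2 \<le> a" unfolding a_def using assms by (intro ln_2_div_ge) auto
  have ws: "0 < w s" "0 < w b" using assms by (auto intro: weight_pos)
  have "w s / w b \<le> sqrt (a / ln 2)"
  proof (cases "s \<le> b")
    case True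
    have "w s \<le> w b * sqrt (a / ln (2 / b))" using weight_bounds(2)[of s b] True assms by (simp add: a_def)
    also have "\<dots> \<le> w b * sqrt (a / ln 2)"
      using a l2 assms ws ln_2_div_ge[of b]
      by (intro mult_left_mono real_sqrt_le_mono divide_left_mono mult_pos_pos ln_2_div_pos) auto
    finally show ?thesis using ws by (simp add: field_simps)
  next
    case False
    then have "w s \<le> w b" using assms by (intro weight_bounds(1)) auto
    then have "w s / w b \<le> 1" using ws by simp
    also have "1 \<le> sqrt (a / ln 2)" using a l2 by simp
    finally show ?thesis .
  qed
  moreover have "sqrt z \<le> z" if "1 \<le> z" for z :: real
    using that mult_left_mono[of 1 z z] by (intro real_le_lsqrt) (auto simp: power2_eq_square)
  then have "sqrt (a / ln 2) \<le> a / ln 2" using a l2 by simp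
  ultimately have wr: "w s / w b \<le> a / ln 2" by linarith
  have lr: "0 \<le> ln (2 / r)" using assms by simp
  have "w s * (1 / (b * w b)) * (ln (2 / r) / a) = (w s / w b) * (1 / b) * (ln (2 / r) / a)"
    by simp
  also have "\<dots> \<le> (a / ln 2) * (2 / sqrt r) * (ln (2 / r) / a)"
    using wr assms(1,2,4,6) lr a l2 ws by (intro mult_mono) auto
  also have "\<dots> = (1 / ln 2) * (2 * ln (2 / r) / sqrt r)" using a l2 by simp
  also have "\<dots> \<le> 2 * (2 * ln (2 / r) / sqrt r)"
    using l2 lr assms by (intro mult_right_mono) (auto simp: field_simps)
  also have "ln (2 / r) \<le> 8 * r powr (- 1 / 4)"
  proof -
    have "ln (2 / r) = 4 * ln ((2 / r) powr (1 / 4))" using assms by (simp add: ln_powr)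
    also have "\<dots> \<le> 4 * (2 / r) powr (1 / 4)" using assms ln_le_minus_one[of "(2 / r) powr (1 / 4)"] by simp
    also have "(2 / r) powr (1 / 4) = 2 powr (1 / 4) * r powr (- 1 / 4)"
      using assms by (simp add: powr_divide powr_minus field_simps)
    also have "2 powr (1 / 4) \<le> (2::real) powr 1" by (rule powr_mono) auto
    finally show ?thesis using assms by (simp add: mult_right_mono)
  qed
  then have "2 * (2 * ln (2 / r) / sqrt r) \<le> 2 * (2 * (8 * r powr (- 1 / 4)) / sqrt r)"
    using assms by (intro mult_left_mono divide_right_mono) auto
  also have "\<dots> = 32 * (r powr (- 1 / 4) * r powr (- 1 / 2))"
    using assms by (simp add: powr_half_sqrt powr_minus field_simps)
  also have "r powr (- 1 / 4) * r powr (- 1 / 2) = r powr (- 3 / 4)" by (simp flip: powr_add)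
  finally show ?thesis by (simp add: a_def)
qed

text \<open>\<open>ln x \<le> x - 1\<close> and \<open>ln (2 / b) \<ge> 1 / 2\<close> give
  \<open>ln (2 / s) / ln (2 / b) \<le> 2 * (b / s)\<close>. Its square root leaves the singularity
  \<open>s powr (- 1 / 2)\<close>, whose integral \<open>2 * sqrt b\<close> over
  \<open>(0, b)\<close> cancels the factor \<open>1 / sqrt b\<close>.\<close>

lemma weight_kernel_near:
  assumes "0 < s" "s < b" "b < 1"
  shows "w s * (1 / (b * w b)) \<le> 2 / sqrt b * s powr (- 1 / 2)"
proof -
  have l2: "1 / 2 \<le> ln (2::real)" using ln2_ge_two_thirds by simp
  have ws: "0 < w s" "0 < w b" using assms by (auto intro: weight_pos)
  have lb: "1 / 2 \<le> ln (2 / b)" using assms by (intro order_trans[OF l2 ln_2_div_ge]) auto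
  define x where "x = b / s"
  define l where "l = ln (2 / b)"
  have x: "1 \<le> x" using assms by (simp add: x_def)
  have "(x - 1) * 1 \<le> (x - 1) * (2 * l)" using lb x by (intro mult_left_mono) (auto simp: l_def)
  also have "\<dots> = 2 * (x * l) - 2 * l" by (simp add: left_diff_distrib)
  finally have x1: "x - 1 \<le> 2 * (x * l) - 2 * l" by simp
  have "ln (2 / s) = l + ln x" using assms by (simp add: x_def l_def ln_div)
  also have "\<dots> \<le> l + (x - 1)" using x by (intro add_left_mono ln_le_minus_one) simp
  also have "\<dots> \<le> l + (2 * (x * l) - 2 * l)" by (rule add_left_mono[OF x1])
  also have "\<dots> \<le> 2 * (x * l)" using lb by (simp add: l_def)
  finally have "ln (2 / s) \<le> 2 * (x * l)" .
  then have "ln (2 / s) \<le> 2 * x * l" by simp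
  then have "ln (2 / s) / l \<le> 2 * x" using lb by (simp add: l_def pos_divide_le_eq)
  then have "ln (2 / s) / ln (2 / b) \<le> 2 * (b / s)" by (simp add: l_def x_def)
  also have "\<dots> \<le> (2 * sqrt (b / s))\<^sup>2" using assms by (simp add: power_mult_distrib divide_right_mono)
  finally have "sqrt (ln (2 / s) / ln (2 / b)) \<le> 2 * sqrt (b / s)" using assms by (intro real_le_lsqrt) auto
  then have "w b * sqrt (ln (2 / s) / ln (2 / b)) \<le> w b * (2 * sqrt (b / s))"
    by (rule mult_left_mono) (use ws in simp)
  then have "w s \<le> w b * (2 * sqrt (b / s))" using weight_bounds(2)[of s b] assms by linarith
  then have "w s * (1 / (b * w b)) \<le> w b * (2 * sqrt (b / s)) * (1 / (b * w b))"
    using ws assms by (intro mult_right_mono) auto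
  also have "\<dots> = 2 * (sqrt b / b) * (1 / sqrt s)" using ws by (simp add: real_sqrt_divide)
  also have "sqrt b / b = 1 / sqrt b" using assms by (simp add: field_simps)
  also have "1 / sqrt s = s powr (- 1 / 2)" using assms by (simp add: powr_half_sqrt powr_minus field_simps)
  finally show ?thesis by simp
qed

text \<open>For given \<open>F\<close> and \<open>\<phi>\<close>, averaging \<open>Q 1 F / w\<close> over the intervals on which the majorant of
  \<open>\<phi> / w\<close> is attained far to the right yields a decreasing function \<open>f\<close> which is nearly extremal
  for \<open>\<phi>\<close>, while \<open>w f\<close> stays dominated by \<open>Q 1 F\<close>.\<close>

lemma majorant_test_function:
  assumes F: "decr F" and \<phi>: "decr \<phi>"
  obtains f where "decr f"
    "(\<integral>\<^sub>1r. Q 1 F r * majorant (over \<phi>) r) \<le> ennreal 2 * (\<integral>\<^sub>1s. f s * \<phi> s)"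
    "\<And>t. 0 < t \<Longrightarrow> t \<le> 1 \<Longrightarrow> (\<integral>\<^sub>1s. ennreal (w s) * f s * indicator {..<t} s)
        \<le> ennreal 133 * (\<integral>\<^sub>1s. Q 1 F s * indicator {..<t} s)"
proof -
  obtain \<gamma> :: "nat \<Rightarrow> real" where \<gamma>: "\<And>j. 0 < \<gamma> j" "\<And>j. \<gamma> j < 1"
    "\<And>r. 0 < r \<Longrightarrow> r < 1 \<Longrightarrow> 1 / \<gamma> (level r) \<le> 2 / sqrt r"
    and sel: "\<And>r. 0 < r \<Longrightarrow> r < 1 \<Longrightarrow> majorant (over \<phi>) r
       \<le> 2 * (\<phi> r * ennreal (1 / w r)) + 2 * (\<phi> (\<gamma> (level r)) * ennreal (1 / w (\<gamma> (level r))))"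
    using majorant_selection[OF \<phi>] by blast
  define q where "q = Q 1 F"
  define b where "b r = \<gamma> (level r)" for r
  \<comment> \<open>The height of a block over \<open>(0, b r)\<close> of mass
    \<open>1 / w (b r)\<close>. As \<phi> decreases, the block pairs with it to at least
    \<open>\<phi> (b r) / w (b r)\<close>.\<close>
  define a where "a r = ennreal (1 / (b r * w (b r)))" for r
  define i :: "real \<Rightarrow> real \<Rightarrow> ennreal" where "i s r = (if s < b r then 1 else 0)" for s r
  define f2 where "f2 s = (\<integral>\<^sub>1r. q r * a r * i s r)" for s
  define f where "f s = q s * ennreal (1 / w s) + f2 s" for s
  have b: "0 < b r" "b r < 1" for r using \<gamma> by (auto simp: b_def)
  have wb: "0 < w (b r)" for r using b[of r] by (intro weight_pos) auto
  have [measurable]: "b \<in> borel_measurable unit_int" unfolding b_def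
    by (rule measurable_compose[OF level_measurable]) simp
  have [measurable]: "a \<in> borel_measurable unit_int" unfolding a_def b_def
    by (rule measurable_compose[OF level_measurable]) simp
  have [measurable]: "(\<lambda>r. \<phi> (b r) * ennreal (1 / w (b r))) \<in> M_plus" unfolding b_def
    by (rule measurable_compose[OF level_measurable]) simp
  have [measurable]: "q \<in> M_plus" unfolding q_def by (rule decr_measurable[OF decr_Q])
  have [measurable]: "\<phi> \<in> M_plus" by (rule decr_measurable[OF \<phi>])
  have i_meas [measurable]: "(\<lambda>(s, r). i s r) \<in> borel_measurable (unit_int \<Otimes>\<^sub>M unit_int)"
    unfolding i_def by measurable
  have [measurable]: "(\<lambda>(r, s). i s r) \<in> borel_measurable (unit_int \<Otimes>\<^sub>M unit_int)"
    unfolding i_def by measurable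
  have [measurable]: "(\<lambda>r. i s r) \<in> M_plus" "(\<lambda>s. i s r) \<in> M_plus" for s r unfolding i_def by measurable
  have f2: "decr f2" unfolding f2_def
    by (rule decrI, rule unit_integral_mono) (auto simp: i_def)
  have q_div: "decr (\<lambda>s. q s * ennreal (1 / w s))" unfolding q_def by (rule decr_Q_1_over_weight[OF F])
  have [measurable]: "f2 \<in> M_plus" by (rule decr_measurable[OF f2])
  show thesis
  proof (rule that[of f])
    show "decr f" unfolding f_def by (intro decr_add q_div f2)
    have far: "(\<integral>\<^sub>1r. q r * (\<phi> (b r) * ennreal (1 / w (b r)))) \<le> (\<integral>\<^sub>1s. f2 s * \<phi> s)"
    proof -
      have "(\<integral>\<^sub>1r. q r * (\<phi> (b r) * ennreal (1 / w (b r))))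
          \<le> (\<integral>\<^sub>1r. q r * a r * (\<integral>\<^sub>1s. i s r * \<phi> s))"
      proof (rule nn_integral_mono)
        fix r
        have "\<phi> (b r) * ennreal (b r) = (\<integral>\<^sub>1s. \<phi> (b r) * indicator {0<..<b r} s)"
        proof -
          have "{0<..<b r} \<in> sets unit_int" using b[of r] by (intro sets_unit_intI) auto
          then show ?thesis using b[of r] by (simp add: nn_integral_cmult_indicator emeasure_unit_int_interval)
        qed
        also have "\<dots> \<le> (\<integral>\<^sub>1s. i s r * \<phi> s)"
          using b[of r] by (intro unit_integral_mono) (auto simp: i_def split: split_indicator intro!: decrD[OF \<phi>])
        finally have "a r * (\<phi> (b r) * ennreal (b r)) \<le> a r * (\<integral>\<^sub>1s. i s r * \<phi> s)"
          by (rule mult_left_mono) simp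
        moreover have "a r * ennreal (b r) = ennreal (1 / w (b r))"
          using b[of r] wb[of r] by (simp add: a_def flip: ennreal_mult)
        ultimately have "\<phi> (b r) * ennreal (1 / w (b r)) \<le> a r * (\<integral>\<^sub>1s. i s r * \<phi> s)"
          by (metis mult.left_commute)
        then show "q r * (\<phi> (b r) * ennreal (1 / w (b r))) \<le> q r * a r * (\<integral>\<^sub>1s. i s r * \<phi> s)"
          by (simp add: mult.assoc mult_left_mono)
      qed
      also have "\<dots> = (\<integral>\<^sub>1r. (\<integral>\<^sub>1s. q r * a r * i s r * \<phi> s))"
        by (intro nn_integral_cong) (subst nn_integral_cmult[symmetric], auto simp: mult_ac)
      also have "\<dots> = (\<integral>\<^sub>1s. (\<integral>\<^sub>1r. q r * a r * i s r * \<phi> s))"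
        by (rule unit_int2.Fubini') measurable
      also have "\<dots> = (\<integral>\<^sub>1s. f2 s * \<phi> s)" unfolding f2_def
        by (intro nn_integral_cong nn_integral_multc) measurable
      finally show ?thesis .
    qed
    have "(\<integral>\<^sub>1r. q r * majorant (over \<phi>) r)
        \<le> (\<integral>\<^sub>1r. 2 * (q r * ennreal (1 / w r) * \<phi> r) + 2 * (q r * (\<phi> (b r) * ennreal (1 / w (b r)))))"
    proof (rule unit_integral_mono)
      fix r :: real assume "0 < r" "r < 1"
      then have "q r * majorant (over \<phi>) r
          \<le> q r * (2 * (\<phi> r * ennreal (1 / w r)) + 2 * (\<phi> (b r) * ennreal (1 / w (b r))))"
        unfolding b_def by (intro mult_left_mono sel) auto
      then show "q r * majorant (over \<phi>) r
          \<le> 2 * (q r * ennreal (1 / w r) * \<phi> r) + 2 * (q r * (\<phi> (b r) * ennreal (1 / w (b r))))"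
        by (simp add: distrib_left mult_ac)
    qed
    also have "\<dots> = 2 * (\<integral>\<^sub>1r. q r * ennreal (1 / w r) * \<phi> r)
        + 2 * (\<integral>\<^sub>1r. q r * (\<phi> (b r) * ennreal (1 / w (b r))))"
      by (subst nn_integral_add, measurable, subst (1 2) nn_integral_cmult, measurable)
    also have "\<dots> \<le> 2 * (\<integral>\<^sub>1r. q r * ennreal (1 / w r) * \<phi> r) + 2 * (\<integral>\<^sub>1s. f2 s * \<phi> s)"
      by (intro add_left_mono mult_left_mono far) simp
    also have "\<dots> = ennreal 2 * (\<integral>\<^sub>1s. f s * \<phi> s)"
      by (simp add: f_def distrib_right nn_integral_add distrib_left)
    finally show "(\<integral>\<^sub>1r. Q 1 F r * majorant (over \<phi>) r) \<le> ennreal 2 * (\<integral>\<^sub>1s. f s * \<phi> s)"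
      by (simp add: q_def)
    fix t :: real assume t: "0 < t" "t \<le> 1"
    define u :: "real \<Rightarrow> ennreal" where "u s = indicator {..<t} s" for s
    have [measurable]: "u \<in> M_plus" unfolding u_def by measurable
    \<comment> \<open>The kernel is split at the diagonal. For \<open>s \<le> r\<close>,
      \<open>q r\<close> is bounded by \<open>q s\<close>, and the integral over \<open>r\<close> is
      estimated for each \<open>s\<close>; for \<open>r < s\<close>, the integrals are interchanged
      and the one over \<open>s\<close> is estimated for each \<open>r\<close>.\<close>
    define K1 where "K1 s r = ennreal (w s) * (q r * a r) * i s r * u s * (if s \<le> r then 1 else 0)" for s r
    define K2 where "K2 s r = ennreal (w s) * (q r * a r) * i s r * u s * (if r < s then 1 else 0)" for s r
    have K1_meas [measurable]: "(\<lambda>(s, r). K1 s r) \<in> borel_measurable (unit_int \<Otimes>\<^sub>M unit_int)"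
      unfolding K1_def by measurable
    have K2_meas [measurable]: "(\<lambda>(s, r). K2 s r) \<in> borel_measurable (unit_int \<Otimes>\<^sub>M unit_int)"
      unfolding K2_def by measurable
    have K_r [measurable]: "(\<lambda>r. K1 s r) \<in> M_plus" "(\<lambda>r. K2 s r) \<in> M_plus" for s
      unfolding K1_def K2_def by measurable
    have K2_swap [measurable]: "(\<lambda>(r, s). K2 s r) \<in> borel_measurable (unit_int \<Otimes>\<^sub>M unit_int)"
      unfolding K2_def by measurable
    have meas1 [measurable]: "(\<lambda>s. \<integral>\<^sub>1r. K1 s r) \<in> M_plus" "(\<lambda>s. \<integral>\<^sub>1r. K2 s r) \<in> M_plus"
      by measurable
    have part1: "(\<integral>\<^sub>1s. (\<integral>\<^sub>1r. K1 s r)) \<le> ennreal 128 * (\<integral>\<^sub>1s. q s * u s)"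
    proof -
      have "(\<integral>\<^sub>1r. K1 s r) \<le> ennreal 128 * (q s * u s)" if s: "0 < s" "s < 1" for s
      proof -
        have "(\<integral>\<^sub>1r. K1 s r) \<le> (\<integral>\<^sub>1r. (ennreal 32 * (q s * u s)) * (ennreal (r powr (- 3 / 4)) * indicator {0<..<1} r))"
        proof (rule unit_integral_mono)
          fix r :: real assume r: "0 < r" "r < 1"
          show "K1 s r \<le> (ennreal 32 * (q s * u s)) * (ennreal (r powr (- 3 / 4)) * indicator {0<..<1} r)"
          proof (cases "s \<le> r")
            case True
            define c where "c = ln (2 / r) / ln (2 / s)"
            have c: "0 \<le> c" using r s by (simp add: c_def)
            have ws: "0 < w s" using s by (intro weight_pos) auto
            have "K1 s r \<le> ennreal (w s) * (q r * a r) * u s"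
              by (simp add: K1_def i_def)
            also have "\<dots> \<le> ennreal (w s) * ((ennreal c * q s) * a r) * u s"
              unfolding q_def c_def using True r s by (intro mult_right_mono mult_left_mono Q_1_le F) auto
            also have "\<dots> = ennreal (w s * (1 / (b r * w (b r))) * c) * (q s * u s)"
            proof -
              have mult3: "0 \<le> x \<Longrightarrow> ennreal (w s * x * c) = ennreal (w s) * ennreal x * ennreal c" for x
                using ws c by (simp add: ennreal_mult)
              have "ennreal (w s * (1 / (b r * w (b r))) * c) = ennreal (w s) * a r * ennreal c"
                unfolding a_def by (rule mult3) (use b[of r] wb[of r] in simp)
              then show ?thesis by (simp only: mult_ac)
            qed
            also have "\<dots> \<le> ennreal (32 * r powr (- 3 / 4)) * (q s * u s)"
              unfolding c_def using True r s b[of r] \<gamma>(3)[OF r]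
              by (intro mult_right_mono ennreal_leI weight_kernel_far) (auto simp: b_def)
            also have "\<dots> = (ennreal 32 * (q s * u s)) * (ennreal (r powr (- 3 / 4)) * indicator {0<..<1} r)"
              using r by (simp add: ennreal_mult mult_ac)
            finally show ?thesis .
          qed (simp add: K1_def)
        qed
        also have "\<dots> = (ennreal 32 * (q s * u s)) * ennreal 4"
          by (subst nn_integral_cmult) (simp_all add: unit_int_powr)
        also have "\<dots> = (ennreal 32 * ennreal 4) * (q s * u s)" by (simp only: mult_ac)
        also have "ennreal 32 * ennreal 4 = ennreal 128" by (subst ennreal_mult[symmetric]) auto
        finally show ?thesis .
      qed
      then have "(\<integral>\<^sub>1s. (\<integral>\<^sub>1r. K1 s r)) \<le> (\<integral>\<^sub>1s. ennreal 128 * (q s * u s))"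
        by (rule unit_integral_mono)
      also have "\<dots> = ennreal 128 * (\<integral>\<^sub>1s. q s * u s)" by (rule nn_integral_cmult) measurable
      finally show ?thesis .
    qed
    have part2: "(\<integral>\<^sub>1s. (\<integral>\<^sub>1r. K2 s r)) \<le> ennreal 4 * (\<integral>\<^sub>1s. q s * u s)"
    proof -
      have "(\<integral>\<^sub>1s. K2 s r) \<le> ennreal 4 * (q r * u r)" if r: "0 < r" "r < 1" for r
      proof -
        have "(\<integral>\<^sub>1s. K2 s r)
            \<le> (\<integral>\<^sub>1s. (ennreal (2 / sqrt (b r)) * (q r * u r)) * (ennreal (s powr (- 1 / 2)) * indicator {0<..<b r} s))"
        proof (rule unit_integral_mono)
          fix s :: real assume s: "0 < s" "s < 1"
          show "K2 s r \<le> (ennreal (2 / sqrt (b r)) * (q r * u r)) * (ennreal (s powr (- 1 / 2)) * indicator {0<..<b r} s)"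
          proof (cases "r < s \<and> s < b r \<and> s < t")
            case True
            have ws: "0 < w s" using s by (intro weight_pos) auto
            \<comment> \<open>\<open>r < s < t\<close> gives \<open>u r = 1\<close>, so the cut-off
              can be carried by the outer variable \<open>r\<close>.\<close>
            have "K2 s r = ennreal (w s * (1 / (b r * w (b r)))) * (q r * u r)"
              using True r ws b[of r] wb[of r] by (subst ennreal_mult) (auto simp: K2_def i_def u_def a_def mult_ac)
            also have "\<dots> \<le> ennreal (2 / sqrt (b r) * s powr (- 1 / 2)) * (q r * u r)"
              using True s b[of r] by (intro mult_right_mono ennreal_leI weight_kernel_near) auto
            also have "\<dots> = (ennreal (2 / sqrt (b r)) * (q r * u r)) * (ennreal (s powr (- 1 / 2)) * indicator {0<..<b r} s)"
              using True s b[of r] by (subst ennreal_mult) (auto simp: mult_ac)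
            finally show ?thesis .
          next
            case False
            then have "K2 s r = 0" by (auto simp: K2_def i_def u_def)
            then show ?thesis by simp
          qed
        qed
        also have "\<dots> = (ennreal (2 / sqrt (b r)) * (q r * u r)) * ennreal (b r powr (- 1 / 2 + 1) / (- 1 / 2 + 1))"
          using b[of r] by (subst nn_integral_cmult) (simp_all add: unit_int_powr)
        also have "\<dots> = (ennreal (2 / sqrt (b r)) * ennreal (b r powr (- 1 / 2 + 1) / (- 1 / 2 + 1))) * (q r * u r)"
          by (simp only: mult_ac)
        also have "ennreal (2 / sqrt (b r)) * ennreal (b r powr (- 1 / 2 + 1) / (- 1 / 2 + 1)) = ennreal 4"
          using b[of r] by (subst ennreal_mult[symmetric]) (auto simp: powr_half_sqrt)
        finally show ?thesis .
      qed
      then have "(\<integral>\<^sub>1r. (\<integral>\<^sub>1s. K2 s r)) \<le> (\<integral>\<^sub>1r. ennreal 4 * (q r * u r))"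
        by (rule unit_integral_mono)
      also have "\<dots> = ennreal 4 * (\<integral>\<^sub>1s. q s * u s)" by (rule nn_integral_cmult) measurable
      finally show ?thesis using unit_int2.Fubini'[OF K2_meas] by simp
    qed
    have "(\<integral>\<^sub>1s. ennreal (w s) * f s * u s)
        = (\<integral>\<^sub>1s. q s * u s + ((\<integral>\<^sub>1r. K1 s r) + (\<integral>\<^sub>1r. K2 s r)))"
    proof (rule unit_integral_cong)
      fix s :: real assume s: "0 < s" "s < 1"
      have "ennreal (w s) * ennreal (1 / w s) = 1" using weight_pos[of s] s by (simp flip: ennreal_mult)
      then have 1: "ennreal (w s) * (q s * ennreal (1 / w s)) = q s" by (metis mult.commute mult.left_commute mult_1)
      have "ennreal (w s) * f2 s * u s = (\<integral>\<^sub>1r. (ennreal (w s) * u s) * (q r * a r * i s r))"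
        unfolding f2_def by (subst nn_integral_cmult) (auto simp: mult_ac)
      also have "\<dots> = (\<integral>\<^sub>1r. K1 s r + K2 s r)"
        by (rule nn_integral_cong) (auto simp: K1_def K2_def mult_ac)
      also have "\<dots> = (\<integral>\<^sub>1r. K1 s r) + (\<integral>\<^sub>1r. K2 s r)"
        by (rule nn_integral_add) measurable
      finally show "ennreal (w s) * f s * u s = q s * u s + ((\<integral>\<^sub>1r. K1 s r) + (\<integral>\<^sub>1r. K2 s r))"
        using 1 by (simp add: f_def distrib_left distrib_right)
    qed
    also have "\<dots> = (\<integral>\<^sub>1s. q s * u s)
        + ((\<integral>\<^sub>1s. (\<integral>\<^sub>1r. K1 s r)) + (\<integral>\<^sub>1s. (\<integral>\<^sub>1r. K2 s r)))"
      by (subst nn_integral_add, measurable, subst nn_integral_add, measurable)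
    also have "\<dots> \<le> (\<integral>\<^sub>1s. q s * u s)
        + (ennreal 128 * (\<integral>\<^sub>1s. q s * u s) + ennreal 4 * (\<integral>\<^sub>1s. q s * u s))"
      by (intro add_left_mono add_mono part1 part2)
    also have "\<dots> = (1 + (ennreal 128 + ennreal 4)) * (\<integral>\<^sub>1s. q s * u s)"
      by (simp only: distrib_right mult_1)
    \<comment> \<open>The summands belong to \<open>q / w\<close>, to \<open>K1\<close> (32 times 4,
      the integral of \<open>r powr (- 3 / 4)\<close>) and to \<open>K2\<close>.\<close>
    also have "1 + (ennreal 128 + ennreal 4) = ennreal 133"
      by (simp flip: ennreal_1 ennreal_plus del: ennreal_numeral)
    finally show "(\<integral>\<^sub>1s. ennreal (w s) * f s * indicator {..<t} s)
        \<le> ennreal 133 * (\<integral>\<^sub>1s. Q 1 F s * indicator {..<t} s)"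
      by (simp add: u_def q_def)
  qed
qed

text \<open>The dual functions \<open>g\<close> decrease, so Hardy's lemma replaces
  \<open>w f\<close> by \<open>C\<close> times \<open>Q 1 F\<close>; duality then turns the pairing
  of \<open>Q 1 F\<close> with \<open>g\<close> into that of \<open>F\<close> with
  \<open>S 1 g\<close>, which is at most 1.\<close>

lemma X_norm_test_function:
  assumes Y: "weak_norm Y" and F: "decr F" "Y F \<le> 1" and f: "decr f"
    and dom: "\<And>t. 0 < t \<Longrightarrow> t \<le> 1 \<Longrightarrow> (\<integral>\<^sub>1s. ennreal (w s) * f s * indicator {..<t} s)
        \<le> ennreal C * (\<integral>\<^sub>1s. Q 1 F s * indicator {..<t} s)"
  shows "X_norm \<Phi> 1 Y f \<le> ennreal C"
proof (rule X_norm_least[OF Y])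
  fix g assume g: "decr g" "assoc Y (S 1 g) \<le> 1"
  have [measurable]: "g \<in> M_plus" "f \<in> M_plus" "F \<in> M_plus" "Q 1 F \<in> M_plus"
    using g(1) f F(1) decr_Q by (auto intro: decr_measurable)
  have "(\<integral>\<^sub>1s. ennreal (w s ^ 1) * rearr01 f s * g s) = (\<integral>\<^sub>1s. rearr01 f s * (ennreal (w s) * g s))"
    by (simp add: mult_ac)
  also have "\<dots> = (\<integral>\<^sub>1s. f s * (ennreal (w s) * g s))"
    by (rule nn_integral_rearr01_decr[OF f]) measurable
  also have "\<dots> = (\<integral>\<^sub>1s. g s * (ennreal (w s) * f s))" by (simp add: mult_ac)
  also have "\<dots> \<le> (\<integral>\<^sub>1s. g s * (ennreal C * Q 1 F s))"
  proof (rule hardy[OF g(1)])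
    fix t :: real assume t: "0 < t" "t \<le> 1"
    have "ennreal C * (\<integral>\<^sub>1s. Q 1 F s * indicator {..<t} s) = (\<integral>\<^sub>1s. ennreal C * Q 1 F s * indicator {..<t} s)"
      by (subst nn_integral_cmult[symmetric]) (measurable, simp only: mult.assoc)
    then show "(\<integral>\<^sub>1s. ennreal (w s) * f s * indicator {..<t} s)
        \<le> (\<integral>\<^sub>1s. ennreal C * Q 1 F s * indicator {..<t} s)" using dom[OF t] by simp
  qed measurable
  also have "\<dots> = ennreal C * (\<integral>\<^sub>1s. Q 1 F s * g s)"
    by (subst nn_integral_cmult[symmetric]) (measurable, simp only: mult_ac)
  also have "(\<integral>\<^sub>1s. Q 1 F s * g s) = (\<integral>\<^sub>1s. F s * S 1 g s)"
    by (rule S_Q_dual[symmetric]) measurable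
  also have "\<dots> \<le> assoc Y (S 1 g)" unfolding assoc_def using F(2) by (intro SUP_upper) auto
  also have "\<dots> \<le> 1" by (rule g(2))
  finally show "(\<integral>\<^sub>1s. ennreal (w s ^ 1) * rearr01 f s * g s) \<le> ennreal C"
    by (simp add: mult_left_mono)
qed simp

text \<open>The constant is \<open>2 * 2 * 133 * h\<close>: one 2 from \<open>S_majorant\<close>,
  the other from the selection behind \<open>majorant_test_function\<close>, 133 from the norm of
  the test function and \<open>h\<close> from \<open>S_1_S\<close>.\<close>

lemma X_norm_iterate_upper:
  assumes Y: "weak_norm Y" and h: "1 \<le> h"
  shows "X_norm \<Phi> h (X_norm \<Phi> 1 Y) f \<le> ennreal (532 * real h) * X_norm \<Phi> (1 + h) Y f"
proof (rule X_norm_least[OF X_norm_weak_norm[OF Y order_refl] h])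
  fix G assume G: "decr G" and XG: "assoc (X_norm \<Phi> 1 Y) (S h G) \<le> 1"
  define g where "g = majorant (over G)"
  have g: "decr g" unfolding g_def by (rule decr_majorant)
  have [measurable]: "g \<in> M_plus" "G \<in> M_plus" "S h G \<in> M_plus" "S h g \<in> M_plus" "S (1 + h) g \<in> M_plus"
    using g G decr_S by (auto intro: decr_measurable)
  have "assoc Y (S (1 + h) g) \<le> ennreal (532 * real h)"
  proof (rule assoc_least)
    fix F assume F [measurable]: "F \<in> M_plus" and YF: "Y F \<le> 1"
    \<comment> \<open>The test function is built from a decreasing \<open>F\<close>. Rearranging
      keeps \<open>F\<close> in the ball and does not decrease the pairing, by Hardy and
      Littlewood.\<close>
    define F' where "F' = rearr01 F"
    have F': "decr F'" unfolding F'_def by (rule decr_rearr01)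
    have [measurable]: "F' \<in> M_plus" "Q 1 F' \<in> M_plus" using F' decr_Q by (auto intro: decr_measurable)
    have YF': "Y F' \<le> 1" using Y F YF unfolding weak_norm_def F'_def by auto
    obtain k where k: "decr k"
      "(\<integral>\<^sub>1r. Q 1 F' r * majorant (over (S h G)) r) \<le> ennreal 2 * (\<integral>\<^sub>1s. k s * S h G s)"
      "\<And>t. 0 < t \<Longrightarrow> t \<le> 1 \<Longrightarrow> (\<integral>\<^sub>1s. ennreal (w s) * k s * indicator {..<t} s)
        \<le> ennreal 133 * (\<integral>\<^sub>1s. Q 1 F' s * indicator {..<t} s)"
      using majorant_test_function[OF F' decr_S[OF G, of h]] by blast
    have [measurable]: "k \<in> M_plus" by (rule decr_measurable[OF k(1)])
    have "X_norm \<Phi> 1 Y k \<le> ennreal 133" by (rule X_norm_test_function[OF Y F' YF' k(1,3)])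
    moreover have "X_norm \<Phi> 1 Y (\<lambda>x. ennreal (1 / 133) * k x) = ennreal (1 / 133) * X_norm \<Phi> 1 Y k"
      using X_norm_weak_norm[OF Y order_refl] \<open>k \<in> M_plus\<close> unfolding weak_norm_def by simp
    ultimately have "X_norm \<Phi> 1 Y (\<lambda>x. ennreal (1 / 133) * k x) \<le> ennreal (1 / 133) * ennreal 133"
      by (simp add: mult_left_mono)
    also have "\<dots> = 1" by (subst ennreal_mult[symmetric]) auto
    finally have "X_norm \<Phi> 1 Y (\<lambda>x. ennreal (1 / 133) * k x) \<le> 1" .
    then have "(\<integral>\<^sub>1s. (ennreal (1 / 133) * k s) * S h G s) \<le> assoc (X_norm \<Phi> 1 Y) (S h G)"
      unfolding assoc_def by (intro SUP_upper) auto
    also have "\<dots> \<le> 1" by (rule XG)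
    also have "(\<integral>\<^sub>1s. (ennreal (1 / 133) * k s) * S h G s) = ennreal (1 / 133) * (\<integral>\<^sub>1s. k s * S h G s)"
      by (subst nn_integral_cmult[symmetric]) (measurable, simp only: mult.assoc)
    finally have kG: "(\<integral>\<^sub>1s. k s * S h G s) \<le> ennreal 133" by (intro ennreal_le_scaled) auto
    have "(\<integral>\<^sub>1s. F s * S (1 + h) g s) \<le> (\<integral>\<^sub>1s. F' s * rearr01 (S (1 + h) g) s)"
      unfolding F'_def by (rule hardy_littlewood) measurable
    also have "\<dots> = (\<integral>\<^sub>1s. F' s * S (1 + h) g s)"
      using nn_integral_rearr01_decr[OF decr_S[OF g], of F'] by (simp add: mult.commute)
    also have "\<dots> = (\<integral>\<^sub>1s. ennreal (real h) * (F' s * S 1 (S h g) s))"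
    proof (rule unit_integral_cong)
      fix s :: real assume s: "0 < s" "s < 1"
      have "ennreal (real h) * S 1 (S h g) s = ennreal (real h) * (ennreal (1 / real h) * S (h + 1) g s)"
        using s h by (subst S_1_S) auto
      also have "\<dots> = S (1 + h) g s" using h by (simp add: mult.assoc[symmetric] add.commute flip: ennreal_mult)
      finally show "F' s * S (1 + h) g s = ennreal (real h) * (F' s * S 1 (S h g) s)" by (metis mult.left_commute)
    qed
    also have "\<dots> = ennreal (real h) * (\<integral>\<^sub>1s. F' s * S 1 (S h g) s)"
      using decr_measurable[OF decr_S[OF decr_S[OF g]]] by (intro nn_integral_cmult) measurable
    also have "(\<integral>\<^sub>1s. F' s * S 1 (S h g) s) = (\<integral>\<^sub>1s. Q 1 F' s * S h g s)"
      by (rule S_Q_dual) measurable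
    also have "ennreal (real h) * \<dots> \<le> ennreal (real h) * (ennreal 2 * (ennreal 2 * ennreal 133))"
    proof (rule mult_left_mono)
      have "(\<integral>\<^sub>1s. Q 1 F' s * S h g s)
          \<le> (\<integral>\<^sub>1s. ennreal 2 * (Q 1 F' s * majorant (over (S h G)) s))"
      proof (rule unit_integral_mono)
        fix s :: real assume s: "0 < s" "s < 1"
        have "Q 1 F' s * S h g s \<le> Q 1 F' s * (2 * majorant (over (S h G)) s)"
          unfolding g_def using s h by (intro mult_left_mono S_majorant G) auto
        then show "Q 1 F' s * S h g s \<le> ennreal 2 * (Q 1 F' s * majorant (over (S h G)) s)"
          by (simp add: mult_ac)
      qed
      also have "\<dots> = ennreal 2 * (\<integral>\<^sub>1s. Q 1 F' s * majorant (over (S h G)) s)"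
        using decr_measurable[OF decr_majorant] by (intro nn_integral_cmult) measurable
      also have "\<dots> \<le> ennreal 2 * (ennreal 2 * ennreal 133)"
        by (intro mult_left_mono order_trans[OF k(2)] kG) auto
      finally show "(\<integral>\<^sub>1s. Q 1 F' s * S h g s) \<le> ennreal 2 * (ennreal 2 * ennreal 133)" .
    qed simp
    also have "\<dots> = ennreal (532 * real h)"
      by (simp only: ennreal_mult[symmetric] of_nat_0_le_iff zero_le_numeral mult_nonneg_nonneg) simp
    finally show "(\<integral>\<^sub>1s. F s * S (1 + h) g s) \<le> ennreal (532 * real h)" .
  qed
  then have "(\<integral>\<^sub>1s. ennreal (w s ^ (1 + h)) * rearr01 f s * g s) \<le> ennreal (532 * real h) * X_norm \<Phi> (1 + h) Y f"
    using h by (intro X_norm_upper Y g) auto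
  moreover have "(\<integral>\<^sub>1s. ennreal (w s ^ h) * rearr01 f s * G s)
      \<le> (\<integral>\<^sub>1s. ennreal (w s ^ (1 + h)) * rearr01 f s * g s)"
  proof (rule unit_integral_mono)
    fix s :: real assume s: "0 < s" "s < 1"
    have ws: "0 < w s" using s by (intro weight_pos) auto
    have "ennreal (w s) * ennreal (1 / w s) = 1" using ws by (simp flip: ennreal_mult)
    then have "G s = ennreal (w s) * (G s * ennreal (1 / w s))" by (metis mult.commute mult.left_commute mult_1)
    also have "\<dots> \<le> ennreal (w s) * g s" unfolding g_def using s by (intro mult_left_mono majorant_upper) auto
    finally have "ennreal (w s ^ h) * rearr01 f s * G s \<le> ennreal (w s ^ h) * rearr01 f s * (ennreal (w s) * g s)"
      by (rule mult_left_mono) simp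
    also have "\<dots> = ennreal (w s ^ (1 + h)) * rearr01 f s * g s" using ws by (simp add: ennreal_mult mult_ac)
    finally show "ennreal (w s ^ h) * rearr01 f s * G s \<le> ennreal (w s ^ (1 + h)) * rearr01 f s * g s" .
  qed
  ultimately show "(\<integral>\<^sub>1s. ennreal (w s ^ h) * rearr01 f s * G s) \<le> ennreal (532 * real h) * X_norm \<Phi> (1 + h) Y f"
    by (rule order_trans[rotated])
qed

section \<open>Iteration\<close>

text \<open>Passing to the associate reverses the inequality, and taking the supremum over the
  associate ball reverses it again.\<close>

lemma X_norm_mono:
  assumes Y: "weak_norm Y" "weak_norm Y'" and h: "1 \<le> h" and c: "0 < c" "\<And>F. Y' F \<le> ennreal c * Y F"
  shows "X_norm \<Phi> h Y' f \<le> ennreal c * X_norm \<Phi> h Y f"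
proof (rule X_norm_least[OF Y(2) h])
  fix g assume g: "decr g" "assoc Y' (S h g) \<le> 1"
  have [measurable]: "S h g \<in> M_plus" by (rule decr_measurable[OF decr_S[OF g(1)]])
  have "assoc Y (S h g) \<le> ennreal c"
  proof (rule assoc_least)
    fix F assume F [measurable]: "F \<in> M_plus" and YF: "Y F \<le> 1"
    have "Y' (\<lambda>x. ennreal (1 / c) * F x) = ennreal (1 / c) * Y' F"
      using Y(2) F c(1) unfolding weak_norm_def by simp
    also have "\<dots> \<le> ennreal (1 / c) * (ennreal c * Y F)" by (intro mult_left_mono c(2)) simp
    also have "\<dots> \<le> 1" using YF by (simp add: ennreal_cancel(1)[OF c(1)])
    finally have "(\<integral>\<^sub>1s. (ennreal (1 / c) * F s) * S h g s) \<le> assoc Y' (S h g)"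
      unfolding assoc_def by (intro SUP_upper) auto
    then have "ennreal (1 / c) * (\<integral>\<^sub>1s. F s * S h g s) \<le> 1"
      using g(2) by (simp add: mult.assoc nn_integral_cmult)
    then show "(\<integral>\<^sub>1s. F s * S h g s) \<le> ennreal c" by (rule ennreal_le_scaled[OF c(1)])
  qed
  then show "(\<integral>\<^sub>1s. ennreal (w s ^ h) * rearr01 f s * g s) \<le> ennreal c * X_norm \<Phi> h Y f"
    by (intro X_norm_upper[OF Y(1) h g(1) c(1)])
qed

lemma X_norm_equiv:
  assumes "weak_norm Y" "weak_norm Y'" "1 \<le> h" "equiv_norms Y Y'"
  shows "equiv_norms (X_norm \<Phi> h Y) (X_norm \<Phi> h Y')"
proof -
  obtain c where c: "0 < c" "\<And>f. Y f \<le> ennreal c * Y' f" "\<And>f. Y' f \<le> ennreal c * Y f"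
    using assms(4) unfolding equiv_norms_def by blast
  show ?thesis
    by (rule equiv_normsI[OF c(1) c(1)]) (intro X_norm_mono assms c)+
qed

lemma X_norm_iterate_one:
  assumes "weak_norm Y" "1 \<le> h"
  shows "equiv_norms (X_norm \<Phi> h (X_norm \<Phi> 1 Y)) (X_norm \<Phi> (1 + h) Y)"
  using X_norm_iterate_upper[OF assms] X_norm_iterate_lower[OF assms] assms(2)
  by (intro equiv_normsI[of "532 * real h" 2]) auto

text \<open>\<open>Y\<close> is generalized because the induction hypothesis is applied to
  \<open>X_norm \<Phi> 1 Y\<close>. The one-step result is used twice: inside
  \<open>X_norm \<Phi> h\<close>, to split off one inner step, and at the end, to absorb that step
  again.\<close>

lemma X_norm_iterate:
  assumes "1 \<le> k" "weak_norm Y" "1 \<le> h"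
  shows "equiv_norms (X_norm \<Phi> h (X_norm \<Phi> k Y)) (X_norm \<Phi> (k + h) Y)"
  using assms
proof (induction k arbitrary: Y rule: nat_induct_at_least)
  case base
  then show ?case by (rule X_norm_iterate_one)
next
  case (Suc k)
  let ?Y = "X_norm \<Phi> 1 Y"
  have Y1: "weak_norm ?Y" using Suc.prems(1) by (intro X_norm_weak_norm) auto
  have "equiv_norms (X_norm \<Phi> (1 + k) Y) (X_norm \<Phi> k ?Y)"
    using Suc by (intro equiv_norms_sym[OF X_norm_iterate_one])
  then have "equiv_norms (X_norm \<Phi> h (X_norm \<Phi> (1 + k) Y)) (X_norm \<Phi> h (X_norm \<Phi> k ?Y))"
    using Suc.prems Suc.hyps Y1 by (intro X_norm_equiv X_norm_weak_norm) auto
  have "equiv_norms (X_norm \<Phi> h (X_norm \<Phi> k ?Y)) (X_norm \<Phi> (k + h) ?Y)"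
    by (rule Suc.IH[OF Y1 Suc.prems(2)])
  moreover have "equiv_norms (X_norm \<Phi> (k + h) ?Y) (X_norm \<Phi> (1 + (k + h)) Y)"
    using Suc by (intro X_norm_iterate_one) auto
  ultimately show ?case
    using \<open>equiv_norms (X_norm \<Phi> h (X_norm \<Phi> (1 + k) Y)) (X_norm \<Phi> h (X_norm \<Phi> k ?Y))\<close>
    by (auto intro: equiv_norms_trans)
qed

end

theorem theorem7p6:
  fixes \<Phi> :: "real \<Rightarrow> real"
    and X :: "(real \<Rightarrow> ennreal) \<Rightarrow> ennreal"
    and k h :: nat
  assumes "admissible \<Phi>" and "ri_norm X" and "k \<ge> 1" and "h \<ge> 1"
  shows "same_space_equiv_norms (mu_prod \<Phi> :: (real ^ 'n) measure)
           (X_norm \<Phi> h (X_norm \<Phi> k X)) (X_norm \<Phi> (k + h) X)"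
  by (intro equiv_norms_same_space X_norm_iterate ri_norm_weak_norm assms)

end
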